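(* Let $d\in\mathbb{N}$, $\lambda\in\mathbb{C}\setminus\{0\}$, and let $J=J(\lambda)$ be the $d\times d$ Jordan-ilk matrix with eigenvalue $\lambda$. Fix $\omega$ as described in the context. Let $f\colon\mathbb{H}\to\mathbb{C}^d$ be a smooth map such that $\Delta f=s(1-s)f$ for some $s\in\mathbb{C}$ and $f(z+1)=Jf(z)$ for all $z\in\mathbb{H}$. Then for all $z=x+\mathrm{i}y\in\mathbb{H}$, \[ f(x+\mathrm{i}y)=\sum_{n\in\mathbb{Z}} J^x\,\hat f_n(y,s)\,e^{2\pi\mathrm{i}nx}, \] where for each $n\in\mathbb{Z}$ there exist matrices $C_n,D_n$, belonging to $\mathrm{Coeff}_{0;d}$ if $\tilde\alpha_n=\alpha_n=0$ and to $\mathrm{Coeff}_{1;d}$ otherwise, such that for all $y>0$ \[ \hat f_n(y,s)=T\,C_n\,S^{\varepsilon_n}\begin{pmatrix}\mathbf I(d-1,\tilde\alpha_n,y,s)\\ \vdots\\ \mathbf I(1,\tilde\alpha_n,y,s)\\ \mathbf I(0,\tilde\alpha_n,y,s)\end{pmatrix}+T\,D_n\,S^{\varepsilon_n}\begin{pmatrix}\mathbf K(d-1,\tilde\alpha_n,y,s)\\ \vdots\\ \mathbf K(1,\tilde\alpha_n,y,s)\\ \mathbf K(0,\tilde\alpha_n,y,s)\end{pmatrix}. \]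
   Context: $\mathbb{H}=\{z=x+\mathrm{i}y\in\mathbb{C}: y>0\}$ and $\Delta=-y^2(\partial_x^2+\partial_y^2)$, acting componentwise on $\mathbb{C}^d$-valued functions. For $\mu\neq 0$, $J(\mu)$ is the $d\times d$ matrix with all entries on the diagonal and on the superdiagonal equal to $\mu$ and all other entries $0$. Logarithm: $\operatorname{Log} z=\log|z|+\mathrm{i}\arg z$ with $\arg z\in(-\pi,\pi]$. For $\omega\in\mathbb{C}\setminus[0,\infty)$ put $\Omega_\omega=(-\pi,\arg\omega)$ if $\arg\omega>0$ and $\Omega_\omega=(\arg\omega,\pi]$ if $\arg\omega<0$; define $\log(z;\omega)=\operatorname{Log} z$ if $\arg z\in\Omega_\omega$ and $\log(z;\omega)=\operatorname{Log}z-2\pi\mathrm{i}\,\mathrm{sgn}(\arg\omega)$ otherwise ($z\neq0$). Here $\omega\in\mathbb{C}\setminus[0,\infty)$ is chosen such that for every $n\in\mathbb{Z}$ at least one of $-\mathrm{i}\operatorname{Log}\lambda+2\pi n$ and $\mathrm{i}\operatorname{Log}\lambda-2\pi n$ is not in $\omega\mathbb{R}_{>0}$. Put $\lambda^x=e^{x\log(\lambda;\omega)}$ and let $J^x$ ($x\in\mathbb{R}$) be the upper triangular matrix with $(i,j)$ entry $\lambda^x\binom{x}{j-i}$ for $i\le j$, where $\binom{x}{p}=\frac1{p!}\prod_{\ell=0}^{p-1}(x-\ell)$. Bessel-type functions: for $\eta\in\mathbb{C}$, $I_\eta(z;\omega)=e^{\eta\log(z/2;\omega)}\sum_{m\ge0}\frac{(z/2)^{2m}}{m!\,\Gamma(\eta+m+1)}$;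 $K_\eta(z;\omega)=\frac{\pi}{2}\frac{I_{-\eta}(z;\omega)-I_\eta(z;\omega)}{\sin(\eta\pi)}$ for $\eta\notin\mathbb{Z}$ and $K_\eta(z;\omega)=\lim_{\xi\to\eta}K_\xi(z;\omega)$ for $\eta\in\mathbb{Z}$. For $m\in\mathbb{N}_0$, $\alpha\in\mathbb{C}\setminus\omega\mathbb{R}_{\ge0}$, $y>0$, $s\in\mathbb{C}$: $\mathbf I(m,\alpha,y,s)=y^{1/2}\mathrm{i}^{-m}\partial_\alpha^m\big(I_{s-1/2}(\alpha y;\omega)\big)$ and $\mathbf K(m,\alpha,y,s)=y^{1/2}\mathrm{i}^{-m}\partial_\alpha^m\big(K_{s-1/2}(\alpha y;\omega)\big)$, where $\partial_\alpha^m$ differentiates the function $\alpha\mapsto I_{s-1/2}(\alpha y;\omega)$ (resp. $K$). Case $\alpha=0$: $E(d)=\{\tfrac12\pm j: j=0,1,\dots,\lfloor\tfrac{d-1}{2}\rfloor\}$. For $k\in\mathbb{N}_0$, $s\in\mathbb{C}$ with $s\notin\{\tfrac12-j: 1\le j\le\lfloor k/2\rfloor\}$ let $\mathfrak p(k,s)=(-1)^{\lfloor k/2\rfloor}\frac{k!}{2^{\lfloor k/2\rfloor}\lfloor k/2\rfloor!\prod_{j=1}^{\lfloor k/2\rfloor}(2j+2s-1)}$ (empty product $=1$), and set $\mathfrak p(k,s)=1$ for the remaining $s$. For $s\in E(d)\cap(-\infty,\tfrac12]$ and $k\in\mathbb{N}_0$ define $\mathfrak q$: $\mathfrak q(0,\tfrac12)=\mathfrak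 q(1,\tfrac12)=1$; for $s\le-\tfrac12$, $\mathfrak q(0,s)=2s\,\mathfrak p(-2s-1,s)$, $\mathfrak q(1,s)=(2s-2)\mathfrak p(-2s,s)$; for $k\ge2$, $\mathfrak q(k,s)=-\frac14\frac{(1-2s+k)(-2s+k)}{\lfloor k/2\rfloor(\frac12-s+\lfloor k/2\rfloor)}\mathfrak q(k-2,s)$. Define $\mathfrak r(0,s)=\mathfrak r(1,s)=0$ and for $k\ge2$ $\mathfrak r(k,s)=-\frac{\frac12-s+2\lfloor k/2\rfloor}{2\lfloor k/2\rfloor(\frac12-s+\lfloor k/2\rfloor)}\mathfrak q(k,s)+\sum_{j=1}^{\lfloor k/2\rfloor-1}(-1)^{\lfloor k/2\rfloor+j+1}\frac{\frac12-s+2j}{2j(\frac12-s+j)}\frac{1}{4^{\lfloor k/2\rfloor-j}}\frac{\prod_{\ell=2j+1+\delta(k)}^{k}(1-2s+\ell)}{\prod_{\ell=j+1}^{\lfloor k/2\rfloor}\ell(\frac12-s+\ell)}\mathfrak q(2j+\delta(k),s)$, with $\delta(k)=1$ for $k$ odd and $0$ for $k$ even. For $m\in\mathbb{N}_0$, $y>0$: if $s\in E(d)\cap[\tfrac12-\tfrac m2,\tfrac12]$ then $\mathbf I(m,0,y,s)=\mathfrak q(m-1+2s,s)y^{s+2\lfloor m/2\rfloor}\log y+\mathfrak r(m-1+2s,s)y^{s+2\lfloor m/2\rfloor}$, otherwise $\mathbf I(m,0,y,s)=\mathfrak p(m,s)y^{s+2\lfloor m/2\rfloor}$; if $s\in E(d)\cap[\tfrac32,\tfrac12+\tfrac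 m2]$ then $\mathbf K(m,0,y,s)=\mathfrak q(m+1-2s,1-s)y^{1-s+2\lfloor m/2\rfloor}\log y+\mathfrak r(m+1-2s,1-s)y^{1-s+2\lfloor m/2\rfloor}$, otherwise $\mathbf K(m,0,y,s)=\mathfrak p(m,1-s)y^{1-s+2\lfloor m/2\rfloor}$. Matrices: $s(n,k)$ are the signed Stirling numbers of the first kind, $\prod_{\ell=0}^{n-1}(x-\ell)=\sum_{k=0}^n s(n,k)x^k$. $T=(t_{ij})_{i,j=1}^d$ with $t_{ij}=s(d-i,d-j)/(d-i)!$. $S=\mathrm{diag}((-1)^{d-1},(-1)^{d-2},\dots,-1,1)$. $\mathrm{Coeff}_{1;d}$ is the set of $(c_{ij})\in\mathbb{C}^{d\times d}$ with $c_{ij}=0$ for $i>j$ and $c_{i,i+p}=c_{1,1+p}\prod_{k=1}^{i-1}(d-p-k)/\prod_{k=1}^{i-1}(d-k)$ for $i\in\{1,\dots,d\}$, $p\in\{0,\dots,d-i\}$. $\mathrm{Coeff}_{0;d}$ is the set of $(c_{ij})\in\mathbb{C}^{d\times d}$ with $c_{i+2k,j+2k}=c_{ij}\prod_{p=0}^{2k-1}(d-(j+p))/\prod_{p=0}^{2k-1}(d-(i+p))$ for all $i,j,k$ for which the indices lie in $\{1,\dots,d\}$, and $c_{ij}=0$ for $i\in\{3,\dots,d\}$, $j\in\{1,\dots,2\lfloor\frac{i-1}{2}\rfloor\}$. Indices: $\alpha_n=2\pi n-\mathrm{i}\log(\lambda;\omega)$; $\varepsilon_n\in\{0,1\}$ is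 chosen with $(-1)^{\varepsilon_n}\alpha_n\notin\omega\mathbb{R}_{>0}$, and $\tilde\alpha_n=(-1)^{\varepsilon_n}\alpha_n$. *)

theory Defs
  imports "HOL-Analysis.Analysis" "Jordan_Normal_Form.Matrix"
begin

unbundle no vec_syntax

section \<open>Smooth functions and the hyperbolic Laplacian\<close>

definition upper_half_plane :: "complex set" where
  "upper_half_plane = {z. Im z > 0}"

text \<open>Differentiability is over the reals; on an open set, \<^term>\<open>Ck_on k\<close> is the
  class of $k$ times continuously differentiable functions.\<close>

primrec Ck_on :: "nat \<Rightarrow> 'a::real_normed_vector set \<Rightarrow> ('a \<Rightarrow> 'b::real_normed_vector) \<Rightarrow> bool" where
  "Ck_on 0 S g \<longleftrightarrow> continuous_on S g"
| "Ck_on (Suc k) S g \<longleftrightarrow>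
     (\<forall>z\<in>S. g differentiable (at z)) \<and> (\<forall>v. Ck_on k S (\<lambda>z. frechet_derivative g (at z) v))"

definition smooth_on :: "'a::real_normed_vector set \<Rightarrow> ('a \<Rightarrow> 'b::real_normed_vector) \<Rightarrow> bool" where
  "smooth_on S g \<longleftrightarrow> (\<forall>k. Ck_on k S g)"

definition dx :: "(complex \<Rightarrow> complex) \<Rightarrow> complex \<Rightarrow> complex" where
  "dx g z = frechet_derivative g (at z) 1"

definition dy :: "(complex \<Rightarrow> complex) \<Rightarrow> complex \<Rightarrow> complex" where
  "dy g z = frechet_derivative g (at z) \<i>"

definition hyp_laplacian :: "(complex \<Rightarrow> complex) \<Rightarrow> complex \<Rightarrow> complex" where
  "hyp_laplacian g z = - complex_of_real ((Im z)^2) * (dx (dx g) z + dy (dy g) z)"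

section \<open>The logarithm cut along the ray through \<open>\<omega>\<close>\<close>

definition open_ray :: "complex \<Rightarrow> complex set" where
  "open_ray \<omega> = {complex_of_real t * \<omega> | t. t > 0}"

text \<open>Used only for \<open>\<omega>\<close> outside $[0,\infty)$, so that \<open>Arg \<omega> \<noteq> 0\<close>.\<close>

definition log_args :: "complex \<Rightarrow> real set" where
  "log_args \<omega> = (if Arg \<omega> > 0 then {-pi<..<Arg \<omega>} else {Arg \<omega><..pi})"

definition log_cut :: "complex \<Rightarrow> complex \<Rightarrow> complex" where
  "log_cut \<omega> z =
     (if Arg z \<in> log_args \<omega> then Ln z
      else Ln z - 2 * complex_of_real pi * \<i> * complex_of_real (sgn (Arg \<omega>)))"

section \<open>Bessel functions and their parameter derivatives\<close>

text \<open>\<^const>\<open>rGamma\<close> is the reciprocal of the Gamma function, with value 0 at its poles.\<close>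

definition bessel_I :: "complex \<Rightarrow> complex \<Rightarrow> complex \<Rightarrow> complex" where
  "bessel_I \<omega> \<eta> z =
     exp (\<eta> * log_cut \<omega> (z / 2)) *
     (\<Sum>m. (z / 2) ^ (2 * m) / fact m * rGamma (\<eta> + of_nat m + 1))"

definition bessel_K_nonint :: "complex \<Rightarrow> complex \<Rightarrow> complex \<Rightarrow> complex" where
  "bessel_K_nonint \<omega> \<eta> z =
     complex_of_real pi / 2 * (bessel_I \<omega> (- \<eta>) z - bessel_I \<omega> \<eta> z) / sin (\<eta> * complex_of_real pi)"

definition bessel_K :: "complex \<Rightarrow> complex \<Rightarrow> complex \<Rightarrow> complex" where
  "bessel_K \<omega> \<eta> z =
     (if \<eta> \<notin> \<int> then bessel_K_nonint \<omega> \<eta> z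
      else Lim (at \<eta>) (\<lambda>\<xi>. bessel_K_nonint \<omega> \<xi> z))"

text \<open>The exceptional values of \<open>s\<close> when \<open>\<alpha> = 0\<close>.\<close>

definition exc_set :: "nat \<Rightarrow> real set" where
  "exc_set d = {1/2 + real j | j. j \<le> (d - 1) div 2} \<union> {1/2 - real j | j. j \<le> (d - 1) div 2}"

definition pfun :: "nat \<Rightarrow> complex \<Rightarrow> complex" where
  "pfun k s =
     (if s \<in> {1/2 - of_nat j | j. 1 \<le> j \<and> j \<le> k div 2} then 1
      else (-1) ^ (k div 2) * fact k /
        (2 ^ (k div 2) * fact (k div 2) * (\<Prod>j = 1..k div 2. 2 * of_nat j + 2 * s - 1)))"

text \<open>\<open>qfun\<close> and \<open>rfun\<close> are only used for \<open>s = 1/2 - j\<close> with \<open>j\<close> a natural number. For \<open>j \<ge> 1\<close>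
  the numbers \<open>-2s-1\<close> and \<open>-2s\<close> are natural numbers, so the conversion to \<^typ>\<open>nat\<close> is exact.\<close>

fun qfun :: "nat \<Rightarrow> complex \<Rightarrow> complex" where
  "qfun 0 s = (if s = 1/2 then 1 else 2 * s * pfun (nat \<lfloor>- 2 * Re s - 1\<rfloor>) s)"
| "qfun (Suc 0) s = (if s = 1/2 then 1 else (2 * s - 2) * pfun (nat \<lfloor>- 2 * Re s\<rfloor>) s)"
| "qfun (Suc (Suc n)) s =
     (let k = Suc (Suc n) in
      - (1/4) * ((1 - 2 * s + of_nat k) * (- 2 * s + of_nat k)
               / (of_nat (k div 2) * (1/2 - s + of_nat (k div 2)))) * qfun n s)"

definition rfun :: "nat \<Rightarrow> complex \<Rightarrow> complex" where
  "rfun k s =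
     (if k < 2 then 0 else
      let h = k div 2; \<delta> = (if odd k then 1 else 0) in
      - ((1/2 - s + 2 * of_nat h) / (2 * of_nat h * (1/2 - s + of_nat h))) * qfun k s
      + (\<Sum>j = 1..h - 1.
           (-1) ^ (h + j + 1)
           * ((1/2 - s + 2 * of_nat j) / (2 * of_nat j * (1/2 - s + of_nat j)))
           * (1 / 4 ^ (h - j))
           * ((\<Prod>l = 2 * j + 1 + \<delta>..k. 1 - 2 * s + of_nat l)
              / (\<Prod>l = j + 1..h. of_nat l * (1/2 - s + of_nat l)))
           * qfun (2 * j + \<delta>) s))"

text \<open>In the next two definitions the arguments \<open>m - 1 + 2s\<close> and \<open>m + 1 - 2s\<close> of
  \<open>qfun\<close> and \<open>rfun\<close> are nonnegative integers in the branches where they occur.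
  The matrix size \<open>d\<close> enters only through the set \<^const>\<open>exc_set\<close>.\<close>

definition bfI :: "nat \<Rightarrow> complex \<Rightarrow> nat \<Rightarrow> complex \<Rightarrow> real \<Rightarrow> complex \<Rightarrow> complex" where
  "bfI d \<omega> m \<alpha> y s =
     (if \<alpha> \<noteq> 0 then
        complex_of_real (sqrt y) * inverse (\<i> ^ m)
        * (deriv ^^ m) (\<lambda>a. bessel_I \<omega> (s - 1/2) (a * complex_of_real y)) \<alpha>
      else if s \<in> complex_of_real ` (exc_set d \<inter> {1/2 - real m / 2..1/2}) then
        (let k = nat \<lfloor>real m - 1 + 2 * Re s\<rfloor>; Y = complex_of_real y powr (s + 2 * of_nat (m div 2)) in
         qfun k s * Y * complex_of_real (ln y) + rfun k s * Y)
      else pfun m s * complex_of_real y powr (s + 2 * of_nat (m div 2)))"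

definition bfK :: "nat \<Rightarrow> complex \<Rightarrow> nat \<Rightarrow> complex \<Rightarrow> real \<Rightarrow> complex \<Rightarrow> complex" where
  "bfK d \<omega> m \<alpha> y s =
     (if \<alpha> \<noteq> 0 then
        complex_of_real (sqrt y) * inverse (\<i> ^ m)
        * (deriv ^^ m) (\<lambda>a. bessel_K \<omega> (s - 1/2) (a * complex_of_real y)) \<alpha>
      else if s \<in> complex_of_real ` (exc_set d \<inter> {3/2..1/2 + real m / 2}) then
        (let k = nat \<lfloor>real m + 1 - 2 * Re s\<rfloor>; Y = complex_of_real y powr (1 - s + 2 * of_nat (m div 2)) in
         qfun k (1 - s) * Y * complex_of_real (ln y) + rfun k (1 - s) * Y)
      else pfun m (1 - s) * complex_of_real y powr (1 - s + 2 * of_nat (m div 2)))"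

section \<open>Matrices\<close>

text \<open>Matrix entries and vector components are indexed from 0. The function \<open>entry\<close> below
  uses the 1-based indices in which the coefficient conditions are formulated.\<close>

definition jordan_ilk :: "nat \<Rightarrow> complex \<Rightarrow> complex mat" where
  "jordan_ilk d \<mu> = Matrix.mat d d (\<lambda>(i, j). if j = i \<or> j = Suc i then \<mu> else 0)"

definition jordan_ilk_power :: "nat \<Rightarrow> complex \<Rightarrow> complex \<Rightarrow> real \<Rightarrow> complex mat" where
  "jordan_ilk_power d \<omega> \<mu> x = Matrix.mat d d (\<lambda>(i, j).
     if i \<le> j then exp (complex_of_real x * log_cut \<omega> \<mu>) * (complex_of_real x gchoose (j - i)) else 0)"

text \<open>Signed Stirling numbers of the first kind.\<close>

definition sstirling :: "nat \<Rightarrow> nat \<Rightarrow> int" where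
  "sstirling n k = poly.coeff (\<Prod>l<n. [:- int l, 1:]) k"

definition T_mat :: "nat \<Rightarrow> complex mat" where
  "T_mat d = Matrix.mat d d (\<lambda>(i, j). of_int (sstirling (d - 1 - i) (d - 1 - j)) / fact (d - 1 - i))"

definition S_mat :: "nat \<Rightarrow> complex mat" where
  "S_mat d = Matrix.mat d d (\<lambda>(i, j). if i = j then (-1) ^ (d - 1 - i) else 0)"

definition entry :: "complex mat \<Rightarrow> nat \<Rightarrow> nat \<Rightarrow> complex" where
  "entry C i j = C $$ (i - 1, j - 1)"

definition Coeff1 :: "nat \<Rightarrow> complex mat set" where
  "Coeff1 d = {C \<in> carrier_mat d d.
     (\<forall>i\<in>{1..d}. \<forall>j\<in>{1..d}. i > j \<longrightarrow> entry C i j = 0) \<and>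
     (\<forall>i\<in>{1..d}. \<forall>p\<in>{0..d - i}.
        entry C i (i + p) =
          entry C 1 (1 + p) * (\<Prod>k = 1..i - 1. of_nat d - of_nat p - of_nat k)
            / (\<Prod>k = 1..i - 1. of_nat d - of_nat k))}"

text \<open>The upper product bound $2k-1$ is written as a strict bound \<open>2 * k\<close>, so that the products
  are empty for \<open>k = 0\<close>.\<close>

definition Coeff0 :: "nat \<Rightarrow> complex mat set" where
  "Coeff0 d = {C \<in> carrier_mat d d.
     (\<forall>i j k. 1 \<le> i \<and> 1 \<le> j \<and> i + 2 * k \<le> d \<and> j + 2 * k \<le> d \<longrightarrow>
        entry C (i + 2 * k) (j + 2 * k) =
          entry C i j * (\<Prod>p<2 * k. of_nat d - of_nat (j + p))
            / (\<Prod>p<2 * k. of_nat d - of_nat (i + p))) \<and>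
     (\<forall>i\<in>{3..d}. \<forall>j\<in>{1..2 * ((i - 1) div 2)}. entry C i j = 0)}"

section \<open>Frequencies and coefficient vectors\<close>

definition freq :: "complex \<Rightarrow> complex \<Rightarrow> int \<Rightarrow> complex" where
  "freq \<omega> \<mu> n = 2 * complex_of_real pi * of_int n - \<i> * log_cut \<omega> \<mu>"

text \<open>The columns $(\mathbf{I}(d-1,\alpha,y,s),\dots,\mathbf{I}(0,\alpha,y,s))^\top$ and likewise for
  $\mathbf{K}$.\<close>

definition I_vec :: "nat \<Rightarrow> complex \<Rightarrow> complex \<Rightarrow> real \<Rightarrow> complex \<Rightarrow> complex vec" where
  "I_vec d \<omega> \<alpha> y s = Matrix.vec d (\<lambda>i. bfI d \<omega> (d - 1 - i) \<alpha> y s)"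

definition K_vec :: "nat \<Rightarrow> complex \<Rightarrow> complex \<Rightarrow> real \<Rightarrow> complex \<Rightarrow> complex vec" where
  "K_vec d \<omega> \<alpha> y s = Matrix.vec d (\<lambda>i. bfK d \<omega> (d - 1 - i) \<alpha> y s)"

end

theory Submission
  imports Defs "HOL-Complex_Analysis.Complex_Analysis"
begin

text \<open>
  In the coordinates given by \<open>T\<close> the matrix \<open>J\<close> becomes \<open>\<lambda> exp U\<close> with \<open>U\<close> nilpotent, and
  \<open>J\<^bsup>-x\<^esup> f(x + iy)\<close> is periodic in \<open>x\<close>. By integration by parts, its Fourier coefficients, with the component
  \<open>m\<close> divided by \<open>m!\<close>, satisfy
  \<open>u\<^sub>m'' = (\<alpha>\<^sup>2 + s(s - 1)/y\<^sup>2) u\<^sub>m - 2i\<alpha> u\<^bsub>m-1\<^esub> - u\<^bsub>m-2\<^esub>\<close>.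
  Differentiating Bessel's equation \<open>m\<close> times shows that the functions \<open>I\<close> and \<open>K\<close> solve the same system for
  \<open>\<alpha> \<noteq> 0\<close>; for \<open>\<alpha> = 0\<close> this is the content of the recursions for \<open>p\<close>, \<open>q\<close>, \<open>r\<close>.
  The system is triangular and invariant under shifts of \<open>m\<close>, hence every solution is a combination of shifts of two
  solutions whose lowest components have a nonzero Wronskian. The coefficients of this combination are the entries of
  \<open>C\<close> and \<open>D\<close>. For \<open>\<alpha> = 0\<close> the even and the odd components decouple, which gives the set
  \<open>Coeff\<^sub>0\<close> instead of \<open>Coeff\<^sub>1\<close>.

  At an integer order \<open>\<eta>\<close> the function \<open>K\<^sub>\<eta>\<close> is a derivative of \<open>I\<^bsub>-\<xi>\<^esub> - I\<^sub>\<xi>\<close> with respect to the order,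
  and differentiating the Wronskian identity for \<open>I\<^sub>\<xi>\<close> and \<open>I\<^bsub>-\<xi>\<^esub>\<close> in \<open>\<xi>\<close> gives the Wronskian of \<open>I\<^sub>\<eta>\<close>
  and \<open>K\<^sub>\<eta>\<close>.
\<close>

section \<open>The logarithm cut along a ray\<close>

text \<open>With a formal variable \<tau>, \<tau>^d = 0, in place of \<open>U\<close>, the column of
  Fourier coefficients is one function satisfying u'' = ((\<alpha> - i\<tau>)^2 + s(s - 1)/y^2) u,
  the scalar equation at the displaced frequency \<alpha> - i\<tau>. Derivatives in \<alpha> with
  weights 1/(i^m m!) are the Taylor coefficients of this displacement. The solutions form a module
  over the truncated polynomials in \<tau>; a pair of solutions is a basis once the constant term of
  its Wronskian is nonzero, and for \<alpha> \<noteq> 0 the matrices C and D are multiplications by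
  elements of that ring, up to factorials. For \<alpha> = 0 only \<tau>^2 occurs. The Bessel
  functions branch at 0, so the Taylor expansion is replaced there by powers of y, with logarithms
  where two exponents meet. The branch cut shapes the nonzero case: derivatives in \<alpha> need an
  open domain, but the frequency may lie on the ray. Then its negative is used, and
  \<open>S\<close>, which is the substitution of -\<tau> for \<tau>, restores the sign of the
  coupling.\<close>

definition slit_plane :: "complex \<Rightarrow> complex set" where
  "slit_plane \<omega> = {z. z \<noteq> 0 \<and> z \<notin> open_ray \<omega>}"

context
  fixes \<omega> :: complex
  assumes omega: "\<omega> \<notin> complex_of_real ` {0..}"
begin

lemma omega_nonzero: "\<omega> \<noteq> 0"
  using omega by (metis atLeast_iff imageI of_real_0 order_refl)

lemma Arg_omega_nonzero: "Arg \<omega> \<noteq> 0"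
proof
  assume "Arg \<omega> = 0"
  then have "\<omega> \<in> \<real>" "Re \<omega> \<in> {0..}" by (auto simp: Arg_eq_0)
  then show False
    using omega by (metis imageI of_real_Re)
qed

text \<open>Dividing by \<open>- \<omega>\<close> rotates the cut onto the nonpositive reals, where
  the principal \<open>Ln\<close> is cut; openness and analyticity thus reduce to
  \<open>Ln\<close>.\<close>

lemma slit_plane_iff: "z \<in> slit_plane \<omega> \<longleftrightarrow> - z / \<omega> \<notin> \<real>\<^sub>\<le>\<^sub>0"
proof -
  have "- z / \<omega> \<in> \<real>\<^sub>\<le>\<^sub>0 \<longleftrightarrow> (\<exists>t\<ge>0. z = complex_of_real t * \<omega>)"
  proof
    assume "- z / \<omega> \<in> \<real>\<^sub>\<le>\<^sub>0"
    then obtain r where r: "r \<le> 0" "- z / \<omega> = complex_of_real r"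
      by (rule nonpos_Reals_cases)
    have "z = - (- z / \<omega>) * \<omega>"
      using omega_nonzero by simp
    then have "z = complex_of_real (-r) * \<omega>"
      unfolding r(2) by simp
    with r show "\<exists>t\<ge>0. z = complex_of_real t * \<omega>"
      by (intro exI[of _ "-r"]) auto
  next
    assume "\<exists>t\<ge>0. z = complex_of_real t * \<omega>"
    then obtain t where "t \<ge> 0" "z = complex_of_real t * \<omega>" by blast
    then have "- z / \<omega> = complex_of_real (- t)"
      using omega_nonzero by simp
    with \<open>t \<ge> 0\<close> show "- z / \<omega> \<in> \<real>\<^sub>\<le>\<^sub>0"
      by (metis neg_le_0_iff_le nonpos_Reals_of_real_iff)
  qed
  moreover have "(\<exists>t\<ge>0. z = complex_of_real t * \<omega>) \<longleftrightarrow> z = 0 \<or> z \<in> open_ray \<omega>"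
    unfolding open_ray_def using omega_nonzero
    by (auto simp: less_le)
  ultimately show ?thesis
    by (auto simp: slit_plane_def)
qed

lemma open_slit_plane: "open (slit_plane \<omega>)"
proof -
  have "slit_plane \<omega> = (\<lambda>z. - z / \<omega>) -` (- \<real>\<^sub>\<le>\<^sub>0)"
    by (auto simp: slit_plane_iff)
  moreover have "open ((\<lambda>z. - z / \<omega>) -` (- \<real>\<^sub>\<le>\<^sub>0))"
    by (intro open_vimage continuous_intros) (auto simp: open_Compl omega_nonzero)
  ultimately show ?thesis by simp
qed

lemma slit_plane_scale:
  assumes "z \<in> slit_plane \<omega>" "t > 0"
  shows "z * complex_of_real t \<in> slit_plane \<omega>"
proof -
  have "z \<in> open_ray \<omega>" if ray: "z * complex_of_real t \<in> open_ray \<omega>"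
  proof -
    obtain r where "r > 0" "z * complex_of_real t = complex_of_real r * \<omega>"
      using ray unfolding open_ray_def by (elim CollectE exE conjE) (rule that)
    then have "z = (complex_of_real r * \<omega>) / complex_of_real t"
      using assms(2) by (simp add: eq_divide_eq)
    then have "z = complex_of_real (r / t) * \<omega>" "r / t > 0"
      using assms(2) \<open>r > 0\<close> by simp_all
    then show ?thesis unfolding open_ray_def by blast
  qed
  with assms show ?thesis
    by (auto simp: slit_plane_def)
qed

lemma exp_log_cut: "z \<noteq> 0 \<Longrightarrow> exp (log_cut \<omega> z) = z"
  using Arg_omega_nonzero
  by (cases "Arg \<omega> > 0") (auto simp: log_cut_def exp_diff exp_minus exp_add)

text \<open>Both sides are logarithms of \<open>z\<close>, so it suffices that their imaginary parts
  differ by less than \<open>2 * pi\<close>. Off the ray both lie within \<open>pi\<close> of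
  \<open>Arg \<omega> - pi * sgn (Arg \<omega>)\<close>, the direction opposite to
  \<open>\<omega>\<close>.\<close>

lemma log_cut_conv_Ln:
  assumes "z \<in> slit_plane \<omega>"
  shows "log_cut \<omega> z = Ln (- z / \<omega>) + Ln \<omega> - \<i> * complex_of_real (pi * sgn (Arg \<omega>))"
    (is "_ = ?R")
proof (rule exp_complex_eqI)
  have z: "z \<noteq> 0" using assms by (simp add: slit_plane_def)
  have w: "- z / \<omega> \<notin> \<real>\<^sub>\<le>\<^sub>0" using assms by (simp add: slit_plane_iff)
  have "exp (\<i> * complex_of_real (pi * sgn (Arg \<omega>))) = -1"
    using Arg_omega_nonzero by (cases "Arg \<omega> > 0") (auto simp: exp_minus)
  then show "exp (log_cut \<omega> z) = exp ?R"
    using z omega_nonzero by (simp add: exp_log_cut exp_diff exp_add)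
  have R: "\<bar>Im (Ln (- z / \<omega>))\<bar> < pi"
  proof -
    have "- z / \<omega> \<noteq> 0" using z omega_nonzero by simp
    moreover have "Im (Ln (- z / \<omega>)) \<noteq> pi"
      using w by (metis Im_Ln_eq_pi calculation complex_nonpos_Reals_iff less_eq_real_def)
    ultimately show ?thesis
      using Im_Ln_le_pi[of "- z / \<omega>"] mpi_less_Im_Ln[of "- z / \<omega>"] by linarith
  qed
  \<comment> \<open>\<open>log_cut\<close> jumps exactly at this argument, that is, on the removed
    ray.\<close>
  have A: "Arg z \<noteq> Arg \<omega>"
  proof
    assume "Arg z = Arg \<omega>"
    then have "z / complex_of_real (norm z) = \<omega> / complex_of_real (norm \<omega>)"
      using z omega_nonzero by (metis Arg_eq mult.commute nonzero_mult_div_cancel_right norm_eq_zero of_real_eq_0_iff)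
    then have "z = complex_of_real (norm z / norm \<omega>) * \<omega>"
      using z omega_nonzero by (simp add: field_simps)
    moreover have "norm z / norm \<omega> > 0" using z omega_nonzero by simp
    ultimately have "z \<in> open_ray \<omega>" unfolding open_ray_def by blast
    with assms show False by (simp add: slit_plane_def)
  qed
  have "-pi < Arg z" "Arg z \<le> pi" "-pi < Arg \<omega>" "Arg \<omega> \<le> pi"
    using mpi_less_Arg Arg_le_pi by auto
  then have "\<bar>Im (log_cut \<omega> z) - (Arg \<omega> - pi * sgn (Arg \<omega>))\<bar> \<le> pi"
    using A z Arg_omega_nonzero
    by (cases "Arg \<omega> > 0") (auto simp: log_cut_def log_args_def Arg_eq_Im_Ln)
  moreover have "Im ?R = Im (Ln (- z / \<omega>)) + (Arg \<omega> - pi * sgn (Arg \<omega>))"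
    using omega_nonzero by (simp add: Arg_eq_Im_Ln)
  ultimately show "\<bar>Im (log_cut \<omega> z) - Im ?R\<bar> < 2 * pi"
    using R by linarith
qed

lemma has_field_derivative_log_cut:
  assumes "z \<in> slit_plane \<omega>"
  shows "(log_cut \<omega> has_field_derivative 1 / z) (at z)"
proof -
  have w: "- z / \<omega> \<notin> \<real>\<^sub>\<le>\<^sub>0" using assms by (simp add: slit_plane_iff)
  have z: "z \<noteq> 0" using assms by (simp add: slit_plane_def)
  have "((\<lambda>z. Ln (- z / \<omega>) + Ln \<omega> - \<i> * complex_of_real (pi * sgn (Arg \<omega>)))
      has_field_derivative 1 / z) (at z)"
    using w z omega_nonzero
    by (auto intro!: derivative_eq_intros simp: field_simps)
  then show ?thesis
    by (rule has_field_derivative_transform_within_open[OF _ open_slit_plane assms])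
       (simp add: log_cut_conv_Ln)
qed

end

section \<open>The power series of the Bessel functions\<close>

text \<open>Once \<open>m\<close> is at least \<open>R\<close>, the argument
  \<open>\<zeta> + m + 1\<close> has modulus at least 1, so
  \<open>rGamma (z + 1) = rGamma z / z\<close> cannot grow any more; the finitely many earlier
  \<open>m\<close> are handled by compactness. Uniformity in the order is what allows the Bessel
  series to be differentiated with respect to its order.\<close>

lemma rGamma_shift_bounded:
  "\<exists>M. \<forall>m. \<forall>\<zeta>\<in>cball 0 R. norm (rGamma (\<zeta> + of_nat m + 1 :: complex)) \<le> M"
proof -
  have "\<exists>M. \<forall>\<zeta>\<in>cball 0 R. norm (rGamma (\<zeta> + of_nat m + 1 :: complex)) \<le> M" for m
  proof -
    have "compact ((\<lambda>\<zeta>. rGamma (\<zeta> + of_nat m + 1 :: complex)) ` cball 0 R)"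
      by (intro compact_continuous_image continuous_on_rGamma[THEN continuous_on_compose2, where ?t = UNIV]
          continuous_intros compact_cball) auto
    then show ?thesis
      by (auto dest!: compact_imp_bounded simp: bounded_iff)
  qed
  then obtain M where M: "\<And>m \<zeta>. \<zeta> \<in> cball 0 R \<Longrightarrow> norm (rGamma (\<zeta> + of_nat m + 1 :: complex)) \<le> M m"
    by metis
  define N where "N = nat \<lceil>R\<rceil>"
  have tail: "norm (rGamma (\<zeta> + of_nat m + 1 :: complex)) \<le> M N" if "\<zeta> \<in> cball 0 R" "m \<ge> N" for m \<zeta>
    using that(2)
  proof (induction m rule: dec_induct)
    case base
    then show ?case using M that by blast
  next
    case (step m)
    let ?z = "\<zeta> + of_nat m + 1 :: complex"
    have "real m + 1 \<le> norm ?z + norm \<zeta>"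
      using norm_triangle_ineq4[of ?z \<zeta>]
      by (metis add.assoc add_diff_cancel_left' norm_of_nat of_nat_1 of_nat_add)
    moreover have "norm \<zeta> \<le> R" "R \<le> real m"
      using that step unfolding N_def by (auto simp: le_nat_iff ceiling_le_iff)
    ultimately have "1 \<le> norm ?z" by linarith
    moreover have "rGamma ?z = ?z * rGamma (\<zeta> + of_nat (Suc m) + 1)"
      using rGamma_plus1[of ?z] by (simp add: algebra_simps)
    ultimately have "norm (rGamma (\<zeta> + of_nat (Suc m) + 1)) \<le> norm (rGamma ?z)"
      by (simp add: norm_mult mult_le_cancel_right1)
    with step.IH show ?case by simp
  qed
  have "norm (rGamma (\<zeta> + of_nat m + 1 :: complex)) \<le> (\<Sum>k\<le>N. \<bar>M k\<bar>)" if "\<zeta> \<in> cball 0 R" for m \<zeta>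
  proof -
    have "\<exists>k\<le>N. norm (rGamma (\<zeta> + of_nat m + 1 :: complex)) \<le> M k"
      using M[OF that, of m] tail[OF that, of m] by (cases "m \<le> N") auto
    then obtain k where k: "k \<le> N" "norm (rGamma (\<zeta> + of_nat m + 1 :: complex)) \<le> M k" by blast
    have "\<bar>M k\<bar> \<le> (\<Sum>k\<le>N. \<bar>M k\<bar>)"
      using k by (intro member_le_sum) auto
    with k show ?thesis by linarith
  qed
  then show ?thesis by blast
qed

text \<open>The entire factor of the Bessel function: \<open>I\<close> of order \<open>\<xi>\<close>
  is \<open>(z/2)^\<xi>\<close> times this series at \<open>w = z^2/4\<close>. All multivaluedness
  stays in the power, and differentiation in \<open>w\<close> merely raises \<open>\<xi>\<close> by
  1.\<close>

definition bessel_series :: "complex \<Rightarrow> complex \<Rightarrow> complex" where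
  "bessel_series \<xi> w = (\<Sum>m. w ^ m / fact m * rGamma (\<xi> + of_nat m + 1))"

definition bessel_series_dparam :: "complex \<Rightarrow> complex \<Rightarrow> complex" where
  "bessel_series_dparam \<xi> w = (\<Sum>m. w ^ m / fact m * deriv rGamma (\<xi> + of_nat m + 1))"

text \<open>Locally uniformly in \<open>\<xi>\<close> the series is dominated by a multiple of an
  exponential series, so it may be differentiated term by term in the order, which yields both
  convergence statements at once.\<close>

lemma bessel_series_sums_and_deriv:
  "(\<lambda>m. w ^ m / fact m * rGamma (\<xi> + of_nat m + 1)) sums bessel_series \<xi> w \<and>
   (\<lambda>m. w ^ m / fact m * deriv rGamma (\<xi> + of_nat m + 1)) sums bessel_series_dparam \<xi> w \<and>
   ((\<lambda>\<xi>. bessel_series \<xi> w) has_field_derivative bessel_series_dparam \<xi> w) (at \<xi>)"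
proof -
  have D: "((\<lambda>\<xi>. w ^ m / fact m * rGamma (\<xi> + of_nat m + 1)) has_field_derivative
      w ^ m / fact m * deriv rGamma (\<xi> + of_nat m + 1)) (at \<xi>)" for m \<xi>
  proof -
    have "rGamma field_differentiable at (\<xi> + of_nat m + 1)"
      by (intro field_differentiable_rGamma)
    then have "(rGamma has_field_derivative deriv rGamma (\<xi> + of_nat m + 1)) (at (\<xi> + of_nat m + 1))"
      by (simp add: DERIV_deriv_iff_field_differentiable)
    then have "((\<lambda>\<xi>. rGamma (\<xi> + of_nat m + 1)) has_field_derivative
        deriv rGamma (\<xi> + of_nat m + 1) * 1) (at \<xi>)"
      by (rule DERIV_chain2) (auto intro!: derivative_eq_intros)
    then show ?thesis
      by (intro DERIV_cmult) simp
  qed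
  obtain g g' where g: "\<forall>\<xi>\<in>UNIV. (\<lambda>m. w ^ m / fact m * rGamma (\<xi> + of_nat m + 1)) sums g \<xi> \<and>
     (\<lambda>m. w ^ m / fact m * deriv rGamma (\<xi> + of_nat m + 1)) sums g' \<xi> \<and> (g has_field_derivative g' \<xi>) (at \<xi>)"
  proof (atomize_elim, rule series_and_derivative_comparison_local)
    fix \<xi> :: complex
    obtain M where M: "\<And>m \<zeta>. \<zeta> \<in> cball 0 (norm \<xi> + 1) \<Longrightarrow> norm (rGamma (\<zeta> + of_nat m + 1 :: complex)) \<le> M"
      using rGamma_shift_bounded by blast
    have "summable (\<lambda>m. norm w ^ m / fact m * M)"
      using summable_mult2[OF summable_exp_generic[of "norm w"], of M]
      by (simp add: field_simps)
    moreover have "norm (w ^ m / fact m * rGamma (y + of_nat m + 1)) \<le> norm w ^ m / fact m * M"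
      if "y \<in> ball \<xi> 1 \<inter> UNIV" for y m
    proof -
      have "norm y \<le> norm \<xi> + 1"
        using that norm_triangle_ineq2[of y \<xi>] by (auto simp: dist_norm norm_minus_commute)
      then have "norm (rGamma (y + of_nat m + 1)) \<le> M" using M by simp
      then show ?thesis
        unfolding norm_mult norm_divide norm_power norm_fact
        by (intro mult_left_mono) auto
    qed
    ultimately show "\<exists>d h. 0 < d \<and> summable h \<and> (\<forall>\<^sub>F m in sequentially. \<forall>y\<in>ball \<xi> d \<inter> UNIV.
        norm (w ^ m / fact m * rGamma (y + of_nat m + 1)) \<le> h m)"
      by (intro exI[of _ 1] exI[of _ "\<lambda>m. norm w ^ m / fact m * M"]) auto
  qed (use D in auto)
  have "g = (\<lambda>\<xi>. bessel_series \<xi> w)" "g' = (\<lambda>\<xi>. bessel_series_dparam \<xi> w)"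
    using g by (auto simp: bessel_series_def bessel_series_dparam_def fun_eq_iff dest: sums_unique)
  with g show ?thesis by auto
qed

lemmas bessel_series_sums = bessel_series_sums_and_deriv[THEN conjunct1]
lemmas bessel_series_dparam_sums = bessel_series_sums_and_deriv[THEN conjunct2, THEN conjunct1]
lemmas bessel_series_has_deriv_param = bessel_series_sums_and_deriv[THEN conjunct2, THEN conjunct2]

text \<open>With coefficients \<open>a m / fact m\<close>, differentiation is a shift of
  \<open>a\<close>; for the Bessel series this shift is the passage from \<open>\<xi>\<close> to
  \<open>\<xi> + 1\<close>.\<close>

lemma exponential_series_has_deriv:
  fixes a :: "nat \<Rightarrow> complex"
  assumes "\<And>w. (\<lambda>m. w ^ m / fact m * a m) sums F w"
    and "\<And>w. (\<lambda>m. w ^ m / fact m * a (Suc m)) sums G w"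
  shows "(F has_field_derivative G w) (at w)"
proof -
  let ?c = "\<lambda>m. a m / fact m"
  have "diffs ?c = (\<lambda>m. a (Suc m) / fact m)"
    by (auto simp: diffs_def fun_eq_iff field_simps simp del: of_nat_Suc)
  moreover have "summable (\<lambda>m. ?c m * w ^ m)" for w
    using sums_summable[OF assms(1)[of w]] by (simp add: field_simps)
  moreover have "(\<Sum>m. ?c m * w ^ m) = F w" for w
    using sums_unique[OF assms(1)[of w]] by (simp add: field_simps)
  moreover have "(\<Sum>m. a (Suc m) / fact m * w ^ m) = G w" for w
    using sums_unique[OF assms(2)[of w]] by (simp add: field_simps)
  ultimately show ?thesis
    using termdiffs_strong_converges_everywhere[of ?c w] by simp
qed

lemma bessel_series_has_deriv:
  "(bessel_series \<xi> has_field_derivative bessel_series (\<xi> + 1) w) (at w)"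
  using bessel_series_sums[of _ \<xi>] bessel_series_sums[of _ "\<xi> + 1"]
  by (intro exponential_series_has_deriv[of "\<lambda>m. rGamma (\<xi> + of_nat m + 1)"])
     (simp_all add: algebra_simps)

lemma bessel_series_dparam_has_deriv:
  "(bessel_series_dparam \<xi> has_field_derivative bessel_series_dparam (\<xi> + 1) w) (at w)"
  using bessel_series_dparam_sums[of _ \<xi>] bessel_series_dparam_sums[of _ "\<xi> + 1"]
  by (intro exponential_series_has_deriv[of "\<lambda>m. deriv rGamma (\<xi> + of_nat m + 1)"])
     (simp_all add: algebra_simps)

text \<open>This is the differential equation of the series, since each increment of
  \<open>\<xi>\<close> is a derivative in \<open>w\<close>. Termwise it is
  \<open>rGamma z = z * rGamma (z + 1)\<close> at \<open>z = \<xi> + m + 1\<close>, with the factor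
  split into \<open>m\<close> and \<open>\<xi> + 1\<close>.\<close>

lemma bessel_series_rec:
  "w * bessel_series (\<xi> + 2) w + (\<xi> + 1) * bessel_series (\<xi> + 1) w = bessel_series \<xi> w"
proof -
  let ?f = "\<lambda>m. w ^ m / fact m * of_nat m * rGamma (\<xi> + 1 + of_nat m + 1)"
  have "(\<lambda>m. ?f (Suc m)) sums (w * bessel_series (\<xi> + 2) w)"
    using sums_mult[OF bessel_series_sums[of w "\<xi> + 2"], of w]
    by (simp add: field_simps fact_Suc del: of_nat_Suc) (simp add: algebra_simps)
  then have "?f sums (w * bessel_series (\<xi> + 2) w)"
    by (subst (asm) sums_Suc_iff) simp
  moreover have "(\<lambda>m. (\<xi> + 1) * (w ^ m / fact m * rGamma (\<xi> + 1 + of_nat m + 1)))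
      sums ((\<xi> + 1) * bessel_series (\<xi> + 1) w)"
    by (intro sums_mult bessel_series_sums)
  ultimately have "(\<lambda>m. ?f m + (\<xi> + 1) * (w ^ m / fact m * rGamma (\<xi> + 1 + of_nat m + 1)))
      sums (w * bessel_series (\<xi> + 2) w + (\<xi> + 1) * bessel_series (\<xi> + 1) w)"
    by (rule sums_add)
  moreover have "?f m + (\<xi> + 1) * (w ^ m / fact m * rGamma (\<xi> + 1 + of_nat m + 1)) =
      w ^ m / fact m * rGamma (\<xi> + of_nat m + 1)" for m
  proof -
    have "rGamma (\<xi> + of_nat m + 1) = (\<xi> + of_nat m + 1) * rGamma (\<xi> + 1 + of_nat m + 1)"
      using rGamma_plus1[of "\<xi> + of_nat m + 1"] by (simp add: add_ac)
    then show ?thesis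
      by (simp only:) (simp add: field_simps)
  qed
  ultimately show ?thesis
    using bessel_series_sums[of w \<xi>] sums_unique2 by (simp only:)
qed


text \<open>The derivative in \<open>\<xi>\<close> of the preceding recurrence; the product rule
  produces the extra undifferentiated term.\<close>

lemma bessel_series_dparam_rec:
  "w * bessel_series_dparam (\<xi> + 2) w + (\<xi> + 1) * bessel_series_dparam (\<xi> + 1) w
     + bessel_series (\<xi> + 1) w = bessel_series_dparam \<xi> w"
proof -
  note D = DERIV_chain2[OF bessel_series_has_deriv_param]
  have "((\<lambda>\<xi>. w * bessel_series (\<xi> + 2) w + (\<xi> + 1) * bessel_series (\<xi> + 1) w) has_field_derivative
     w * (bessel_series_dparam (\<xi> + 2) w * 1) +
      (1 * bessel_series (\<xi> + 1) w + bessel_series_dparam (\<xi> + 1) w * 1 * (\<xi> + 1))) (at \<xi>)"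
    by (intro DERIV_add DERIV_cmult DERIV_mult D) (auto intro!: derivative_eq_intros)
  then have "w * (bessel_series_dparam (\<xi> + 2) w * 1) +
      (1 * bessel_series (\<xi> + 1) w + bessel_series_dparam (\<xi> + 1) w * 1 * (\<xi> + 1)) = bessel_series_dparam \<xi> w"
    unfolding bessel_series_rec by (rule DERIV_unique[OF _ bessel_series_has_deriv_param])
  then show ?thesis
    by (simp add: algebra_simps)
qed

text \<open>The first \<open>n\<close> terms vanish because \<open>rGamma\<close> is zero at
  nonpositive integers; the remaining ones form the shifted series.\<close>

lemma bessel_series_neg_of_nat:
  "bessel_series (- of_nat n) w = w ^ n * bessel_series (of_nat n) w"
proof -
  let ?f = "\<lambda>m. w ^ m / fact m * rGamma (- of_nat n + of_nat m + 1)"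
  have "?f m = 0" if "m < n" for m
  proof -
    have "- of_nat n + of_nat m + 1 = (- of_nat (n - Suc m) :: complex)"
      using that by (simp add: of_nat_diff)
    then show ?thesis by (simp only: rGamma_eq_zero_iff) simp
  qed
  then have "(\<Sum>m<n. ?f m) = 0"
    by (intro sum.neutral) auto
  then have "(\<lambda>m. ?f (m + n)) sums bessel_series (- of_nat n) w"
    using bessel_series_sums[of w "- of_nat n"] unfolding sums_iff_shift[of ?f] by simp
  moreover have "?f (m + n) = w ^ n * (w ^ m / fact m * rGamma (of_nat n + of_nat m + 1))" for m
    by (simp add: power_add rGamma_inverse_Gamma Gamma_fact[symmetric] field_simps)
  then have "(\<lambda>m. ?f (m + n)) sums (w ^ n * bessel_series (of_nat n) w)"
    by (simp only:) (intro sums_mult bessel_series_sums)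
  ultimately show ?thesis by (rule sums_unique2)
qed

text \<open>Up to the factor \<open>z\<close>, the left-hand side is the Wronskian of \<open>I\<^sub>\<xi>\<close> and \<open>I\<^bsub>-\<xi>\<^esub>\<close> at \<open>z\<close>,
  where \<open>w = z\<^sup>2/4\<close>.\<close>

lemma bessel_series_wronskian:
  "- 2 * \<xi> * bessel_series \<xi> w * bessel_series (- \<xi>) w
     + 2 * w * (bessel_series \<xi> w * bessel_series (- \<xi> + 1) w - bessel_series (- \<xi>) w * bessel_series (\<xi> + 1) w)
   = - 2 * sin (complex_of_real pi * \<xi>) / complex_of_real pi"
proof -
  define W where "W w = - 2 * \<xi> * bessel_series \<xi> w * bessel_series (- \<xi>) w
     + 2 * w * (bessel_series \<xi> w * bessel_series (- \<xi> + 1) w - bessel_series (- \<xi>) w * bessel_series (\<xi> + 1) w)" for w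
  have "(W has_field_derivative 0) (at w)" for w
  proof -
    define p where "p = bessel_series \<xi> w"
    define p1 where "p1 = bessel_series (\<xi> + 1) w"
    define p2 where "p2 = bessel_series (\<xi> + 1 + 1) w"
    define q where "q = bessel_series (- \<xi>) w"
    define q1 where "q1 = bessel_series (- \<xi> + 1) w"
    define q2 where "q2 = bessel_series (- \<xi> + 1 + 1) w"
    have rec: "w * p2 = p - (\<xi> + 1) * p1" "w * q2 = q - (- \<xi> + 1) * q1"
      using bessel_series_rec[of w \<xi>] bessel_series_rec[of w "- \<xi>"]
      by (simp_all add: p_def p1_def p2_def q_def q1_def q2_def algebra_simps)
    have "(W has_field_derivative
        - 2 * \<xi> * (p1 * q + p * q1) + 2 * (p * q1 - q * p1)
        + 2 * (p1 * (w * q1) + p * (w * q2) - (q1 * (w * p1) + q * (w * p2)))) (at w)"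
      unfolding W_def p_def p1_def p2_def q_def q1_def q2_def
      by (auto intro!: derivative_eq_intros bessel_series_has_deriv simp: algebra_simps)
    also have "- 2 * \<xi> * (p1 * q + p * q1) + 2 * (p * q1 - q * p1)
        + 2 * (p1 * (w * q1) + p * (w * q2) - (q1 * (w * p1) + q * (w * p2))) = 0"
      unfolding rec by (simp add: algebra_simps)
    finally show ?thesis .
  qed
  then obtain c where c: "\<And>w. W w = c"
    using has_field_derivative_zero_constant[of UNIV W] by auto
  have z: "bessel_series \<xi> 0 = rGamma (\<xi> + 1)" for \<xi>
  proof -
    have "(\<lambda>m. 0 ^ m / fact m * rGamma (\<xi> + of_nat m + 1)) sums (rGamma (\<xi> + 1))"
      using sums_finite[of "{0}" "\<lambda>m. 0 ^ m / fact m * rGamma (\<xi> + of_nat m + 1)"] by simp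
    then show ?thesis using bessel_series_sums sums_unique2 by blast
  qed
  \<comment> \<open>At \<open>w = 0\<close> only the constant terms survive, and the reflection
    formula evaluates them after \<open>\<xi> * rGamma (\<xi> + 1) = rGamma \<xi>\<close>.\<close>
  have "W 0 = - 2 * (\<xi> * rGamma (\<xi> + 1)) * rGamma (1 - \<xi>)"
    by (simp add: W_def z)
  also have "\<dots> = - 2 * sin (complex_of_real pi * \<xi>) / complex_of_real pi"
    unfolding rGamma_plus1 using rGamma_reflection_complex[of \<xi>]
    by (metis mult.assoc times_divide_eq_right)
  finally have "W w = - 2 * sin (complex_of_real pi * \<xi>) / complex_of_real pi"
    using c by metis
  then show ?thesis unfolding W_def .
qed

section \<open>Bessel functions of arbitrary order\<close>

text \<open>The companion \<open>F1\<close> is \<open>z F'\<close>.\<close>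

definition bessel_solution :: "complex \<Rightarrow> complex \<Rightarrow> (complex \<Rightarrow> complex) \<Rightarrow> (complex \<Rightarrow> complex) \<Rightarrow> bool" where
  "bessel_solution \<omega> \<eta> F F1 \<longleftrightarrow> (\<forall>z\<in>slit_plane \<omega>.
     (F has_field_derivative F1 z / z) (at z) \<and>
     (F1 has_field_derivative (z\<^sup>2 + \<eta>\<^sup>2) * F z / z) (at z))"

definition bessel_I1 :: "complex \<Rightarrow> complex \<Rightarrow> complex \<Rightarrow> complex" where
  "bessel_I1 \<omega> \<eta> z = exp (\<eta> * log_cut \<omega> (z / 2)) *
     (\<eta> * bessel_series \<eta> (z\<^sup>2 / 4) + z\<^sup>2 / 2 * bessel_series (\<eta> + 1) (z\<^sup>2 / 4))"

lemma bessel_I_eq: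
  "bessel_I \<omega> \<eta> z = exp (\<eta> * log_cut \<omega> (z / 2)) * bessel_series \<eta> (z\<^sup>2 / 4)"
  by (simp add: bessel_I_def bessel_series_def power_mult power_divide)

text \<open>The derivative of \<open>I\<close> with respect to its order, from which
  \<open>K\<close> is built at integer orders. \<open>bessel_dI1\<close> below is the order
  derivative of \<open>z I'\<close>, hence on the slit plane also \<open>z\<close> times the
  \<open>z\<close>-derivative of this function.\<close>

definition bessel_dI :: "complex \<Rightarrow> complex \<Rightarrow> complex \<Rightarrow> complex" where
  "bessel_dI \<omega> \<eta> z = exp (\<eta> * log_cut \<omega> (z / 2)) *
     (log_cut \<omega> (z / 2) * bessel_series \<eta> (z\<^sup>2 / 4) + bessel_series_dparam \<eta> (z\<^sup>2 / 4))"

definition bessel_dI1 :: "complex \<Rightarrow> complex \<Rightarrow> complex \<Rightarrow> complex" where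
  "bessel_dI1 \<omega> \<eta> z = exp (\<eta> * log_cut \<omega> (z / 2)) *
     (log_cut \<omega> (z / 2) * (\<eta> * bessel_series \<eta> (z\<^sup>2 / 4) + z\<^sup>2 / 2 * bessel_series (\<eta> + 1) (z\<^sup>2 / 4))
      + bessel_series \<eta> (z\<^sup>2 / 4) + \<eta> * bessel_series_dparam \<eta> (z\<^sup>2 / 4)
      + z\<^sup>2 / 2 * bessel_series_dparam (\<eta> + 1) (z\<^sup>2 / 4))"

lemma bessel_I_has_deriv_param:
  "((\<lambda>\<eta>. bessel_I \<omega> \<eta> z) has_field_derivative bessel_dI \<omega> \<eta> z) (at \<eta>)"
proof -
  note [derivative_intros] = DERIV_chain2[OF bessel_series_has_deriv_param]
  show ?thesis
    unfolding bessel_I_eq bessel_dI_def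
    by (auto intro!: derivative_eq_intros simp: algebra_simps)
qed

lemma bessel_I1_has_deriv_param:
  "((\<lambda>\<eta>. bessel_I1 \<omega> \<eta> z) has_field_derivative bessel_dI1 \<omega> \<eta> z) (at \<eta>)"
proof -
  note [derivative_intros] = DERIV_chain2[OF bessel_series_has_deriv_param]
  show ?thesis
    unfolding bessel_I1_def bessel_dI1_def
    by (auto intro!: derivative_eq_intros simp: algebra_simps)
qed

lemma bessel_I_neg_has_deriv_param:
  "((\<lambda>\<eta>. bessel_I \<omega> (- \<eta>) z) has_field_derivative bessel_dI \<omega> (- \<eta>) z * (- 1)) (at \<eta>)"
  by (rule DERIV_chain2[where g = uminus, OF bessel_I_has_deriv_param]) (auto intro!: derivative_eq_intros)

lemma bessel_I1_neg_has_deriv_param: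
  "((\<lambda>\<eta>. bessel_I1 \<omega> (- \<eta>) z) has_field_derivative bessel_dI1 \<omega> (- \<eta>) z * (- 1)) (at \<eta>)"
  by (rule DERIV_chain2[where g = uminus, OF bessel_I1_has_deriv_param]) (auto intro!: derivative_eq_intros)

text \<open>The exponential prefactors are inverse to each other, so the logarithm cancels and the
  identity for the entire factors remains.\<close>

lemma bessel_I_wronskian_neg:
  "bessel_I \<omega> \<eta> z * bessel_I1 \<omega> (- \<eta>) z - bessel_I \<omega> (- \<eta>) z * bessel_I1 \<omega> \<eta> z
     = - 2 * sin (complex_of_real pi * \<eta>) / complex_of_real pi"
proof -
  define e f where "e = exp (\<eta> * log_cut \<omega> (z / 2))" and "f = exp (- \<eta> * log_cut \<omega> (z / 2))"
  define p p1 where "p = bessel_series \<eta> (z\<^sup>2 / 4)" and "p1 = bessel_series (\<eta> + 1) (z\<^sup>2 / 4)"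
  define q q1 where "q = bessel_series (- \<eta>) (z\<^sup>2 / 4)" and "q1 = bessel_series (- \<eta> + 1) (z\<^sup>2 / 4)"
  have ef: "e * f = 1" by (simp add: e_def f_def flip: exp_add)
  have "bessel_I \<omega> \<eta> z * bessel_I1 \<omega> (- \<eta>) z - bessel_I \<omega> (- \<eta>) z * bessel_I1 \<omega> \<eta> z =
    (e * p) * (f * (- \<eta> * q + z\<^sup>2 / 2 * q1)) - (f * q) * (e * (\<eta> * p + z\<^sup>2 / 2 * p1))"
    unfolding bessel_I_eq bessel_I1_def e_def f_def p_def p1_def q_def q1_def ..
  also have "\<dots> = (e * f) * (- 2 * \<eta> * p * q + 2 * (z\<^sup>2 / 4) * (p * q1 - q * p1))"
    by (simp add: algebra_simps)
  also have "\<dots> = - 2 * sin (complex_of_real pi * \<eta>) / complex_of_real pi"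
    unfolding ef p_def p1_def q_def q1_def bessel_series_wronskian by simp
  finally show ?thesis .
qed

lemma bessel_solution_linear:
  assumes "bessel_solution \<omega> \<eta> F F1" "bessel_solution \<omega> \<eta> G G1"
  shows "bessel_solution \<omega> \<eta> (\<lambda>z. a * F z + b * G z) (\<lambda>z. a * F1 z + b * G1 z)"
proof -
  { fix z assume z: "z \<in> slit_plane \<omega>"
    have "((\<lambda>z. a * F z + b * G z) has_field_derivative a * (F1 z / z) + b * (G1 z / z)) (at z)"
      "((\<lambda>z. a * F1 z + b * G1 z) has_field_derivative
        a * ((z\<^sup>2 + \<eta>\<^sup>2) * F z / z) + b * ((z\<^sup>2 + \<eta>\<^sup>2) * G z / z)) (at z)"
      using assms[unfolded bessel_solution_def, rule_format, OF z]
      by (intro DERIV_add DERIV_cmult; simp)+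
    then have "((\<lambda>z. a * F z + b * G z) has_field_derivative (a * F1 z + b * G1 z) / z) (at z)"
      "((\<lambda>z. a * F1 z + b * G1 z) has_field_derivative (z\<^sup>2 + \<eta>\<^sup>2) * (a * F z + b * G z) / z) (at z)"
      by (simp_all add: add_divide_distrib algebra_simps) }
  then show ?thesis unfolding bessel_solution_def by blast
qed

context
  fixes \<omega> :: complex
  assumes omega: "\<omega> \<notin> complex_of_real ` {0..}"
begin

lemma has_field_derivative_log_cut_half:
  assumes "z \<in> slit_plane \<omega>"
  shows "((\<lambda>z. log_cut \<omega> (z / 2)) has_field_derivative 1 / z) (at z)"
proof -
  have "z / 2 \<in> slit_plane \<omega>"
    using slit_plane_scale[OF omega assms, of "1/2"] by simp
  then have "((\<lambda>z. log_cut \<omega> (z / 2)) has_field_derivative 1 / (z / 2) * (1 / 2)) (at z)"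
    by (intro DERIV_chain2[where g = "\<lambda>z. z / 2", OF has_field_derivative_log_cut[OF omega]])
       (auto intro!: derivative_eq_intros)
  then show ?thesis by simp
qed

lemma bessel_I_solution: "bessel_solution \<omega> \<eta> (bessel_I \<omega> \<eta>) (bessel_I1 \<omega> \<eta>)"
proof -
  { fix z assume z: "z \<in> slit_plane \<omega>"
    then have z0: "z \<noteq> 0" by (simp add: slit_plane_def)
    let ?w = "z\<^sup>2 / 4"
    note [derivative_intros] = DERIV_chain2[OF bessel_series_has_deriv]
      has_field_derivative_log_cut_half[OF z]
    define p where "p = bessel_series \<eta> ?w"
    define p1 where "p1 = bessel_series (\<eta> + 1) ?w"
    define p2 where "p2 = bessel_series (\<eta> + 1 + 1) ?w"
    define e where "e = exp (\<eta> * log_cut \<omega> (z / 2))"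
    have rec: "?w * p2 + (\<eta> + 1) * p1 = p"
      using bessel_series_rec[of ?w \<eta>] by (simp add: p_def p1_def p2_def algebra_simps)
    have "(bessel_I \<omega> \<eta> has_field_derivative e * (\<eta> / z) * p + e * (p1 * (z / 2))) (at z)"
      unfolding bessel_I_eq p_def p1_def e_def
      by (auto intro!: derivative_eq_intros simp: z0 field_simps)
    moreover have "e * (\<eta> / z) * p + e * (p1 * (z / 2)) = bessel_I1 \<omega> \<eta> z / z"
      using z0 unfolding bessel_I1_def p_def p1_def e_def
      by (simp add: field_simps power2_eq_square)
    moreover have "(bessel_I1 \<omega> \<eta> has_field_derivative
       e * (\<eta> / z) * (\<eta> * p + z\<^sup>2 / 2 * p1) +
       e * (\<eta> * (p1 * (z / 2)) + z * p1 + z\<^sup>2 / 2 * (p2 * (z / 2)))) (at z)"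
      unfolding bessel_I1_def p_def p1_def p2_def e_def
      by (auto intro!: derivative_eq_intros simp: z0 field_simps)
    moreover have "e * (\<eta> / z) * (\<eta> * p + z\<^sup>2 / 2 * p1) +
       e * (\<eta> * (p1 * (z / 2)) + z * p1 + z\<^sup>2 / 2 * (p2 * (z / 2))) = (z\<^sup>2 + \<eta>\<^sup>2) * bessel_I \<omega> \<eta> z / z"
    proof -
      have "(e * (\<eta> / z) * (\<eta> * p + z\<^sup>2 / 2 * p1) +
        e * (\<eta> * (p1 * (z / 2)) + z * p1 + z\<^sup>2 / 2 * (p2 * (z / 2)))) * z
        = e * (\<eta>\<^sup>2 * p + z\<^sup>2 * (?w * p2 + (\<eta> + 1) * p1))"
        using z0 by (simp add: field_simps power2_eq_square)
      then show ?thesis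
        unfolding rec using z0 by (simp add: bessel_I_eq p_def e_def field_simps)
    qed
    ultimately have "(bessel_I \<omega> \<eta> has_field_derivative bessel_I1 \<omega> \<eta> z / z) (at z)"
      "(bessel_I1 \<omega> \<eta> has_field_derivative (z\<^sup>2 + \<eta>\<^sup>2) * bessel_I \<omega> \<eta> z / z) (at z)"
      by simp_all }
  then show ?thesis unfolding bessel_solution_def by blast
qed

text \<open>Differentiating Bessel's equation in \<open>\<eta>\<close> leaves the inhomogeneous term
  \<open>2 * \<eta> * I\<close>. At integer orders it is odd in \<open>\<eta>\<close>, so it cancels
  in the sum over \<open>\<eta>\<close> and \<open>- \<eta>\<close> that represents
  \<open>K\<close>.\<close>

lemma bessel_dI_has_deriv:
  assumes z: "z \<in> slit_plane \<omega>"
  shows "(bessel_dI \<omega> \<eta> has_field_derivative bessel_dI1 \<omega> \<eta> z / z) (at z)"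
    and "(bessel_dI1 \<omega> \<eta> has_field_derivative
       ((z\<^sup>2 + \<eta>\<^sup>2) * bessel_dI \<omega> \<eta> z + 2 * \<eta> * bessel_I \<omega> \<eta> z) / z) (at z)"
proof -
  have z0: "z \<noteq> 0" using z by (simp add: slit_plane_def)
  let ?w = "z\<^sup>2 / 4"
  note [derivative_intros] = DERIV_chain2[OF bessel_series_has_deriv]
    DERIV_chain2[OF bessel_series_dparam_has_deriv] has_field_derivative_log_cut_half[OF z]
  define p where "p = bessel_series \<eta> ?w"
  define p1 where "p1 = bessel_series (\<eta> + 1) ?w"
  define p2 where "p2 = bessel_series (\<eta> + 1 + 1) ?w"
  define r where "r = bessel_series_dparam \<eta> ?w"
  define r1 where "r1 = bessel_series_dparam (\<eta> + 1) ?w"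
  define r2 where "r2 = bessel_series_dparam (\<eta> + 1 + 1) ?w"
  define e where "e = exp (\<eta> * log_cut \<omega> (z / 2))"
  define l where "l = log_cut \<omega> (z / 2)"
  note defs = p_def p1_def p2_def r_def r1_def r2_def e_def l_def
  have rec: "?w * p2 + (\<eta> + 1) * p1 = p" "?w * r2 + (\<eta> + 1) * r1 + p1 = r"
    using bessel_series_rec[of ?w \<eta>] bessel_series_dparam_rec[of ?w \<eta>]
    by (simp_all add: defs algebra_simps)
  have "(bessel_dI \<omega> \<eta> has_field_derivative
      e * (\<eta> / z) * (l * p + r) + e * (p / z + l * (p1 * (z / 2)) + r1 * (z / 2))) (at z)"
    unfolding bessel_dI_def defs by (auto intro!: derivative_eq_intros simp: z0 field_simps)
  moreover have "e * (\<eta> / z) * (l * p + r) + e * (p / z + l * (p1 * (z / 2)) + r1 * (z / 2))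
      = bessel_dI1 \<omega> \<eta> z / z"
    using z0 unfolding bessel_dI1_def defs by (simp add: field_simps power2_eq_square)
  ultimately show "(bessel_dI \<omega> \<eta> has_field_derivative bessel_dI1 \<omega> \<eta> z / z) (at z)"
    by simp
  have "(bessel_dI1 \<omega> \<eta> has_field_derivative
      e * (\<eta> / z) * (l * (\<eta> * p + z\<^sup>2 / 2 * p1) + p + \<eta> * r + z\<^sup>2 / 2 * r1) +
      e * ((\<eta> * p + z\<^sup>2 / 2 * p1) / z + l * (\<eta> * (p1 * (z / 2)) + z * p1 + z\<^sup>2 / 2 * (p2 * (z / 2)))
        + p1 * (z / 2) + \<eta> * (r1 * (z / 2)) + z * r1 + z\<^sup>2 / 2 * (r2 * (z / 2)))) (at z)"
    (is "(_ has_field_derivative ?D) _")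
    unfolding bessel_dI1_def defs by (auto intro!: derivative_eq_intros simp: z0 field_simps)
  moreover have "?D = ((z\<^sup>2 + \<eta>\<^sup>2) * bessel_dI \<omega> \<eta> z + 2 * \<eta> * bessel_I \<omega> \<eta> z) / z"
  proof -
    have "?D * z = e * (\<eta>\<^sup>2 * (l * p + r) + 2 * \<eta> * p + z\<^sup>2 * (l * (?w * p2 + (\<eta> + 1) * p1)
        + (?w * r2 + (\<eta> + 1) * r1 + p1)))"
      using z0 by (simp add: field_simps power2_eq_square)
    also have "\<dots> = (z\<^sup>2 + \<eta>\<^sup>2) * bessel_dI \<omega> \<eta> z + 2 * \<eta> * bessel_I \<omega> \<eta> z"
      unfolding rec by (simp add: bessel_I_eq bessel_dI_def defs field_simps)
    finally show ?thesis using z0 by (simp add: eq_divide_eq)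
  qed
  ultimately show "(bessel_dI1 \<omega> \<eta> has_field_derivative
       ((z\<^sup>2 + \<eta>\<^sup>2) * bessel_dI \<omega> \<eta> z + 2 * \<eta> * bessel_I \<omega> \<eta> z) / z) (at z)"
    by simp
qed

lemma bessel_I_neg_int:
  assumes "\<eta> \<in> \<int>" "z \<noteq> 0"
  shows "bessel_I \<omega> (- \<eta>) z = bessel_I \<omega> \<eta> z"
proof -
  have nat: "bessel_I \<omega> (- of_nat n) z = bessel_I \<omega> (of_nat n) z" for n
  proof -
    let ?E = "exp (log_cut \<omega> (z / 2))"
    have E: "?E = z / 2" using assms(2) by (intro exp_log_cut omega) auto
    have n: "exp (of_nat n * log_cut \<omega> (z / 2)) = ?E ^ n"
      by (simp add: exp_of_nat_mult)
    have "bessel_I \<omega> (- of_nat n) z = inverse (?E ^ n) * ((z\<^sup>2 / 4) ^ n * bessel_series (of_nat n) (z\<^sup>2 / 4))"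
      unfolding bessel_I_eq bessel_series_neg_of_nat by (simp add: exp_minus n)
    also have "(z\<^sup>2 / 4) = ?E * ?E" unfolding E by (simp add: power2_eq_square)
    also have "inverse (?E ^ n) * ((?E * ?E) ^ n * bessel_series (of_nat n) (?E * ?E))
        = ?E ^ n * bessel_series (of_nat n) (?E * ?E)"
      by (simp add: power_mult_distrib)
    also have "?E * ?E = z\<^sup>2 / 4" unfolding E by (simp add: power2_eq_square)
    finally show ?thesis unfolding bessel_I_eq n .
  qed
  obtain k where k: "\<eta> = of_int k" using assms(1) by (auto elim: Ints_cases)
  show ?thesis
  proof (cases "k \<ge> 0")
    case True
    then show ?thesis using nat[of "nat k"] k by simp
  next
    case False
    then show ?thesis using nat[of "nat (- k)"] k by simp
  qed
qed

text \<open>The functions \<open>I\<close> of orders \<open>\<eta>\<close> and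
  \<open>- \<eta>\<close> agree on an open set, hence so do their derivatives.\<close>

lemma bessel_I1_neg_int:
  assumes "\<eta> \<in> \<int>" "z \<in> slit_plane \<omega>"
  shows "bessel_I1 \<omega> (- \<eta>) z = bessel_I1 \<omega> \<eta> z"
proof -
  have z: "z \<noteq> 0" using assms by (simp add: slit_plane_def)
  have D: "(bessel_I \<omega> \<eta> has_field_derivative bessel_I1 \<omega> \<eta> z / z) (at z)" for \<eta>
    using bessel_I_solution[of \<eta>] assms(2) by (simp add: bessel_solution_def)
  have "bessel_I \<omega> (- \<eta>) x = bessel_I \<omega> \<eta> x" if "x \<in> slit_plane \<omega>" for x
    using bessel_I_neg_int[OF assms(1)] that by (simp add: slit_plane_def)
  then have "(bessel_I \<omega> \<eta> has_field_derivative bessel_I1 \<omega> (- \<eta>) z / z) (at z)"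
    by (rule has_field_derivative_transform_within_open[OF D open_slit_plane[OF omega] assms(2)])
  from DERIV_unique[OF this D] z show ?thesis by simp
qed

text \<open>At an integer order numerator and denominator of the defining quotient both vanish, so
  the limit is the quotient of their derivatives in the order. The value of the cosine is its own
  inverse and moves to the numerator.\<close>

lemma bessel_K_int:
  assumes "z \<noteq> 0"
  shows "bessel_K \<omega> (of_int n) z
    = - cos (complex_of_real pi * of_int n) / 2 * (bessel_dI \<omega> (of_int n) z + bessel_dI \<omega> (- of_int n) z)"
proof -
  let ?n = "of_int n :: complex" and ?pi = "complex_of_real pi"
  let ?h = "\<lambda>\<xi>. bessel_I \<omega> (- \<xi>) z - bessel_I \<omega> \<xi> z"
  let ?L = "- bessel_dI \<omega> (- ?n) z - bessel_dI \<omega> ?n z"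
  have c: "cos (?pi * ?n) * cos (?pi * ?n) = 1" and s: "sin (?pi * ?n) = 0"
  proof -
    show s: "sin (?pi * ?n) = 0"
      unfolding sin_eq_0 by (rule exI[of _ n]) simp
    show "cos (?pi * ?n) * cos (?pi * ?n) = 1"
      using sin_cos_squared_add[of "?pi * ?n"] s by (simp add: power2_eq_square)
  qed
  have h0: "?h ?n = 0" using bessel_I_neg_int[of ?n z] assms by simp
  have "(?h has_field_derivative bessel_dI \<omega> (- ?n) z * (- 1) - bessel_dI \<omega> ?n z) (at ?n)"
    by (intro DERIV_diff bessel_I_neg_has_deriv_param bessel_I_has_deriv_param)
  then have A: "((\<lambda>\<xi>. ?h \<xi> / (\<xi> - ?n)) \<longlongrightarrow> ?L) (at ?n)"
    unfolding has_field_derivative_iff using h0 by simp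
  have "((\<lambda>\<xi>. sin (\<xi> * ?pi)) has_field_derivative cos (?n * ?pi) * ?pi) (at ?n)"
    by (auto intro!: derivative_eq_intros)
  then have B: "((\<lambda>\<xi>. sin (\<xi> * ?pi) / (\<xi> - ?n)) \<longlongrightarrow> cos (?n * ?pi) * ?pi) (at ?n)"
    unfolding has_field_derivative_iff using s by (simp add: mult.commute)
  have nz: "cos (?n * ?pi) * ?pi \<noteq> 0" using c by (auto simp: mult.commute)
  have "((\<lambda>\<xi>. ?pi / 2 * ((?h \<xi> / (\<xi> - ?n)) / (sin (\<xi> * ?pi) / (\<xi> - ?n)))) \<longlongrightarrow>
      ?pi / 2 * (?L / (cos (?n * ?pi) * ?pi))) (at ?n)"
    by (intro tendsto_intros A B nz)
  moreover have "\<forall>\<^sub>F \<xi> in at ?n.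
      ?pi / 2 * ((?h \<xi> / (\<xi> - ?n)) / (sin (\<xi> * ?pi) / (\<xi> - ?n))) = bessel_K_nonint \<omega> \<xi> z"
    by (simp add: eventually_at_filter bessel_K_nonint_def)
  ultimately have "((\<lambda>\<xi>. bessel_K_nonint \<omega> \<xi> z) \<longlongrightarrow> ?pi / 2 * (?L / (cos (?n * ?pi) * ?pi))) (at ?n)"
    by (rule Lim_transform_eventually)
  then have "bessel_K \<omega> ?n z = ?pi / 2 * (?L / (cos (?n * ?pi) * ?pi))"
    unfolding bessel_K_def by (simp add: tendsto_Lim)
  also have "\<dots> = ?L / 2 / cos (?pi * ?n)" by (simp add: mult.commute)
  also have "\<dots> = ?L / 2 * cos (?pi * ?n)"
    by (simp only: divide_inverse[of "?L / 2"] inverse_unique[OF c])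
  finally show ?thesis by (simp only: minus_divide_left[symmetric]) (simp add: field_simps)
qed

text \<open>Formed with \<open>z F'\<close> instead of \<open>F'\<close>, the Wronskian of
  \<open>I\<close> and \<open>K\<close> is the constant -1 for every order; its not vanishing is
  what the spanning argument relies on.\<close>

lemma bessel_fundamental_system:
  "\<exists>I1 K1. bessel_solution \<omega> \<eta> (bessel_I \<omega> \<eta>) I1 \<and> bessel_solution \<omega> \<eta> (bessel_K \<omega> \<eta>) K1 \<and>
     (\<forall>z\<in>slit_plane \<omega>. bessel_I \<omega> \<eta> z * K1 z - bessel_K \<omega> \<eta> z * I1 z = -1)"
proof (cases "\<eta> \<in> \<int>")
  case False
  let ?c = "complex_of_real pi / 2 / sin (complex_of_real pi * \<eta>)"
  have s: "sin (complex_of_real pi * \<eta>) \<noteq> 0"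
    using False by (auto simp: sin_eq_0 mult.commute)
  let ?K1 = "\<lambda>z. ?c * bessel_I1 \<omega> (- \<eta>) z + (- ?c) * bessel_I1 \<omega> \<eta> z"
  have "bessel_solution \<omega> \<eta> (bessel_I \<omega> (- \<eta>)) (bessel_I1 \<omega> (- \<eta>))"
    using bessel_I_solution[of "- \<eta>"] by (simp add: bessel_solution_def)
  then have "bessel_solution \<omega> \<eta> (\<lambda>z. ?c * bessel_I \<omega> (- \<eta>) z + (- ?c) * bessel_I \<omega> \<eta> z) ?K1"
    by (intro bessel_solution_linear bessel_I_solution)
  also have "(\<lambda>z. ?c * bessel_I \<omega> (- \<eta>) z + (- ?c) * bessel_I \<omega> \<eta> z) = bessel_K \<omega> \<eta>"
    using False by (simp add: fun_eq_iff bessel_K_def bessel_K_nonint_def mult.commute diff_divide_distrib right_diff_distrib)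
  finally have "bessel_solution \<omega> \<eta> (bessel_K \<omega> \<eta>) ?K1" .
  moreover have "bessel_I \<omega> \<eta> z * ?K1 z - bessel_K \<omega> \<eta> z * bessel_I1 \<omega> \<eta> z = -1" for z
  proof -
    have K: "bessel_K \<omega> \<eta> z = ?c * bessel_I \<omega> (- \<eta>) z - ?c * bessel_I \<omega> \<eta> z"
      using False by (simp add: bessel_K_def bessel_K_nonint_def mult.commute diff_divide_distrib right_diff_distrib)
    have "bessel_I \<omega> \<eta> z * ?K1 z - bessel_K \<omega> \<eta> z * bessel_I1 \<omega> \<eta> z =
      ?c * (bessel_I \<omega> \<eta> z * bessel_I1 \<omega> (- \<eta>) z - bessel_I \<omega> (- \<eta>) z * bessel_I1 \<omega> \<eta> z)"
      unfolding K by (simp add: algebra_simps)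
    also have "\<dots> = -1" unfolding bessel_I_wronskian_neg using s by simp
    finally show ?thesis .
  qed
  ultimately show ?thesis using bessel_I_solution by blast
next
  case True
  then obtain n where n: "\<eta> = of_int n" by (auto elim: Ints_cases)
  define c where "c = cos (complex_of_real pi * \<eta>)"
  have s: "sin (complex_of_real pi * \<eta>) = 0"
    unfolding sin_eq_0 n by (rule exI[of _ n]) simp
  have c: "c * c = 1"
    using sin_cos_squared_add[of "complex_of_real pi * \<eta>"] s unfolding c_def by (simp add: power2_eq_square)
  let ?K = "\<lambda>z. - c / 2 * bessel_dI \<omega> \<eta> z + (- c / 2) * bessel_dI \<omega> (- \<eta>) z"
  let ?K1 = "\<lambda>z. - c / 2 * bessel_dI1 \<omega> \<eta> z + (- c / 2) * bessel_dI1 \<omega> (- \<eta>) z"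
  have K: "bessel_K \<omega> \<eta> z = ?K z" if "z \<in> slit_plane \<omega>" for z
    using bessel_K_int[of z n] n that unfolding c_def by (simp add: slit_plane_def algebra_simps)
  have "bessel_solution \<omega> \<eta> (bessel_K \<omega> \<eta>) ?K1"
    unfolding bessel_solution_def
  proof (intro ballI conjI)
    fix z assume z: "z \<in> slit_plane \<omega>"
    then have I: "bessel_I \<omega> (- \<eta>) z = bessel_I \<omega> \<eta> z"
      using bessel_I_neg_int[OF True] by (simp add: slit_plane_def)
    have "(?K has_field_derivative - c / 2 * (bessel_dI1 \<omega> \<eta> z / z) + (- c / 2) * (bessel_dI1 \<omega> (- \<eta>) z / z)) (at z)"
      by (intro DERIV_add DERIV_cmult bessel_dI_has_deriv z)
    then have "(?K has_field_derivative ?K1 z / z) (at z)"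
      by (rule DERIV_cong) (simp add: add_divide_distrib diff_divide_distrib)
    then show "(bessel_K \<omega> \<eta> has_field_derivative ?K1 z / z) (at z)"
      by (rule has_field_derivative_transform_within_open[OF _ open_slit_plane[OF omega] z]) (use K in auto)
    \<comment> \<open>The terms \<open>2 * \<eta> * I\<close> of the two orders carry opposite signs
      and cancel, because \<open>I\<close> takes the same value at both.\<close>
    have "(?K1 has_field_derivative
        - c / 2 * (((z\<^sup>2 + \<eta>\<^sup>2) * bessel_dI \<omega> \<eta> z + 2 * \<eta> * bessel_I \<omega> \<eta> z) / z) +
        (- c / 2) * (((z\<^sup>2 + (- \<eta>)\<^sup>2) * bessel_dI \<omega> (- \<eta>) z + 2 * (- \<eta>) * bessel_I \<omega> (- \<eta>) z) / z)) (at z)"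
      by (intro DERIV_add DERIV_cmult bessel_dI_has_deriv z)
    then show "(?K1 has_field_derivative (z\<^sup>2 + \<eta>\<^sup>2) * bessel_K \<omega> \<eta> z / z) (at z)"
      by (rule DERIV_cong) (use z in \<open>simp add: slit_plane_def I K[OF z] field_simps\<close>)
  qed
  moreover have "bessel_I \<omega> \<eta> z * ?K1 z - bessel_K \<omega> \<eta> z * bessel_I1 \<omega> \<eta> z = -1"
    if z: "z \<in> slit_plane \<omega>" for z
  proof -
    have I: "bessel_I \<omega> (- \<eta>) z = bessel_I \<omega> \<eta> z"
      using bessel_I_neg_int[OF True] z by (simp add: slit_plane_def)
    have I1: "bessel_I1 \<omega> (- \<eta>) z = bessel_I1 \<omega> \<eta> z"
      using bessel_I1_neg_int[OF True z] .
    have "((\<lambda>\<eta>. bessel_I \<omega> \<eta> z * bessel_I1 \<omega> (- \<eta>) z - bessel_I \<omega> (- \<eta>) z * bessel_I1 \<omega> \<eta> z)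
      has_field_derivative
      (bessel_I \<omega> \<eta> z * (bessel_dI1 \<omega> (- \<eta>) z * (- 1)) + bessel_dI \<omega> \<eta> z * bessel_I1 \<omega> (- \<eta>) z)
      - (bessel_I \<omega> (- \<eta>) z * bessel_dI1 \<omega> \<eta> z + (bessel_dI \<omega> (- \<eta>) z * (- 1)) * bessel_I1 \<omega> \<eta> z)) (at \<eta>)"
      by (intro DERIV_diff DERIV_mult' bessel_I_has_deriv_param bessel_I1_has_deriv_param
          bessel_I_neg_has_deriv_param bessel_I1_neg_has_deriv_param)
    moreover have "((\<lambda>\<eta>. - 2 * sin (complex_of_real pi * \<eta>) / complex_of_real pi)
      has_field_derivative - 2 * c) (at \<eta>)"
      unfolding c_def by (auto intro!: derivative_eq_intros)
    ultimately have "bessel_I \<omega> \<eta> z * (bessel_dI1 \<omega> (- \<eta>) z * (- 1)) + bessel_dI \<omega> \<eta> z * bessel_I1 \<omega> (- \<eta>) z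
      - (bessel_I \<omega> (- \<eta>) z * bessel_dI1 \<omega> \<eta> z + (bessel_dI \<omega> (- \<eta>) z * (- 1)) * bessel_I1 \<omega> \<eta> z) = - 2 * c"
      unfolding bessel_I_wronskian_neg by (rule DERIV_unique)
    then have Y: "bessel_I1 \<omega> \<eta> z * (bessel_dI \<omega> \<eta> z + bessel_dI \<omega> (- \<eta>) z)
       - bessel_I \<omega> \<eta> z * (bessel_dI1 \<omega> \<eta> z + bessel_dI1 \<omega> (- \<eta>) z) = - 2 * c"
      unfolding I I1 by (simp add: algebra_simps)
    \<comment> \<open>Scaling by \<open>c / 2\<close> reproduces the normalisation of
      \<open>K\<close>, and \<open>c * c = 1\<close> makes the value -1.\<close>
    have "c / 2 * (bessel_I1 \<omega> \<eta> z * (bessel_dI \<omega> \<eta> z + bessel_dI \<omega> (- \<eta>) z)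
       - bessel_I \<omega> \<eta> z * (bessel_dI1 \<omega> \<eta> z + bessel_dI1 \<omega> (- \<eta>) z)) = c / 2 * (- 2 * c)"
      unfolding Y ..
    moreover have "c / 2 * (- 2 * c) = -1" using c by simp
    ultimately show ?thesis unfolding K[OF z] by (simp add: algebra_simps)
  qed
  ultimately show ?thesis using bessel_I_solution by blast
qed

end

section \<open>Fourier series of continuously differentiable functions\<close>

lemma has_vector_derivative_imp_tendsto_quotient:
  fixes f :: "real \<Rightarrow> complex"
  assumes "(f has_vector_derivative f') (at x)"
  shows "((\<lambda>y. (f y - f x) / of_real (y - x)) \<longlongrightarrow> f') (at x)"
proof -
  have "((\<lambda>h. norm (f (x + h) - f x - h *\<^sub>R f') / norm h) \<longlongrightarrow> 0) (at 0)"
    using assms unfolding has_vector_derivative_def has_derivative_at by blast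
  moreover have "\<forall>\<^sub>F h in at 0. norm (f (x + h) - f x - h *\<^sub>R f') / norm h
      = norm ((f (x + h) - f x) / of_real h - f')"
  proof -
    have "norm (f (x + h) - f x - h *\<^sub>R f') / norm h = norm ((f (x + h) - f x) / of_real h - f')"
      if "h \<noteq> 0" for h
    proof -
      have "(f (x + h) - f x) / of_real h - f' = (f (x + h) - f x - h *\<^sub>R f') / of_real h"
        using that by (simp add: scaleR_conv_of_real diff_divide_distrib)
      then show ?thesis by (simp add: norm_divide)
    qed
    then show ?thesis by (simp add: eventually_at_filter)
  qed
  ultimately have "((\<lambda>h. norm ((f (x + h) - f x) / of_real h - f')) \<longlongrightarrow> 0) (at 0)"
    by (rule Lim_transform_eventually)
  then have "((\<lambda>h. (f (x + h) - f x) / of_real h - f') \<longlongrightarrow> 0) (at 0)"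
    by (rule tendsto_norm_zero_cancel)
  then have "((\<lambda>h. (f (x + h) - f x) / of_real (x + h - x)) \<longlongrightarrow> f') (at 0)"
    by (simp add: LIM_zero_iff)
  then show ?thesis by (rule LIM_offset_zero_cancel)
qed

definition fourier_char :: "int \<Rightarrow> real \<Rightarrow> complex" where
  "fourier_char n x = exp (2 * complex_of_real pi * \<i> * of_int n * complex_of_real x)"

definition fourier_coeff :: "(real \<Rightarrow> complex) \<Rightarrow> int \<Rightarrow> complex" where
  "fourier_coeff g n = integral {0..1} (\<lambda>x. g x * fourier_char (- n) x)"

lemma fourier_char_0 [simp]: "fourier_char 0 x = 1"
  by (simp add: fourier_char_def)

lemma fourier_char_add: "fourier_char (m + n) x = fourier_char m x * fourier_char n x"
  by (simp add: fourier_char_def exp_add[symmetric] algebra_simps)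

lemma cnj_fourier_char: "cnj (fourier_char n x) = fourier_char (- n) x"
  by (simp add: fourier_char_def exp_cnj)

lemma norm_fourier_char [simp]: "norm (fourier_char n x) = 1"
  by (simp add: fourier_char_def)

lemma fourier_char_has_vector_derivative:
  "(fourier_char n has_vector_derivative 2 * pi * \<i> * of_int n * fourier_char n x) (at x within A)"
proof -
  have "((\<lambda>z. exp (2 * complex_of_real pi * \<i> * of_int n * z)) has_field_derivative
      2 * pi * \<i> * of_int n * fourier_char n x) (at (complex_of_real x))"
    unfolding fourier_char_def by (auto intro!: derivative_eq_intros)
  then show ?thesis
    unfolding fourier_char_def[abs_def]
    by (rule has_vector_derivative_real_field[THEN has_vector_derivative_at_within])
qed

lemma continuous_on_fourier_char [continuous_intros]: "continuous_on A (fourier_char n)"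
  unfolding fourier_char_def[abs_def] by (intro continuous_intros)

lemma fourier_char_int: "fourier_char n (of_int k) = 1"
proof -
  have "fourier_char n (of_int k) = exp (\<i> * (of_int (2 * (n * k)) * pi))"
    by (simp add: fourier_char_def algebra_simps)
  also have "\<dots> = 1"
    unfolding exp_eq_1 by (auto intro!: exI[of _ "n * k"])
  finally show ?thesis .
qed

lemma integral_fourier_char:
  "integral {0..1} (fourier_char n) = (if n = 0 then 1 else 0)"
proof (cases "n = 0")
  case True
  then have "fourier_char n = (\<lambda>x. 1)" by auto
  then show ?thesis using True by simp
next
  case False
  have "(fourier_char n has_integral fourier_char n 1 / (2 * pi * \<i> * of_int n) - fourier_char n 0 / (2 * pi * \<i> * of_int n)) {0..1}"
  proof (rule fundamental_theorem_of_calculus)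
    fix x :: real
    have "((\<lambda>x. fourier_char n x / (2 * pi * \<i> * of_int n)) has_vector_derivative
        (2 * pi * \<i> * of_int n * fourier_char n x) / (2 * pi * \<i> * of_int n)) (at x within {0..1})"
      by (intro has_vector_derivative_divide fourier_char_has_vector_derivative)
    then show "((\<lambda>x. fourier_char n x / (2 * pi * \<i> * of_int n)) has_vector_derivative fourier_char n x) (at x within {0..1})"
      using False by simp
  qed simp
  then show ?thesis
    using fourier_char_int[of n 0] fourier_char_int[of n 1] False by (simp add: integral_unique)
qed

lemma integrable_mult_fourier_char:
  assumes "continuous_on {0..1} h"
  shows "(\<lambda>x. h x * fourier_char n x) integrable_on {0..1}"
  by (intro integrable_continuous_interval continuous_intros assms)

text \<open>Bessel's inequality for Fourier coefficients. With \<open>P\<close> the partial sum over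
  \<open>F\<close>, the integrals of \<open>h * cnj P\<close> and of \<open>P * cnj P\<close> both
  equal the sum of the squared coefficients, and the integral of the squared modulus of
  \<open>h - P\<close> is nonnegative.\<close>

lemma bessel_inequality:
  assumes h: "continuous_on {0..1} h" and "finite F"
  shows "(\<Sum>n\<in>F. (norm (fourier_coeff h n))\<^sup>2) \<le> integral {0..1} (\<lambda>x. (norm (h x))\<^sup>2)"
proof -
  define c where "c = fourier_coeff h"
  define P where "P x = (\<Sum>n\<in>F. c n * fourier_char n x)" for x
  have contP: "continuous_on {0..1} P"
    unfolding P_def by (intro continuous_intros)
  have I1: "integral {0..1} (\<lambda>x. h x * cnj (P x)) = of_real (\<Sum>n\<in>F. (norm (c n))\<^sup>2)"
  proof -
    have "integral {0..1} (\<lambda>x. h x * cnj (P x)) = integral {0..1} (\<lambda>x. \<Sum>n\<in>F. cnj (c n) * (h x * fourier_char (- n) x))"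
      by (simp add: P_def cnj_fourier_char sum_distrib_left mult_ac)
    also have "\<dots> = (\<Sum>n\<in>F. cnj (c n) * fourier_coeff h n)"
      unfolding fourier_coeff_def
      by (subst integral_sum)
         (auto intro!: integrable_on_mult_right integrable_mult_fourier_char h \<open>finite F\<close>)
    also have "\<dots> = of_real (\<Sum>n\<in>F. (norm (c n))\<^sup>2)"
      by (simp add: c_def mult.commute flip: complex_norm_square)
    finally show ?thesis .
  qed
  have I2: "integral {0..1} (\<lambda>x. P x * cnj (P x)) = of_real (\<Sum>n\<in>F. (norm (c n))\<^sup>2)"
  proof -
    have *: "integral {0..1} (\<lambda>x. P x * fourier_char (- n) x) = c n" if "n \<in> F" for n
    proof -
      have "integral {0..1} (\<lambda>x. P x * fourier_char (- n) x) =
         integral {0..1} (\<lambda>x. \<Sum>m\<in>F. c m * fourier_char (m - n) x)"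
        by (simp add: P_def sum_distrib_right mult.assoc flip: fourier_char_add)
      also have "\<dots> = (\<Sum>m\<in>F. c m * integral {0..1} (fourier_char (m - n)))"
        by (subst integral_sum)
           (auto intro!: integrable_on_mult_right integrable_continuous_interval continuous_intros \<open>finite F\<close>)
      also have "\<dots> = (\<Sum>m\<in>F. if m = n then c m else 0)"
        by (intro sum.cong) (auto simp: integral_fourier_char)
      finally show ?thesis using that \<open>finite F\<close> by simp
    qed
    have "integral {0..1} (\<lambda>x. P x * cnj (P x)) = integral {0..1} (\<lambda>x. \<Sum>n\<in>F. cnj (c n) * (P x * fourier_char (- n) x))"
      by (subst (2) P_def) (simp add: cnj_fourier_char sum_distrib_left mult_ac)
    also have "\<dots> = (\<Sum>n\<in>F. cnj (c n) * integral {0..1} (\<lambda>x. P x * fourier_char (- n) x))"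
      by (subst integral_sum)
         (auto intro!: integrable_on_mult_right integrable_mult_fourier_char contP \<open>finite F\<close>)
    also have "\<dots> = of_real (\<Sum>n\<in>F. (norm (c n))\<^sup>2)"
      by (simp add: * mult.commute flip: complex_norm_square)
    finally show ?thesis .
  qed
  have eq: "(norm (h x - P x))\<^sup>2 = (norm (h x))\<^sup>2 - 2 * Re (h x * cnj (P x)) + Re (P x * cnj (P x))" for x
    unfolding cmod_power2 by (simp add: power2_eq_square algebra_simps)
  have int: "(\<lambda>x. (norm (h x))\<^sup>2) integrable_on {0..1}" "(\<lambda>x. h x * cnj (P x)) integrable_on {0..1}"
      "(\<lambda>x. P x * cnj (P x)) integrable_on {0..1}"
    by (intro integrable_continuous_interval continuous_intros h contP)+
  have "((\<lambda>x. (norm (h x - P x))\<^sup>2) has_integral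
      integral {0..1} (\<lambda>x. (norm (h x))\<^sup>2) - 2 * Re (of_real (\<Sum>n\<in>F. (norm (c n))\<^sup>2))
        + Re (of_real (\<Sum>n\<in>F. (norm (c n))\<^sup>2))) {0..1}"
    unfolding eq using int[THEN integrable_integral] unfolding I1 I2
    by (intro has_integral_add has_integral_diff has_integral_mult_right has_integral_Re)
  from has_integral_nonneg[OF this] show ?thesis
    unfolding c_def by simp
qed

text \<open>Bessel's inequality makes the squared coefficients summable along every injective
  sequence of indices. The index \<open>- int k - 1\<close> is the lower end left over when
  symmetric partial sums telescope.\<close>

lemma fourier_coeff_tendsto_0:
  assumes "continuous_on {0..1} h"
  shows "(\<lambda>k. fourier_coeff h (int k)) \<longlonglongrightarrow> 0" "(\<lambda>k. fourier_coeff h (- int k - 1)) \<longlonglongrightarrow> 0"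
proof -
  have main: "(\<lambda>k. fourier_coeff h (\<sigma> k)) \<longlonglongrightarrow> 0" if "inj \<sigma>" for \<sigma> :: "nat \<Rightarrow> int"
  proof -
    have "summable (\<lambda>k. (norm (fourier_coeff h (\<sigma> k)))\<^sup>2)"
    proof (rule summableI_nonneg_bounded)
      fix N
      have "(\<Sum>k<N. (norm (fourier_coeff h (\<sigma> k)))\<^sup>2) = (\<Sum>n\<in>\<sigma> ` {..<N}. (norm (fourier_coeff h n))\<^sup>2)"
        by (subst sum.reindex) (use that in \<open>auto intro: inj_on_subset\<close>)
      also have "\<dots> \<le> integral {0..1} (\<lambda>x. (norm (h x))\<^sup>2)"
        by (intro bessel_inequality assms) auto
      finally show "(\<Sum>k<N. (norm (fourier_coeff h (\<sigma> k)))\<^sup>2) \<le> integral {0..1} (\<lambda>x. (norm (h x))\<^sup>2)" .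
    qed auto
    then have "(\<lambda>k. (norm (fourier_coeff h (\<sigma> k)))\<^sup>2) \<longlonglongrightarrow> 0"
      by (rule summable_LIMSEQ_zero)
    then have "(\<lambda>k. sqrt ((norm (fourier_coeff h (\<sigma> k)))\<^sup>2)) \<longlonglongrightarrow> sqrt 0"
      by (rule tendsto_real_sqrt)
    then show ?thesis by (simp add: tendsto_norm_zero_iff)
  qed
  show "(\<lambda>k. fourier_coeff h (int k)) \<longlonglongrightarrow> 0" "(\<lambda>k. fourier_coeff h (- int k - 1)) \<longlonglongrightarrow> 0"
    by (rule main; simp add: inj_def)+
qed

context
  fixes g g' :: "real \<Rightarrow> complex"
  assumes deriv: "\<And>x. (g has_vector_derivative g' x) (at x)"
    and cont: "continuous_on UNIV g'"
    and periodic: "\<And>x. g (x + 1) = g x"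
begin

lemma continuous_on_C1: "continuous_on A g"
  by (meson continuous_at_imp_continuous_on deriv has_vector_derivative_continuous)

lemma periodic_int: "g (x + of_int k) = g x"
proof -
  have nat: "g (x + real n) = g x" for n x
    by (induction n) (use periodic[of "x + real _"] in \<open>auto simp: add_ac\<close>)
  show ?thesis
  proof (cases "k \<ge> 0")
    case True
    then show ?thesis using nat[of x "nat k"] by simp
  next
    case False
    then show ?thesis using nat[of "x + of_int k" "nat (- k)"] by simp
  qed
qed

lemma fourier_coeff_deriv: "fourier_coeff g' n = 2 * pi * \<i> * of_int n * fourier_coeff g n"
proof -
  have "((\<lambda>x. g' x * fourier_char (- n) x + g x * (2 * pi * \<i> * of_int (- n) * fourier_char (- n) x))
      has_integral g 1 * fourier_char (- n) 1 - g 0 * fourier_char (- n) 0) {0..1}"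
  proof (rule fundamental_theorem_of_calculus)
    fix x :: real
    show "((\<lambda>x. g x * fourier_char (- n) x) has_vector_derivative
      g' x * fourier_char (- n) x + g x * (2 * pi * \<i> * of_int (- n) * fourier_char (- n) x)) (at x within {0..1})"
      using has_vector_derivative_mult[OF has_vector_derivative_at_within[OF deriv]
          fourier_char_has_vector_derivative[of "- n"]]
      by (simp only: add.commute)
  qed simp
  moreover have "((\<lambda>x. g' x * fourier_char (- n) x + (2 * pi * \<i> * of_int (- n)) * (g x * fourier_char (- n) x))
      has_integral fourier_coeff g' n + (2 * pi * \<i> * of_int (- n)) * fourier_coeff g n) {0..1}"
    unfolding fourier_coeff_def
    by (intro has_integral_add has_integral_mult_right integrable_integral integrable_mult_fourier_char
        continuous_on_C1 continuous_on_subset[OF cont]) auto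
  ultimately have "fourier_coeff g' n + (2 * pi * \<i> * of_int (- n)) * fourier_coeff g n =
      g 1 * fourier_char (- n) 1 - g 0 * fourier_char (- n) 0"
    by (intro has_integral_unique) (simp_all add: mult_ac)
  also have "\<dots> = 0"
    using periodic[of 0] fourier_char_int[of "- n" 0] fourier_char_int[of "- n" 1] by simp
  finally show ?thesis by simp
qed

text \<open>A coefficient of \<open>g\<close> is that of \<open>g'\<close> divided by
  \<open>2 * pi * \<i> * n\<close>, and \<open>a * b\<close> is at most \<open>a^2 + b^2\<close>;
  Bessel's inequality for \<open>g'\<close> and the sum of \<open>1 / n^2\<close> then suffice.
  Absolute summability is needed because the expansion is an unordered sum over the
  integers.\<close>

lemma fourier_coeff_summable: "(\<lambda>n. norm (fourier_coeff g n)) summable_on UNIV"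
proof -
  have contg': "continuous_on {0..1} g'"
    using cont continuous_on_subset by blast
  have "(\<lambda>n. (norm (fourier_coeff g' n))\<^sup>2) summable_on UNIV"
    by (rule nonneg_bdd_above_summable_on)
       (auto intro!: bdd_aboveI[where M = "integral {0..1} (\<lambda>x. (norm (g' x))\<^sup>2)"] bessel_inequality contg')
  moreover have "(\<lambda>n :: int. 1 / (of_int n)\<^sup>2 :: real) summable_on UNIV"
  proof -
    have s: "summable (\<lambda>n. 1 / (real n)\<^sup>2)"
      using inverse_power_summable[of 2, where ?'a = real] by (simp add: inverse_eq_divide)
    then have N: "(\<lambda>n. 1 / (real n)\<^sup>2) summable_on UNIV"
      by (intro norm_summable_imp_summable_on) simp
    have "(\<lambda>n :: int. 1 / (of_int n)\<^sup>2 :: real) summable_on (range int)"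
      using N by (subst summable_on_reindex) (auto simp: o_def)
    moreover have "(\<lambda>n :: int. 1 / (of_int n)\<^sup>2 :: real) summable_on (range (\<lambda>k. - int k))"
      using N by (subst summable_on_reindex) (auto simp: o_def inj_def)
    ultimately have "(\<lambda>n :: int. 1 / (of_int n)\<^sup>2 :: real) summable_on (range int \<union> range (\<lambda>k. - int k))"
      by (rule summable_on_union)
    moreover have "range int \<union> range (\<lambda>k. - int k) = UNIV"
      by (auto simp: image_iff) (metis int_cases2)
    ultimately show ?thesis by simp
  qed
  ultimately have S: "(\<lambda>n. (norm (fourier_coeff g' n))\<^sup>2 + 1 / (of_int n)\<^sup>2) summable_on UNIV"
    by (rule summable_on_add)
  have bound: "norm (fourier_coeff g n) \<le> (norm (fourier_coeff g' n))\<^sup>2 + 1 / (of_int n)\<^sup>2" if "n \<noteq> 0" for n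
  proof -
    define a b where "a = norm (fourier_coeff g' n)" and "b = 1 / \<bar>real_of_int n\<bar>"
    have "norm (fourier_coeff g n) = a * b / (2 * pi)"
      using that by (simp add: a_def b_def fourier_coeff_deriv norm_mult)
    also have "\<dots> \<le> a * b / 1"
      using pi_gt3 by (intro divide_left_mono) (auto simp: a_def b_def)
    also have "\<dots> \<le> a\<^sup>2 + b\<^sup>2"
    proof -
      have "0 \<le> (a - b)\<^sup>2" "0 \<le> a * b" by (auto simp: a_def b_def)
      then show ?thesis unfolding power2_diff by simp
    qed
    finally show ?thesis by (simp add: a_def b_def power_divide)
  qed
  have "(\<lambda>n. norm (fourier_coeff g n)) summable_on (UNIV - {0})"
    by (rule Infinite_Sum.abs_summable_on_comparison_test'[OF summable_on_subset_banach[OF S]]) (use bound in auto)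
  then have "(\<lambda>n. norm (fourier_coeff g n)) summable_on insert 0 (UNIV - {0})"
    by (subst summable_on_insert_iff) auto
  then show ?thesis by (simp add: insert_UNIV)
qed

text \<open>Dividing \<open>g - g(x0)\<close> by \<open>e\<^bsup>2\<pi>i(x - x0)\<^esup> - 1\<close> makes the partial sums of the Fourier series telescope.\<close>

lemma fourier_series_has_sum:
  "((\<lambda>n. fourier_coeff g n * fourier_char n x0) has_sum g x0) UNIV"
proof -
  define e where "e x = fourier_char 1 (x - x0)" for x
  \<comment> \<open>At the zeros of \<open>e - 1\<close> the value is the limit of the quotient,
    since \<open>e' = 2 * pi * \<i> * e\<close>. This makes \<open>h\<close> continuous, which is
    all that the decay of its coefficients requires.\<close>
  define h where "h x = (if e x = 1 then g' x / (2 * pi * \<i>) else (g x - g x0) / (e x - 1))" for x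
  have e_deriv: "(e has_vector_derivative 2 * pi * \<i> * e x) (at x)" for x
  proof -
    have e_eq: "e = (\<lambda>x. fourier_char (- 1) x0 * fourier_char 1 x)"
      by (simp add: e_def fourier_char_def fun_eq_iff flip: exp_add) (simp add: algebra_simps)
    have "(e has_vector_derivative fourier_char (- 1) x0 * (2 * pi * \<i> * of_int 1 * fourier_char 1 x)) (at x)"
      unfolding e_eq by (intro has_vector_derivative_mult_right fourier_char_has_vector_derivative)
    then show ?thesis by (simp add: e_eq mult_ac)
  qed
  have e_cont: "continuous_on A e" for A
    by (meson continuous_at_imp_continuous_on e_deriv has_vector_derivative_continuous)
  have g_eq: "g x = g x0" if "e x = 1" for x
  proof -
    from that obtain k where "2 * pi * (x - x0) = of_int (2 * k) * pi"
      unfolding e_def fourier_char_def exp_eq_1 by auto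
    then have "2 * pi * (x - x0 - of_int k) = 0" by (simp add: algebra_simps)
    then have "x = x0 + of_int k" by simp
    then show ?thesis using periodic_int by simp
  qed
  have gh: "g x - g x0 = (e x - 1) * h x" for x
    using g_eq by (auto simp: h_def)
  have "isCont h x" for x
  proof (cases "e x = 1")
    case True
    have A: "((\<lambda>y. (g y - g x) / of_real (y - x)) \<longlongrightarrow> g' x) (at x)"
      by (rule has_vector_derivative_imp_tendsto_quotient deriv)+
    have B: "((\<lambda>y. (e y - e x) / of_real (y - x)) \<longlongrightarrow> 2 * pi * \<i> * e x) (at x)"
      by (rule has_vector_derivative_imp_tendsto_quotient e_deriv)+
    have "((\<lambda>y. ((g y - g x) / of_real (y - x)) / ((e y - e x) / of_real (y - x))) \<longlongrightarrow> g' x / (2 * pi * \<i> * e x)) (at x)"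
      using True by (intro tendsto_divide A B) auto
    moreover have "\<forall>\<^sub>F y in at x. ((g y - g x) / of_real (y - x)) / ((e y - e x) / of_real (y - x)) = h y"
    proof -
      have "\<forall>\<^sub>F y in at x. (e y - e x) / of_real (y - x) \<noteq> 0"
        using B True by (intro tendsto_imp_eventually_ne) auto
      moreover have "\<forall>\<^sub>F y in at x. y \<noteq> x"
        by (simp add: eventually_at_filter)
      ultimately show ?thesis
        by eventually_elim (use True g_eq[OF True] in \<open>auto simp: h_def\<close>)
    qed
    ultimately have "(h \<longlongrightarrow> g' x / (2 * pi * \<i> * e x)) (at x)"
      by (rule Lim_transform_eventually)
    then show ?thesis using True by (simp add: isCont_def h_def)
  next
    case False
    have "isCont e x" "isCont g x"
      using e_cont[of UNIV] continuous_on_C1[of UNIV] by (auto simp: continuous_on_eq_continuous_at)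
    then have "\<forall>\<^sub>F y in nhds x. e y \<noteq> 1"
      using False by (intro tendsto_imp_eventually_ne) (auto simp: isCont_def tendsto_at_iff_tendsto_nhds)
    then have "\<forall>\<^sub>F y in nhds x. h y = (g y - g x0) / (e y - 1)"
      by eventually_elim (simp add: h_def)
    moreover have "isCont (\<lambda>y. (g y - g x0) / (e y - 1)) x"
      using False \<open>isCont e x\<close> \<open>isCont g x\<close> by (intro continuous_intros) auto
    ultimately show ?thesis
      by (simp add: isCont_cong)
  qed
  then have h_cont: "continuous_on A h" for A
    by (simp add: continuous_at_imp_continuous_on)
  define E where "E n = fourier_char n x0" for n
  have E_add: "E (m + n) = E m * E n" for m n by (simp add: E_def fourier_char_add)
  \<comment> \<open>Multiplication of \<open>h\<close> by \<open>e - 1\<close> yields the difference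
    of neighbouring coefficients of \<open>h\<close>; the constant \<open>g x0\<close> contributes
    at \<open>n = 0\<close> only.\<close>
  have tele: "fourier_coeff g n * E n - (if n = 0 then g x0 else 0)
      = fourier_coeff h (n - 1) * E (n - 1) - fourier_coeff h n * E n" for n
  proof -
    have fe: "(\<lambda>x. (g x - g x0) * fourier_char (- n) x) =
        (\<lambda>x. E (- 1) * (h x * fourier_char (- (n - 1)) x) - h x * fourier_char (- n) x)"
    proof
      fix x
      have "e x = E (- 1) * fourier_char 1 x"
        by (simp add: e_def E_def fourier_char_def flip: exp_add) (simp add: algebra_simps)
      moreover have "fourier_char (- (n - 1)) x = fourier_char 1 x * fourier_char (- n) x"
        by (simp flip: fourier_char_add)
      ultimately show "(g x - g x0) * fourier_char (- n) x =
          E (- 1) * (h x * fourier_char (- (n - 1)) x) - h x * fourier_char (- n) x"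
        unfolding gh by (simp add: algebra_simps)
    qed
    have i1: "((\<lambda>x. (g x - g x0) * fourier_char (- n) x) has_integral
        fourier_coeff g n - g x0 * (if n = 0 then 1 else 0)) {0..1}"
    proof -
      have "(fourier_char (- n) has_integral (if n = 0 then 1 else 0)) {0..1}"
        using integral_fourier_char[of "- n"] integrable_integral[of "fourier_char (- n)" "{0..1}"]
        by (simp add: integrable_continuous_interval continuous_intros)
      then show ?thesis
        unfolding left_diff_distrib fourier_coeff_def
        by (intro has_integral_diff has_integral_mult_right integrable_integral
            integrable_mult_fourier_char continuous_on_C1)
    qed
    have i2: "((\<lambda>x. E (- 1) * (h x * fourier_char (- (n - 1)) x) - h x * fourier_char (- n) x)
        has_integral E (- 1) * fourier_coeff h (n - 1) - fourier_coeff h n) {0..1}"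
      unfolding fourier_coeff_def
      by (intro has_integral_diff has_integral_mult_right integrable_integral
            integrable_mult_fourier_char h_cont)
    have "fourier_coeff g n - g x0 * (if n = 0 then 1 else 0)
        = E (- 1) * fourier_coeff h (n - 1) - fourier_coeff h n"
      by (rule has_integral_unique[OF i1[unfolded fe] i2])
    then have "(fourier_coeff g n - g x0 * (if n = 0 then 1 else 0)) * E n
        = (E (- 1) * fourier_coeff h (n - 1) - fourier_coeff h n) * E n" by simp
    moreover have "E (n - 1) = E n * E (- 1)" by (simp flip: E_add)
    moreover have "E 0 = 1" by (simp add: E_def)
    ultimately show ?thesis by (auto simp: algebra_simps split: if_splits)
  qed
  define a where "a n = fourier_coeff g n * E n" for n
  have part: "(\<Sum>n = - int N..int N. a n) = g x0 + fourier_coeff h (- int N - 1) * E (- int N - 1)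
      - fourier_coeff h (int N) * E (int N)" for N
  proof -
    have "(\<Sum>n = - int N..int N. a n - (if n = 0 then g x0 else 0)) =
        fourier_coeff h (- int N - 1) * E (- int N - 1) - fourier_coeff h (int N) * E (int N)"
    proof (induction N)
      case 0
      then show ?case using tele[of 0] by (simp add: a_def)
    next
      case (Suc N)
      have "{- int (Suc N)..int (Suc N)} = insert (- int N - 1) (insert (int N + 1) {- int N..int N})"
        by auto
      then have "(\<Sum>n = - int (Suc N)..int (Suc N). a n - (if n = 0 then g x0 else 0)) =
          (a (- int N - 1) - (if - int N - 1 = 0 then g x0 else 0)) +
          ((a (int N + 1) - (if int N + 1 = 0 then g x0 else 0)) +
           (\<Sum>n = - int N..int N. a n - (if n = 0 then g x0 else 0)))"
        by simp
      also have "\<dots> = fourier_coeff h (- int N - 1 - 1) * E (- int N - 1 - 1)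
          - fourier_coeff h (int N + 1) * E (int N + 1)"
        unfolding Suc unfolding a_def tele by simp
      finally show ?case by (simp add: algebra_simps)
    qed
    moreover have "(\<Sum>n = - int N..int N. a n - (if n = 0 then g x0 else 0))
        = (\<Sum>n = - int N..int N. a n) - g x0"
      unfolding sum_subtractf by simp
    ultimately have "(\<Sum>n = - int N..int N. a n) - g x0 =
        fourier_coeff h (- int N - 1) * E (- int N - 1) - fourier_coeff h (int N) * E (int N)"
      by (simp only:)
    then show ?thesis
      unfolding diff_eq_eq by simp
  qed
  have "(\<lambda>N. g x0 + fourier_coeff h (- int N - 1) * E (- int N - 1)
      - fourier_coeff h (int N) * E (int N)) \<longlonglongrightarrow> g x0 + 0 - 0"
  proof (intro tendsto_diff tendsto_add tendsto_const)
    show "(\<lambda>N. fourier_coeff h (- int N - 1) * E (- int N - 1)) \<longlonglongrightarrow> 0"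
      by (rule tendsto_norm_zero_cancel)
         (use fourier_coeff_tendsto_0(2)[OF h_cont, THEN tendsto_norm_zero] in \<open>simp add: norm_mult E_def\<close>)
    show "(\<lambda>N. fourier_coeff h (int N) * E (int N)) \<longlonglongrightarrow> 0"
      by (rule tendsto_norm_zero_cancel)
         (use fourier_coeff_tendsto_0(1)[OF h_cont, THEN tendsto_norm_zero] in \<open>simp add: norm_mult E_def\<close>)
  qed
  then have lim: "(\<lambda>N. \<Sum>n = - int N..int N. a n) \<longlonglongrightarrow> g x0"
    unfolding part by simp
  \<comment> \<open>So far only symmetric partial sums converge. Absolute summability gives an
    unordered sum, and the intervals from \<open>- N\<close> to \<open>N\<close> exhaust the
    integers, so the two limits agree.\<close>
  have "(\<lambda>n. norm (a n)) summable_on UNIV"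
    using fourier_coeff_summable by (simp add: a_def E_def norm_mult)
  then have "a summable_on UNIV"
    by (rule abs_summable_summable)
  then have "(a has_sum infsum a UNIV) UNIV" by simp
  moreover have "filterlim (\<lambda>N. {- int N..int N}) (finite_subsets_at_top UNIV) sequentially"
    unfolding filterlim_finite_subsets_at_top
  proof (intro allI impI)
    fix X :: "int set" assume X: "finite X \<and> X \<subseteq> UNIV"
    define M where "M = (\<Sum>x\<in>X. nat \<bar>x\<bar>)"
    have "nat \<bar>x\<bar> \<le> M" if "x \<in> X" for x
      unfolding M_def using X that by (intro member_le_sum) auto
    then have "X \<subseteq> {- int N..int N}" if "N \<ge> M" for N
      using that by fastforce
    then show "\<forall>\<^sub>F N in sequentially. finite {- int N..int N} \<and> X \<subseteq> {- int N..int N} \<and> {- int N..int N} \<subseteq> UNIV"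
      unfolding eventually_sequentially by auto
  qed
  ultimately have "(\<lambda>N. \<Sum>n = - int N..int N. a n) \<longlonglongrightarrow> infsum a UNIV"
    unfolding has_sum_def by (rule filterlim_compose)
  with lim have "infsum a UNIV = g x0" by (rule LIMSEQ_unique[symmetric])
  with \<open>(a has_sum infsum a UNIV) UNIV\<close> show ?thesis
    by (simp add: a_def[abs_def] E_def)
qed

end

section \<open>Triangular systems of second-order equations\<close>

definition scalar_solution :: "(real \<Rightarrow> complex) \<Rightarrow> (real \<Rightarrow> complex) \<Rightarrow> (real \<Rightarrow> complex) \<Rightarrow> bool" where
  "scalar_solution q w w' \<longleftrightarrow> (\<forall>y>0. (w has_vector_derivative w' y) (at y) \<and>
     (w' has_vector_derivative q y * w y) (at y))"

abbreviation chain_rhs ::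
  "(real \<Rightarrow> complex) \<Rightarrow> complex \<Rightarrow> complex \<Rightarrow> (nat \<Rightarrow> real \<Rightarrow> complex) \<Rightarrow> nat \<Rightarrow> real \<Rightarrow> complex"
  where "chain_rhs q \<beta> \<gamma> u m y \<equiv>
    q y * u m y + (if m \<ge> 1 then \<beta> * u (m - 1) y else 0) + (if m \<ge> 2 then \<gamma> * u (m - 2) y else 0)"

text \<open>Dividing the component \<open>m\<close> of a vector by \<open>m!\<close> makes the coefficients of the system independent of \<open>m\<close>,
  so that shifting a solution in \<open>m\<close> yields another solution.\<close>

definition chain_solution ::
  "(real \<Rightarrow> complex) \<Rightarrow> complex \<Rightarrow> complex \<Rightarrow> nat \<Rightarrow> (nat \<Rightarrow> real \<Rightarrow> complex) \<Rightarrow> bool" where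
  "chain_solution q \<beta> \<gamma> d u \<longleftrightarrow> (\<exists>u'. \<forall>m<d. \<forall>y>0.
     (u m has_vector_derivative u' m y) (at y) \<and>
     (u' m has_vector_derivative chain_rhs q \<beta> \<gamma> u m y) (at y))"

lemma constant_on_positive_reals:
  fixes W :: "real \<Rightarrow> complex"
  assumes "\<And>y. y > 0 \<Longrightarrow> (W has_vector_derivative 0) (at y)"
  obtains c where "\<And>y. y > 0 \<Longrightarrow> W y = c"
proof -
  have "W y = W 1" if "y > 0" for y
  proof (rule has_derivative_zero_unique_strong_connected[where f = W and S = "{0<..}" and K = "{}" and c = 1])
    show "continuous_on {0<..} W"
      by (intro continuous_at_imp_continuous_on ballI has_vector_derivative_continuous[OF assms]) auto
    show "(W has_derivative (\<lambda>h. 0)) (at x within {0<..})" if "x \<in> {0<..} - {}" for x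
      using assms[of x] that by (auto simp: has_vector_derivative_def intro: has_derivative_at_withinI)
  qed (use that in auto)
  then show ?thesis using that by blast
qed

text \<open>The equation has no first-order term, so Abel's formula gives a constant.\<close>

lemma wronskian_constant:
  assumes "scalar_solution q v v'" "scalar_solution q w w'"
  obtains c where "\<And>y. y > 0 \<Longrightarrow> v y * w' y - w y * v' y = c"
proof (rule constant_on_positive_reals)
  fix y :: real assume "y > 0"
  with assms have v: "(v has_vector_derivative v' y) (at y)" "(v' has_vector_derivative q y * v y) (at y)"
    and w: "(w has_vector_derivative w' y) (at y)" "(w' has_vector_derivative q y * w y) (at y)"
    by (auto simp: scalar_solution_def)
  have "((\<lambda>y. v y * w' y - w y * v' y) has_vector_derivative
      (v y * (q y * w y) + v' y * w' y) - (w y * (q y * v y) + w' y * v' y)) (at y)"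
    by (intro has_vector_derivative_diff has_vector_derivative_mult v w)
  then show "((\<lambda>y. v y * w' y - w y * v' y) has_vector_derivative 0) (at y)"
    by (simp add: mult_ac)
qed blast

text \<open>Cramer's rule with Wronskians.\<close>

lemma scalar_solution_span:
  assumes v: "scalar_solution q v v'" and w: "scalar_solution q w w'" and u: "scalar_solution q u u'"
    and W: "\<And>y. y > 0 \<Longrightarrow> v y * w' y - w y * v' y = W" "W \<noteq> 0"
  obtains a b where "\<And>y. y > 0 \<Longrightarrow> u y = a * v y + b * w y"
proof -
  obtain c1 where c1: "\<And>y. y > 0 \<Longrightarrow> u y * w' y - w y * u' y = c1"
    using wronskian_constant[OF u w] by blast
  obtain c2 where c2: "\<And>y. y > 0 \<Longrightarrow> v y * u' y - u y * v' y = c2"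
    using wronskian_constant[OF v u] by blast
  have "u y = c1 / W * v y + c2 / W * w y" if "y > 0" for y
  proof -
    have "u y * W = c1 * v y + c2 * w y"
      unfolding c1[OF that, symmetric] c2[OF that, symmetric] W(1)[OF that, symmetric]
      by (simp add: algebra_simps)
    then show ?thesis using W(2) by (simp add: field_simps)
  qed
  then show ?thesis using that by blast
qed

text \<open>Induction on the number of components. The combination with the coefficients found so
  far agrees with \<open>u\<close> below level \<open>M\<close>; in the difference at level
  \<open>M\<close> the coupling terms therefore cancel, it solves the scalar equation, and its
  expansion in \<open>P 0\<close> and \<open>Q 0\<close> supplies the coefficients with index
  \<open>M\<close>.\<close>

lemma chain_solution_span:
  assumes u: "chain_solution q \<beta> \<gamma> d u"
    and P: "chain_solution q \<beta> \<gamma> d P" and Q: "chain_solution q \<beta> \<gamma> d Q"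
    and p: "scalar_solution q (P 0) p'" and q: "scalar_solution q (Q 0) q'"
    and W: "\<And>y. y > 0 \<Longrightarrow> P 0 y * q' y - Q 0 y * p' y = W" "W \<noteq> 0"
  shows "\<exists>a b. \<forall>m<d. \<forall>y>0. u m y = (\<Sum>k\<le>m. a k * P (m - k) y + b k * Q (m - k) y)"
proof -
  have "\<exists>a b. \<forall>m<M. \<forall>y>0. u m y = (\<Sum>k\<le>m. a k * P (m - k) y + b k * Q (m - k) y)" if "M \<le> d" for M
    using that
  proof (induction M)
    case 0
    then show ?case by simp
  next
    case (Suc M)
    then obtain a b where ab: "\<And>m y. m < M \<Longrightarrow> y > 0 \<Longrightarrow>
        u m y = (\<Sum>k\<le>m. a k * P (m - k) y + b k * Q (m - k) y)"
      by auto
    obtain u' where u': "\<And>m y. m < d \<Longrightarrow> y > 0 \<Longrightarrow> (u m has_vector_derivative u' m y) (at y) \<and>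
       (u' m has_vector_derivative chain_rhs q \<beta> \<gamma> u m y) (at y)"
      using u unfolding chain_solution_def by blast
    obtain P' where P': "\<And>m y. m < d \<Longrightarrow> y > 0 \<Longrightarrow> (P m has_vector_derivative P' m y) (at y) \<and>
       (P' m has_vector_derivative chain_rhs q \<beta> \<gamma> P m y) (at y)"
      using P unfolding chain_solution_def by blast
    obtain Q' where Q': "\<And>m y. m < d \<Longrightarrow> y > 0 \<Longrightarrow> (Q m has_vector_derivative Q' m y) (at y) \<and>
       (Q' m has_vector_derivative chain_rhs q \<beta> \<gamma> Q m y) (at y)"
      using Q unfolding chain_solution_def by blast
    \<comment> \<open>The guard makes the same formula valid at \<open>M\<close>,
      \<open>M - 1\<close> and \<open>M - 2\<close>, so that \<open>R\<close> itself obeys the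
      system at level \<open>M\<close>.\<close>
    define R where "R m y = (\<Sum>k<M. if k \<le> m then a k * P (m - k) y + b k * Q (m - k) y else 0)" for m y
    define R' where "R' y = (\<Sum>k<M. a k * P' (M - k) y + b k * Q' (M - k) y)" for y
    have uR: "u m y = R m y" if "m < M" "y > 0" for m y
    proof -
      have "R m y = (\<Sum>k\<in>{..<M} \<inter> {k. k \<le> m}. a k * P (m - k) y + b k * Q (m - k) y)"
        unfolding R_def by (subst sum.inter_restrict) auto
      also have "{..<M} \<inter> {k. k \<le> m} = {..m}" using that by auto
      finally show ?thesis using ab that by simp
    qed
    have "scalar_solution q (\<lambda>y. u M y - R M y) (\<lambda>y. u' M y - R' y)"
      unfolding scalar_solution_def
    proof (intro allI impI conjI)
      fix y :: real assume y: "y > 0"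
      have RM: "R M = (\<lambda>y. \<Sum>k<M. a k * P (M - k) y + b k * Q (M - k) y)"
        unfolding R_def by (intro ext sum.cong) auto
      have M: "M < d" using Suc by simp
      show "((\<lambda>y. u M y - R M y) has_vector_derivative u' M y - R' y) (at y)"
        unfolding RM R'_def using u'[OF M y] P' Q' y M
        by (intro has_vector_derivative_diff has_vector_derivative_sum has_vector_derivative_add
            has_vector_derivative_mult_right) auto
      let ?t = "\<lambda>F m y. chain_rhs q \<beta> \<gamma> F m y :: complex"
      have D: "((\<lambda>y. u' M y - R' y) has_vector_derivative
         ?t u M y - (\<Sum>k<M. a k * ?t P (M - k) y + b k * ?t Q (M - k) y)) (at y)"
        unfolding R'_def using u'[OF M y] P' Q' y M
        by (intro has_vector_derivative_diff has_vector_derivative_sum has_vector_derivative_add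
            has_vector_derivative_mult_right) auto
      have "(\<Sum>k<M. a k * ?t P (M - k) y + b k * ?t Q (M - k) y) = ?t R M y"
      proof -
        have 1: "(if M \<ge> 1 then \<beta> * R (M - 1) y else 0) =
          (\<Sum>k<M. a k * (if M - k \<ge> 1 then \<beta> * P (M - k - 1) y else 0) + b k * (if M - k \<ge> 1 then \<beta> * Q (M - k - 1) y else 0))"
          unfolding R_def by (cases "M = 0")
            (auto simp: sum_distrib_left algebra_simps diff_commute intro!: sum.cong)
        have 2: "(if M \<ge> 2 then \<gamma> * R (M - 2) y else 0) =
          (\<Sum>k<M. a k * (if M - k \<ge> 2 then \<gamma> * P (M - k - 2) y else 0) + b k * (if M - k \<ge> 2 then \<gamma> * Q (M - k - 2) y else 0))"
        proof (cases "M \<ge> 2")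
          case True
          then show ?thesis
            unfolding R_def
            by (auto simp: sum_distrib_left algebra_simps diff_commute intro!: sum.cong)
        next
          case False
          then have "\<not> M - k \<ge> 2" for k by arith
          with False show ?thesis by simp
        qed
        have 0: "q y * R M y = (\<Sum>k<M. a k * (q y * P (M - k) y) + b k * (q y * Q (M - k) y))"
          unfolding RM by (simp add: sum_distrib_left algebra_simps)
        show ?thesis unfolding 0 1 2
          by (simp only: sum.distrib[symmetric] distrib_left add_ac)
      qed
      moreover have "?t u M y = q y * u M y + (if M \<ge> 1 then \<beta> * R (M - 1) y else 0)
         + (if M \<ge> 2 then \<gamma> * R (M - 2) y else 0)"
        using uR y by auto
      ultimately show "((\<lambda>y. u' M y - R' y) has_vector_derivative q y * (u M y - R M y)) (at y)"
        using D by (simp add: algebra_simps)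
    qed
    from scalar_solution_span[OF p q this W] obtain a0 b0
      where a0: "\<And>y. y > 0 \<Longrightarrow> u M y - R M y = a0 * P 0 y + b0 * Q 0 y" by blast
    have "u m y = (\<Sum>k\<le>m. (a(M := a0)) k * P (m - k) y + (b(M := b0)) k * Q (m - k) y)"
      if "m < Suc M" "y > 0" for m y
    proof (cases "m = M")
      case False
      then show ?thesis using that ab by (auto intro!: sum.cong)
    next
      case True
      have "R M y = (\<Sum>k<M. (a(M := a0)) k * P (M - k) y + (b(M := b0)) k * Q (M - k) y)"
        unfolding R_def by (intro sum.cong) auto
      with a0[OF that(2)] show ?thesis
        unfolding True by (simp add: lessThan_Suc_atMost[symmetric] algebra_simps)
    qed
    then show ?case by blast
  qed
  then show ?thesis by blast
qed

text \<open>With \<open>\<beta> = 0\<close> only components of equal parity interact, and inside one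
  class the coupling over two steps becomes a coupling over one. The new length counts the
  \<open>m\<close> with \<open>2 * m + r < d\<close>.\<close>

lemma chain_solution_parity:
  assumes "chain_solution q 0 \<gamma> d u" "r < 2"
  shows "chain_solution q \<gamma> 0 ((d + 1 - r) div 2) (\<lambda>m. u (2 * m + r))"
proof -
  obtain u' where u': "\<And>m y. m < d \<Longrightarrow> y > 0 \<Longrightarrow> (u m has_vector_derivative u' m y) (at y) \<and>
       (u' m has_vector_derivative chain_rhs q 0 \<gamma> u m y) (at y)"
    using assms unfolding chain_solution_def by blast
  show ?thesis unfolding chain_solution_def
  proof (intro exI[of _ "\<lambda>m. u' (2 * m + r)"] allI impI)
    fix m y assume m: "m < (d + 1 - r) div 2" and y: "y > (0::real)"
    then have md: "2 * m + r < d" using assms(2) by linarith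
    have "(if 2 * m + r \<ge> 2 then \<gamma> * u (2 * m + r - 2) y else 0) = (if m \<ge> 1 then \<gamma> * u (2 * (m - 1) + r) y else 0)"
      using assms(2) by (cases m) auto
    then show "(u (2 * m + r) has_vector_derivative u' (2 * m + r) y) (at y) \<and>
       (u' (2 * m + r) has_vector_derivative q y * u (2 * m + r) y
        + (if m \<ge> 1 then \<gamma> * u (2 * (m - 1) + r) y else 0) + (if m \<ge> 2 then 0 * u (2 * (m - 2) + r) y else 0)) (at y)"
      using u'[OF md y] by (simp only: mult_zero_left if_cancel add_0_right)
  qed
qed

section \<open>Coefficients of powers of the logarithm\<close>

context
  includes fps_syntax
begin

text \<open>The substitutions \<open>t = exp \<tau> - 1\<close> and \<open>\<tau> = log (1 + t)\<close> exchange multiplication by \<open>1 + t\<close>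
  (the matrix \<open>J / \<lambda>\<close>) with multiplication by \<open>exp \<tau>\<close>; up to factorials the second one is the matrix \<open>T\<close>.\<close>

definition log_coeff :: "nat \<Rightarrow> nat \<Rightarrow> complex" where
  "log_coeff m j = (fps_ln 1 ^ j) $ m"

definition exp_coeff :: "nat \<Rightarrow> nat \<Rightarrow> complex" where
  "exp_coeff m k = ((fps_exp 1 - 1) ^ k) $ m"

lemma log_coeff_eq_0: "j > m \<Longrightarrow> log_coeff m j = 0"
  unfolding log_coeff_def by (intro startsby_zero_power_prefix[rule_format]) auto

lemma exp_coeff_eq_0: "k > m \<Longrightarrow> exp_coeff m k = 0"
  unfolding exp_coeff_def by (intro startsby_zero_power_prefix[rule_format]) auto

text \<open>The identity \<open>(1 + t)^x = exp (x log (1 + t))\<close>, by uniqueness for the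
  differential equation of the binomial series. It links the binomial entries of \<open>J^x\<close>
  to exponentials.\<close>

lemma fps_exp_compose_ln: "fps_exp (x :: complex) oo fps_ln 1 = fps_binomial x"
proof -
  have "fps_deriv (fps_exp x oo fps_ln 1) = fps_const x * (fps_exp x oo fps_ln 1) / (1 + fps_X)"
    by (simp add: fps_compose_deriv fps_ln_deriv fps_compose_mult_distrib fps_divide_unit mult.assoc)
  then show ?thesis
    by (subst fps_binomial_ODE_unique'[symmetric]) simp
qed

lemma log_exp_coeff_inverse: "(\<Sum>j\<le>m. log_coeff m j * exp_coeff j k) = (if m = k then 1 else 0)"
proof -
  have "(fps_exp 1 - 1 :: complex fps) oo fps_ln 1 = fps_X"
    by (simp add: fps_compose_sub_distrib fps_exp_compose_ln fps_binomial_1)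
  then have "(fps_exp 1 - 1 :: complex fps) ^ k oo fps_ln 1 = fps_X ^ k"
    by (simp flip: fps_compose_power)
  then have "((fps_exp 1 - 1 :: complex fps) ^ k oo fps_ln 1) $ m = (if m = k then 1 else 0)"
    by simp
  then show ?thesis
    by (simp add: fps_compose_nth log_coeff_def exp_coeff_def atLeast0AtMost mult.commute)
qed

text \<open>Coefficientwise form of \<open>(1 + t) t^k = exp \<tau> t^k\<close> for
  \<open>t = exp \<tau> - 1\<close>.\<close>

lemma exp_coeff_Suc:
  "exp_coeff m k + exp_coeff m (Suc k) = (\<Sum>j\<le>m. exp_coeff (m - j) k / fact j)"
proof -
  have "(fps_exp 1 - 1) ^ k + (fps_exp 1 - 1) ^ Suc k = fps_exp 1 * (fps_exp 1 - 1 :: complex fps) ^ k"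
    by (simp add: algebra_simps)
  then have "((fps_exp 1 - 1) ^ k + (fps_exp 1 - 1) ^ Suc k) $ m
      = (fps_exp 1 * (fps_exp 1 - 1 :: complex fps) ^ k) $ m" by (rule arg_cong)
  then show ?thesis
    unfolding exp_coeff_def by (simp add: fps_mult_nth atLeast0AtMost field_simps)
qed

text \<open>Both sides are the coefficient of \<open>t^m\<close> in
  \<open>(1 + t)^x (log (1 + t))^j\<close>, expanded once as a product and once by substituting
  \<open>\<tau> = log (1 + t)\<close> into \<open>exp (x \<tau>) \<tau>^j\<close>.\<close>

lemma gbinomial_log_coeff:
  "(\<Sum>k\<le>m. (x gchoose k) * log_coeff (m - k) j) = (\<Sum>k\<le>m. x ^ k / fact k * log_coeff m (j + k))"
proof -
  have "(\<Sum>k\<le>m. (x gchoose k) * log_coeff (m - k) j) = (fps_binomial x * fps_ln 1 ^ j) $ m"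
    by (simp add: fps_mult_nth log_coeff_def atLeast0AtMost)
  also have "fps_binomial x * fps_ln 1 ^ j = (fps_exp x * fps_X ^ j) oo fps_ln 1"
    by (simp add: fps_compose_mult_distrib fps_exp_compose_ln flip: fps_compose_power)
  also have "\<dots> $ m = (\<Sum>i\<le>m. (if i < j then 0 else x ^ (i - j) / fact (i - j)) * log_coeff m i)"
    unfolding fps_compose_nth log_coeff_def atLeast0AtMost
    by (intro sum.cong) (auto simp: fps_X_power_mult_right_nth)
  also have "\<dots> = (\<Sum>i\<le>m + j. (if i < j then 0 else x ^ (i - j) / fact (i - j)) * log_coeff m i)"
    by (intro sum.mono_neutral_left) (auto simp: log_coeff_eq_0)
  also have "\<dots> = (\<Sum>i\<in>{j..m + j}. x ^ (i - j) / fact (i - j) * log_coeff m i)"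
    by (rule sum.mono_neutral_cong_right) auto
  also have "\<dots> = (\<Sum>k\<in>{0..m}. x ^ k / fact k * log_coeff m (k + j))"
    using sum.shift_bounds_cl_nat_ivl[of "\<lambda>i. x ^ (i - j) / fact (i - j) * log_coeff m i" 0 j m] by simp
  finally show ?thesis by (simp add: atLeast0AtMost add.commute)
qed

text \<open>The coefficient of \<open>t^m\<close> in \<open>exp (x log (1 + t))\<close> is a
  polynomial in \<open>x\<close> equal to \<open>x gchoose m\<close>; comparing it with the falling
  factorial that generates the Stirling numbers identifies the entries of \<open>T\<close>.\<close>

lemma log_coeff_conv_sstirling: "log_coeff m j = fact j * of_int (sstirling m j) / fact m"
proof -
  define p where "p = (\<Sum>i\<le>m. Polynomial.monom (log_coeff m i / fact i) i)"
  define r where "r = (\<Prod>l<m. [:- of_int (int l), 1:] :: complex poly)"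
  have "poly (Polynomial.smult (fact m) p) x = poly r x" for x
  proof -
    have "(fps_exp x oo fps_ln 1) $ m = x gchoose m"
      by (simp add: fps_exp_compose_ln)
    then have "poly p x = x gchoose m"
      by (simp add: p_def poly_sum poly_monom fps_compose_nth log_coeff_def atLeast0AtMost mult_ac)
    then show ?thesis
      by (simp add: r_def poly_prod gbinomial_prod_rev atLeast0LessThan)
  qed
  then have eq: "Polynomial.smult (fact m) p = r" by (intro poly_eq_poly_eq_iff[THEN iffD1] ext)
  have r: "poly.coeff r j = of_int (sstirling m j)"
    unfolding r_def sstirling_def
    by (induction m arbitrary: j) (auto simp: coeff_pCons mult.commute[of _ "[:_, 1:]"] split: nat.split)
  show ?thesis
  proof (cases "j \<le> m")
    case True
    then have "poly.coeff (Polynomial.smult (fact m) p) j = fact m * (log_coeff m j / fact j)"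
      by (simp add: p_def coeff_sum coeff_monom)
    with eq r show ?thesis by (simp add: field_simps)
  next
    case False
    then have "poly.coeff (Polynomial.smult (fact m) p) j = 0"
      by (simp add: p_def coeff_sum coeff_monom)
    with eq r have "(of_int (sstirling m j) :: complex) = 0" by simp
    with False show ?thesis by (simp add: log_coeff_eq_0)
  qed
qed

end

section \<open>Derivatives of solutions of Bessel's equation\<close>

lemma chain_solution_cong:
  assumes "chain_solution q \<beta> \<gamma> d u" "\<And>m y. m < d \<Longrightarrow> y > 0 \<Longrightarrow> u m y = v m y" "\<And>y. y > 0 \<Longrightarrow> q y = r y"
  shows "chain_solution r \<beta> \<gamma> d v"
proof -
  obtain u' where u': "\<And>m y. m < d \<Longrightarrow> y > 0 \<Longrightarrow> (u m has_vector_derivative u' m y) (at y) \<and>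
       (u' m has_vector_derivative chain_rhs q \<beta> \<gamma> u m y) (at y)"
    using assms(1) unfolding chain_solution_def by blast
  show ?thesis unfolding chain_solution_def
  proof (intro exI[of _ u'] allI impI conjI)
    fix m y assume m: "m < d" and y: "y > (0::real)"
    show "(v m has_vector_derivative u' m y) (at y)"
      using u'[OF m y, THEN conjunct1]
      by (rule has_vector_derivative_transform_within_open[where S = "{0<..}"]) (use y m assms(2) in auto)
    show "(u' m has_vector_derivative chain_rhs r \<beta> \<gamma> v m y) (at y)"
    proof -
      have "u m y = v m y" "u (m - 1) y = v (m - 1) y" "u (m - 2) y = v (m - 2) y" "q y = r y"
        using assms(2,3) m y by simp_all
      then show ?thesis
        using u'[OF m y, THEN conjunct2] by (simp only:)
    qed
  qed
qed

text \<open>Replacing \<tau> by -\<tau> in the generating function reverses the coupling over one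
  step and keeps the coupling over two.\<close>

lemma chain_solution_sign:
  assumes "chain_solution q \<beta> \<gamma> d u"
  shows "chain_solution q (- \<beta>) \<gamma> d (\<lambda>m y. (-1) ^ m * u m y)"
proof -
  obtain u' where u': "\<And>m y. m < d \<Longrightarrow> y > 0 \<Longrightarrow> (u m has_vector_derivative u' m y) (at y) \<and>
       (u' m has_vector_derivative chain_rhs q \<beta> \<gamma> u m y) (at y)"
    using assms(1) unfolding chain_solution_def by blast
  show ?thesis unfolding chain_solution_def
  proof (intro exI[of _ "\<lambda>m y. (-1) ^ m * u' m y"] allI impI conjI)
    fix m y assume m: "m < d" and y: "y > (0::real)"
    show "((\<lambda>y. (-1) ^ m * u m y) has_vector_derivative (-1) ^ m * u' m y) (at y)"
      by (intro has_vector_derivative_mult_right u'[OF m y, THEN conjunct1])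
    have "((\<lambda>y. (-1) ^ m * u' m y) has_vector_derivative (-1) ^ m * (chain_rhs q \<beta> \<gamma> u m y)) (at y)"
      by (intro has_vector_derivative_mult_right u'[OF m y, THEN conjunct2])
    moreover have "(-1) ^ m * (chain_rhs q \<beta> \<gamma> u m y) =
        q y * ((-1) ^ m * u m y)
        + (if m \<ge> 1 then - \<beta> * ((-1) ^ (m - 1) * u (m - 1) y) else 0)
        + (if m \<ge> 2 then \<gamma> * ((-1) ^ (m - 2) * u (m - 2) y) else 0)"
    proof -
      consider "m = 0" | "m = 1" | n where "m = Suc (Suc n)" by (metis One_nat_def not0_implies_Suc)
      then show ?thesis by cases (auto simp: algebra_simps)
    qed
    ultimately show "((\<lambda>y. (-1) ^ m * u' m y) has_vector_derivative q y * ((-1) ^ m * u m y)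
        + (if m \<ge> 1 then - \<beta> * ((-1) ^ (m - 1) * u (m - 1) y) else 0)
        + (if m \<ge> 2 then \<gamma> * ((-1) ^ (m - 2) * u (m - 2) y) else 0)) (at y)"
      by (simp only:)
  qed
qed

lemma has_vector_derivative_cong_both:
  assumes "(f has_vector_derivative f') (at x)" "\<And>x. f x = g x" "f' = g'"
  shows "(g has_vector_derivative g') (at x)"
proof -
  have "f = g" using assms(2) by blast
  with assms show ?thesis by simp
qed

text \<open>The factor \<open>of_real y ^ n\<close> is the one that \<open>n\<close> derivatives in
  \<open>\<alpha>\<close> of a function of \<open>\<alpha> * y\<close> produce.\<close>

lemma sqrt_power_has_vector_derivative:
  assumes X: "(X has_vector_derivative X') (at y)" and y: "y > 0"
  shows "((\<lambda>y. of_real (sqrt y) * of_real y ^ n * X y :: complex) has_vector_derivative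
     of_real (sqrt y) * of_real y ^ n * ((of_nat n + 1 / 2) / of_real y * X y + X')) (at y)"
proof -
  have "((\<lambda>y. sqrt y * y ^ n) has_real_derivative (sqrt y * y ^ n * (real n + 1 / 2) / y)) (at y)"
  proof -
    have D: "((\<lambda>y. sqrt y * y ^ n) has_real_derivative
        sqrt y * (real n * y ^ (n - 1)) + inverse (sqrt y) / 2 * y ^ n) (at y)"
      using y by (auto intro!: derivative_eq_intros)
    have 1: "sqrt y * (real n * y ^ (n - 1)) = sqrt y * y ^ n * real n / y"
      using y by (cases n) auto
    have "inverse (sqrt y) = sqrt y / y"
      using y by (simp add: field_simps)
    then have 2: "inverse (sqrt y) / 2 * y ^ n = sqrt y * y ^ n * (1 / 2) / y"
      by simp
    show ?thesis
      using D unfolding 1 2 by (rule DERIV_cong) (simp only: distrib_left add_divide_distrib)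
  qed
  then have "((\<lambda>y. of_real (sqrt y * y ^ n) :: complex) has_vector_derivative of_real (sqrt y * y ^ n * (real n + 1 / 2) / y)) (at y)"
    by (rule has_vector_derivative_of_real)
  from has_vector_derivative_mult[OF this X] show ?thesis
    by (rule has_vector_derivative_cong_both) (simp_all add: algebra_simps)
qed

lemma has_vector_derivative_scale_arg:
  assumes "(F has_field_derivative F') (at (\<alpha> * of_real y))"
  shows "((\<lambda>y. F (\<alpha> * complex_of_real y)) has_vector_derivative F' * \<alpha>) (at y)"
proof -
  have "((\<lambda>z. F (\<alpha> * z)) has_field_derivative F' * \<alpha>) (at (of_real y))"
    by (rule DERIV_chain2[where g = "\<lambda>z. \<alpha> * z", OF assms]) (auto intro!: derivative_eq_intros)
  then show ?thesis by (rule has_vector_derivative_real_field)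
qed

context
  fixes \<omega> \<eta> :: complex and B B1 :: "complex \<Rightarrow> complex"
  assumes omega: "\<omega> \<notin> complex_of_real ` {0..}"
    and sol: "bessel_solution \<omega> \<eta> B B1"
begin

lemma bessel_solution_holomorphic: "B holomorphic_on slit_plane \<omega>"
  using sol open_slit_plane[OF omega] unfolding bessel_solution_def
  by (auto simp: holomorphic_on_open)

lemma bessel_higher_deriv:
  assumes "z \<in> slit_plane \<omega>"
  shows "((deriv ^^ m) B has_field_derivative (deriv ^^ Suc m) B z) (at z)"
proof -
  have "(deriv ^^ m) B holomorphic_on slit_plane \<omega>"
    by (intro holomorphic_higher_deriv bessel_solution_holomorphic open_slit_plane omega)
  then show ?thesis
    using assms open_slit_plane[OF omega] by (simp add: holomorphic_derivI)
qed

text \<open>Leibniz's rule for \<open>z^2 B'' + z B' = (z^2 + \<eta>^2) B\<close>. The truncated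
  indices \<open>m - 1\<close> and \<open>m - 2\<close> are harmless, because their factors vanish
  whenever truncation occurs.\<close>

lemma bessel_higher_ode:
  assumes "z \<in> slit_plane \<omega>"
  shows "z\<^sup>2 * (deriv ^^ (m + 2)) B z + (2 * of_nat m + 1) * z * (deriv ^^ (m + 1)) B z
      + (of_nat m)\<^sup>2 * (deriv ^^ m) B z
    = (z\<^sup>2 + \<eta>\<^sup>2) * (deriv ^^ m) B z + 2 * of_nat m * z * (deriv ^^ (m - 1)) B z
      + of_nat m * (of_nat m - 1) * (deriv ^^ (m - 2)) B z"
  using assms
proof (induction m arbitrary: z)
  case 0
  note z = this
  then have z0: "z \<noteq> 0" by (simp add: slit_plane_def)
  have B1: "B1 x = x * deriv B x" if "x \<in> slit_plane \<omega>" for x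
    using sol that unfolding bessel_solution_def
    by (auto dest!: DERIV_imp_deriv simp: slit_plane_def)
  have "(B1 has_field_derivative (z * deriv (deriv B) z + deriv B z)) (at z)"
  proof (rule has_field_derivative_transform_within_open[OF _ open_slit_plane[OF omega] z])
    show "((\<lambda>x. x * deriv B x) has_field_derivative (z * deriv (deriv B) z + deriv B z)) (at z)"
      using bessel_higher_deriv[OF z, of 1] by (auto intro!: derivative_eq_intros)
  qed (simp add: B1)
  moreover have "(B1 has_field_derivative (z\<^sup>2 + \<eta>\<^sup>2) * B z / z) (at z)"
    using sol z unfolding bessel_solution_def by blast
  ultimately have "(z\<^sup>2 + \<eta>\<^sup>2) * B z / z = z * deriv (deriv B) z + deriv B z"
    by (rule DERIV_unique[symmetric])
  then show ?case using z0 by (simp add: field_simps power2_eq_square)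
next
  case (Suc m)
  note z = Suc.prems
  let ?D = "\<lambda>k. (deriv ^^ k) B"
  have D: "(?D k has_field_derivative ?D (Suc k) z) (at z)" for k
    by (rule bessel_higher_deriv[OF z])
  define L where "L = (\<lambda>z. z\<^sup>2 * ?D (m + 2) z + (2 * of_nat m + 1) * z * ?D (m + 1) z + (of_nat m)\<^sup>2 * ?D m z)"
  define R where "R = (\<lambda>z. (z\<^sup>2 + \<eta>\<^sup>2) * ?D m z + 2 * of_nat m * z * ?D (m - 1) z + of_nat m * (of_nat m - 1) * ?D (m - 2) z)"
  have L: "(L has_field_derivative z\<^sup>2 * ?D (m + 3) z + (2 * of_nat (Suc m) + 1) * z * ?D (m + 2) z
      + (of_nat (Suc m))\<^sup>2 * ?D (m + 1) z) (at z)"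
    unfolding L_def
    by (rule derivative_eq_intros D refl)+ (simp add: algebra_simps power2_eq_square numeral_3_eq_3 del: funpow.simps)
  have R: "(R has_field_derivative (z\<^sup>2 + \<eta>\<^sup>2) * ?D (m + 1) z + 2 * of_nat (Suc m) * z * ?D m z
      + of_nat (Suc m) * of_nat m * ?D (m - 1) z) (at z)"
  proof -
    \<comment> \<open>The derivative raises a truncated index correctly only when nothing was cut
      off, hence the separate cases 0 and 1.\<close>
    consider "m = 0" | "m = 1" | n where "m = Suc (Suc n)" by (metis One_nat_def not0_implies_Suc)
    then show ?thesis
    proof cases
      case 1
      show ?thesis unfolding R_def 1
        by (rule derivative_eq_intros D refl)+ (simp add: algebra_simps power2_eq_square del: funpow.simps)
    next
      case 2
      show ?thesis unfolding R_def 2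
        by (rule derivative_eq_intros D refl)+ (simp add: algebra_simps power2_eq_square del: funpow.simps)
    next
      case 3
      show ?thesis unfolding R_def 3
        by (rule derivative_eq_intros D refl)+ (simp add: algebra_simps power2_eq_square del: funpow.simps)
    qed
  qed
  have "L x = R x" if "x \<in> slit_plane \<omega>" for x
    unfolding L_def R_def by (rule Suc.IH[OF that])
  then have "(R has_field_derivative z\<^sup>2 * ?D (m + 3) z + (2 * of_nat (Suc m) + 1) * z * ?D (m + 2) z
      + (of_nat (Suc m))\<^sup>2 * ?D (m + 1) z) (at z)"
    by (rule has_field_derivative_transform_within_open[OF L open_slit_plane[OF omega] z])
  from DERIV_unique[OF this R] show ?case
    by (simp add: numeral_3_eq_3 numeral_2_eq_2 del: funpow.simps)
qed

text \<open>Multiplication by \<open>sqrt y\<close> removes the first-order term and lowers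
  \<open>\<eta>^2\<close> by 1/4; for \<open>\<eta> = s - 1/2\<close> this gives
  \<open>s * (s - 1)\<close>.\<close>

lemma bessel_scalar_solution:
  assumes \<alpha>: "\<alpha> \<in> slit_plane \<omega>"
  shows "scalar_solution (\<lambda>y. \<alpha>\<^sup>2 + (\<eta>\<^sup>2 - 1 / 4) / (of_real y)\<^sup>2)
     (\<lambda>y. of_real (sqrt y) * B (\<alpha> * of_real y))
     (\<lambda>y. of_real (sqrt y) * ((1 / 2 * B (\<alpha> * of_real y) + B1 (\<alpha> * of_real y)) / of_real y))"
  unfolding scalar_solution_def
proof (intro allI impI conjI)
  fix y :: real assume y: "y > 0"
  let ?z = "\<alpha> * of_real y"
  have z: "?z \<in> slit_plane \<omega>" by (rule slit_plane_scale[OF omega \<alpha> y])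
  then have z0: "?z \<noteq> 0" by (simp add: slit_plane_def)
  then have \<alpha>0: "\<alpha> \<noteq> 0" by auto
  have "((\<lambda>y. B (\<alpha> * complex_of_real y)) has_vector_derivative B1 ?z / ?z * \<alpha>) (at y)"
    by (rule has_vector_derivative_scale_arg) (use sol z in \<open>auto simp: bessel_solution_def\<close>)
  then have D: "((\<lambda>y. B (\<alpha> * complex_of_real y)) has_vector_derivative B1 ?z / of_real y) (at y)"
    by (rule has_vector_derivative_eq_rhs) (use y \<alpha>0 in simp)
  have "((\<lambda>y. B1 (\<alpha> * complex_of_real y)) has_vector_derivative (?z\<^sup>2 + \<eta>\<^sup>2) * B ?z / ?z * \<alpha>) (at y)"
    by (rule has_vector_derivative_scale_arg) (use sol z in \<open>auto simp: bessel_solution_def\<close>)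
  then have D1: "((\<lambda>y. B1 (\<alpha> * complex_of_real y)) has_vector_derivative (?z\<^sup>2 + \<eta>\<^sup>2) * B ?z / of_real y) (at y)"
    by (rule has_vector_derivative_eq_rhs) (use y \<alpha>0 in simp)
  show "((\<lambda>y. of_real (sqrt y) * B (\<alpha> * of_real y)) has_vector_derivative
      of_real (sqrt y) * ((1 / 2 * B ?z + B1 ?z) / of_real y)) (at y)"
    using sqrt_power_has_vector_derivative[OF D y, of 0] by (simp add: add_divide_distrib)
  have inv: "((\<lambda>y. 1 / complex_of_real y) has_vector_derivative - 1 / (of_real y)\<^sup>2) (at y)"
    by (rule has_vector_derivative_real_field)
       (use y in \<open>auto intro!: derivative_eq_intros simp: power2_eq_square\<close>)
  have "((\<lambda>y. (1 / 2 * B (\<alpha> * of_real y) + B1 (\<alpha> * of_real y)) * (1 / of_real y)) has_vector_derivative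
     (1 / 2 * B ?z + B1 ?z) * (- 1 / (of_real y)\<^sup>2) +
     (1 / 2 * (B1 ?z / of_real y) + (?z\<^sup>2 + \<eta>\<^sup>2) * B ?z / of_real y) * (1 / of_real y)) (at y)"
    by (intro has_vector_derivative_mult has_vector_derivative_add has_vector_derivative_mult_right D D1 inv)
  from sqrt_power_has_vector_derivative[OF this y, of 0]
  show "((\<lambda>y. of_real (sqrt y) * ((1 / 2 * B (\<alpha> * of_real y) + B1 (\<alpha> * of_real y)) / of_real y)) has_vector_derivative
    (\<alpha>\<^sup>2 + (\<eta>\<^sup>2 - 1 / 4) / (of_real y)\<^sup>2) * (of_real (sqrt y) * B ?z)) (at y)"
    by (rule has_vector_derivative_cong_both)
       (use y in \<open>simp_all add: field_simps power2_eq_square\<close>)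
qed

text \<open>Derivatives in \<open>\<alpha>\<close> are \<open>y^m\<close> times derivatives of
  \<open>B\<close> at \<open>\<alpha> * y\<close>, to which the differentiated equation applies. The
  weights \<open>1 / (\<i>^m m!)\<close> turn its factors \<open>2 m\<close> and
  \<open>m (m - 1)\<close> into constants independent of \<open>m\<close>.\<close>

lemma bessel_chain_solution:
  assumes \<alpha>: "\<alpha> \<in> slit_plane \<omega>"
  shows "chain_solution (\<lambda>y. \<alpha>\<^sup>2 + (\<eta>\<^sup>2 - 1 / 4) / (of_real y)\<^sup>2) (- 2 * \<i> * \<alpha>) (- 1) d
     (\<lambda>m y. of_real (sqrt y) * inverse (\<i> ^ m) * (deriv ^^ m) (\<lambda>a. B (a * of_real y)) \<alpha> / fact m)"
proof (rule chain_solution_cong[OF _ _ refl])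
  let ?D = "\<lambda>k. (deriv ^^ k) B"
  let ?u = "\<lambda>m y. inverse (\<i> ^ m) / fact m * (of_real (sqrt y) * of_real y ^ m * ?D m (\<alpha> * of_real y))"
  let ?X = "\<lambda>m y. (of_nat m + 1 / 2) / of_real y * ?D m (\<alpha> * of_real y) + ?D (Suc m) (\<alpha> * of_real y) * \<alpha>"
  let ?u' = "\<lambda>m y. inverse (\<i> ^ m) / fact m * (of_real (sqrt y) * of_real y ^ m * ?X m y)"
  show "chain_solution (\<lambda>y. \<alpha>\<^sup>2 + (\<eta>\<^sup>2 - 1 / 4) / (of_real y)\<^sup>2) (- 2 * \<i> * \<alpha>) (- 1) d ?u"
    unfolding chain_solution_def
  proof (intro exI[of _ ?u'] allI impI conjI)
    fix m and y :: real assume y: "y > 0"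
    let ?z = "\<alpha> * of_real y"
    define Y where "Y = complex_of_real y"
    have Y0: "Y \<noteq> 0" using y by (simp add: Y_def)
    have z: "?z \<in> slit_plane \<omega>" by (rule slit_plane_scale[OF omega \<alpha> y])
    have D: "((\<lambda>y. ?D k (\<alpha> * complex_of_real y)) has_vector_derivative ?D (Suc k) ?z * \<alpha>) (at y)" for k
      by (intro has_vector_derivative_scale_arg bessel_higher_deriv z)
    show "(?u m has_vector_derivative ?u' m y) (at y)"
      by (intro has_vector_derivative_mult_right sqrt_power_has_vector_derivative D y)
    have inv: "((\<lambda>y. (of_nat m + 1 / 2) / complex_of_real y) has_vector_derivative - (of_nat m + 1 / 2) / Y\<^sup>2) (at y)"
      by (rule has_vector_derivative_real_field)
         (use y in \<open>auto intro!: derivative_eq_intros simp: power2_eq_square Y_def\<close>)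
    have "(?X m has_vector_derivative
        ((of_nat m + 1 / 2) / of_real y * (?D (Suc m) ?z * \<alpha>) + (- (of_nat m + 1 / 2) / Y\<^sup>2) * ?D m ?z)
         + ?D (Suc (Suc m)) ?z * \<alpha> * \<alpha>) (at y)"
      by (intro has_vector_derivative_add has_vector_derivative_mult has_vector_derivative_mult_left D inv)
    from has_vector_derivative_mult_right[OF sqrt_power_has_vector_derivative[OF this y]]
    have "(?u' m has_vector_derivative inverse (\<i> ^ m) / fact m * (of_real (sqrt y) * of_real y ^ m *
       ((of_nat m + 1 / 2) / of_real y * ?X m y +
         (((of_nat m + 1 / 2) / of_real y * (?D (Suc m) ?z * \<alpha>) + (- (of_nat m + 1 / 2) / Y\<^sup>2) * ?D m ?z)
         + ?D (Suc (Suc m)) ?z * \<alpha> * \<alpha>)))) (at y)" .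
    moreover have "(of_nat m + 1 / 2) / of_real y * ?X m y +
         (((of_nat m + 1 / 2) / of_real y * (?D (Suc m) ?z * \<alpha>) + (- (of_nat m + 1 / 2) / Y\<^sup>2) * ?D m ?z)
         + ?D (Suc (Suc m)) ?z * \<alpha> * \<alpha>)
      = (?z\<^sup>2 * ?D (m + 2) ?z + (2 * of_nat m + 1) * ?z * ?D (m + 1) ?z + (of_nat m)\<^sup>2 * ?D m ?z - 1 / 4 * ?D m ?z) / Y\<^sup>2"
      using Y0 by (simp add: Y_def[symmetric] field_simps power2_eq_square del: funpow.simps)
    moreover have "\<dots> = (\<alpha>\<^sup>2 + (\<eta>\<^sup>2 - 1 / 4) / Y\<^sup>2) * ?D m ?z + 2 * of_nat m * \<alpha> * ?D (m - 1) ?z / Y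
      + of_nat m * (of_nat m - 1) * ?D (m - 2) ?z / Y\<^sup>2"
      unfolding bessel_higher_ode[OF z]
      using Y0 by (simp add: Y_def[symmetric] field_simps power2_eq_square del: funpow.simps)
    moreover have "inverse (\<i> ^ m) / fact m * (of_real (sqrt y) * of_real y ^ m *
       ((\<alpha>\<^sup>2 + (\<eta>\<^sup>2 - 1 / 4) / Y\<^sup>2) * ?D m ?z + 2 * of_nat m * \<alpha> * ?D (m - 1) ?z / Y
      + of_nat m * (of_nat m - 1) * ?D (m - 2) ?z / Y\<^sup>2)) =
      (\<alpha>\<^sup>2 + (\<eta>\<^sup>2 - 1 / 4) / (of_real y)\<^sup>2) * ?u m y
        + (if m \<ge> 1 then - 2 * \<i> * \<alpha> * ?u (m - 1) y else 0) + (if m \<ge> 2 then - 1 * ?u (m - 2) y else 0)"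
    proof -
      consider "m = 0" | "m = 1" | n where "m = Suc (Suc n)" by (metis One_nat_def not0_implies_Suc)
      then show ?thesis
      proof cases
        case 1
        then show ?thesis by (simp add: Y_def)
      next
        case 2
        then show ?thesis using Y0 by (simp add: Y_def[symmetric] field_simps del: funpow.simps)
      next
        case 3
        \<comment> \<open>The weight at level \<open>n\<close>; the weights at the next two levels
          are \<open>c\<close> times powers of \<open>Y\<close> and \<open>\<i>\<close>, divided by
          the new factors of the factorial.\<close>
        define c where "c = inverse (\<i> ^ n) / fact n * (complex_of_real (sqrt y) * Y ^ n)"
        define a1 a2 where "a1 = (of_nat n + 1 :: complex)" and "a2 = (of_nat n + 2 :: complex)"
        have a: "a1 \<noteq> 0" "a2 \<noteq> 0"
          using of_nat_eq_0_iff[of "n + 2", where ?'a = complex] of_nat_eq_0_iff[of "n + 1", where ?'a = complex]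
          unfolding of_nat_add of_nat_numeral of_nat_1 a1_def a2_def by simp_all
        have f: "fact (Suc n) = a1 * (fact n :: complex)" "fact m = a2 * (a1 * (fact n :: complex))"
          unfolding 3 a1_def a2_def by (simp_all add: algebra_simps)
        have i: "inverse (\<i> ^ Suc n) = - \<i> * inverse (\<i> ^ n)" "inverse (\<i> ^ m) = - inverse (\<i> ^ n)"
          unfolding 3 by simp_all
        have k0: "inverse (\<i> ^ n) / fact n * (of_real (sqrt y) * of_real y ^ n * X) = c * X" for X
          by (simp add: c_def Y_def)
        have k1: "inverse (\<i> ^ Suc n) / fact (Suc n) * (of_real (sqrt y) * of_real y ^ Suc n * X) = - \<i> * (c * Y / a1) * X" for X
          unfolding f i by (simp add: c_def Y_def mult_ac)
        have k2: "inverse (\<i> ^ m) / fact m * (of_real (sqrt y) * of_real y ^ m * X) = - (c * Y\<^sup>2 / (a1 * a2)) * X" for X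
          unfolding f i by (simp add: c_def Y_def 3 power2_eq_square mult_ac)
        have m: "m - 1 = Suc n" "m - 2 = n" "of_nat m = a2" "a2 - 1 = a1" "1 \<le> m" "2 \<le> m"
          by (simp_all add: 3 a1_def a2_def)
        define Q where "Q = \<alpha>\<^sup>2 + (\<eta>\<^sup>2 - 1 / 4) / (complex_of_real y)\<^sup>2"
        have "- (c * Y\<^sup>2 / (a1 * a2)) * (Q * ?D m ?z + 2 * a2 * \<alpha> * ?D (Suc n) ?z / Y + a2 * a1 * ?D n ?z / Y\<^sup>2)
          = Q * (- (c * Y\<^sup>2 / (a1 * a2)) * ?D m ?z) + - 2 * \<i> * \<alpha> * (- \<i> * (c * Y / a1) * ?D (Suc n) ?z) + - 1 * (c * ?D n ?z)"
          using Y0 a by (simp add: field_simps power2_eq_square del: funpow.simps)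
        then show ?thesis
          using m(5,6) unfolding k2 unfolding m(1,2) k0 k1 unfolding m(3,4) Q_def Y_def
          by (simp only: if_True simp_thms)
      qed
    qed
    ultimately show "(?u' m has_vector_derivative (\<alpha>\<^sup>2 + (\<eta>\<^sup>2 - 1 / 4) / (of_real y)\<^sup>2) * ?u m y
        + (if m \<ge> 1 then - 2 * \<i> * \<alpha> * ?u (m - 1) y else 0) + (if m \<ge> 2 then - 1 * ?u (m - 2) y else 0)) (at y)"
      by (simp only:)
  qed
  fix m and y :: real assume y: "y > 0"
  \<comment> \<open>The slit plane is invariant under positive scaling, so the chain rule for higher
    derivatives applies on it.\<close>
  have "(deriv ^^ m) (\<lambda>a. B (of_real y * a)) \<alpha> = of_real y ^ m * ?D m (of_real y * \<alpha>)"
    using slit_plane_scale[OF omega _ y]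
    by (intro higher_deriv_compose_linear[OF bessel_solution_holomorphic open_slit_plane[OF omega] open_slit_plane[OF omega] \<alpha>])
       (simp add: mult.commute)
  then show "?u m y = of_real (sqrt y) * inverse (\<i> ^ m) * (deriv ^^ m) (\<lambda>a. B (a * of_real y)) \<alpha> / fact m"
    by (simp add: mult_ac)
qed

end

section \<open>Frequency zero\<close>

lemma power_log_has_vector_derivative:
  assumes "y > 0"
  shows "((\<lambda>y. complex_of_real y powr a * (c * of_real (ln y) + e)) has_vector_derivative
     of_real y powr a * (a * c * of_real (ln y) + (a * e + c)) / of_real y) (at y)"
proof -
  have y: "complex_of_real y \<notin> \<real>\<^sub>\<le>\<^sub>0" "complex_of_real y \<noteq> 0" using assms by auto
  have "((\<lambda>z. z powr a * (c * Ln z + e)) has_field_derivative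
      of_real y powr a * (a * c * Ln (of_real y) + (a * e + c)) / of_real y) (at (of_real y))"
    using y by (auto intro!: derivative_eq_intros simp: powr_diff field_simps)
  then have "((\<lambda>y. complex_of_real y powr a * (c * Ln (of_real y) + e)) has_vector_derivative
      of_real y powr a * (a * c * Ln (of_real y) + (a * e + c)) / of_real y) (at y)"
    by (rule has_vector_derivative_real_field)
  then have "((\<lambda>y. complex_of_real y powr a * (c * of_real (ln y) + e)) has_vector_derivative
      of_real y powr a * (a * c * Ln (of_real y) + (a * e + c)) / of_real y) (at y)"
    by (rule has_vector_derivative_transform_within_open[where S = "{0<..}"])
       (use assms in \<open>auto simp: Ln_of_real\<close>)
  then show ?thesis using assms by (simp add: Ln_of_real)
qed

lemma power_log_has_second_vector_derivative:
  assumes "y > 0"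
  shows "((\<lambda>y. complex_of_real y powr a * (a * c * of_real (ln y) + (a * e + c)) / of_real y) has_vector_derivative
     of_real y powr a * (a * (a - 1) * c * of_real (ln y) + (a * (a - 1) * e + (2 * a - 1) * c)) / (of_real y)\<^sup>2) (at y)"
proof -
  let ?c = "a * c" and ?e = "a * e + c"
  have "((\<lambda>y. complex_of_real y powr (a - 1) * (?c * of_real (ln y) + ?e)) has_vector_derivative
     of_real y powr (a - 1) * ((a - 1) * ?c * of_real (ln y) + ((a - 1) * ?e + ?c)) / of_real y) (at y)"
    by (rule power_log_has_vector_derivative[OF assms])
  then have "((\<lambda>y. complex_of_real y powr (a - 1) * (?c * of_real (ln y) + ?e)) has_vector_derivative
     of_real y powr a * (a * (a - 1) * c * of_real (ln y) + (a * (a - 1) * e + (2 * a - 1) * c)) / (of_real y)\<^sup>2) (at y)"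
    by (rule has_vector_derivative_eq_rhs)
       (use assms in \<open>simp add: powr_diff power2_eq_square field_simps\<close>)
  then show ?thesis
    by (rule has_vector_derivative_transform_within_open[where S = "{0<..}"])
       (use assms in \<open>auto simp: powr_diff\<close>)
qed

text \<open>Applied to \<open>c y^s log y\<close>, the operator leaves the remainder
  \<open>(2 s - 1) c y^(s - 2)\<close>: a logarithm is admissible only at the double exponent
  \<open>s = 1/2\<close>.\<close>

lemma power_log_scalar_solution:
  assumes "(2 * s - 1) * c = 0"
  shows "scalar_solution (\<lambda>y. s * (s - 1) / (of_real y)\<^sup>2)
     (\<lambda>y. of_real y powr s * (c * of_real (ln y) + e))
     (\<lambda>y. of_real y powr s * (s * c * of_real (ln y) + (s * e + c)) / of_real y)"
  unfolding scalar_solution_def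
proof (intro allI impI conjI)
  fix y :: real assume y: "y > 0"
  show "((\<lambda>y. of_real y powr s * (c * of_real (ln y) + e)) has_vector_derivative
      of_real y powr s * (s * c * of_real (ln y) + (s * e + c)) / of_real y) (at y)"
    by (rule power_log_has_vector_derivative[OF y])
  show "((\<lambda>y. of_real y powr s * (s * c * of_real (ln y) + (s * e + c)) / of_real y) has_vector_derivative
      s * (s - 1) / (of_real y)\<^sup>2 * (of_real y powr s * (c * of_real (ln y) + e))) (at y)"
    using power_log_has_second_vector_derivative[OF y, of s c e] unfolding assms
    by (rule has_vector_derivative_eq_rhs) (use y in \<open>simp add: field_simps\<close>)
qed

text \<open>Comparison of coefficients. With \<open>h = m div 2\<close> and exponent
  \<open>a = s + 2 h\<close>, the factor in both recursions is
  \<open>a (a - 1) - s (s - 1) = 2 h (2 s + 2 h - 1)\<close>; differentiating the logarithm feeds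
  \<open>(2 a - 1) c m\<close> into the recursion for \<open>e\<close>.\<close>

lemma power_log_chain_solution:
  fixes c e :: "nat \<Rightarrow> complex"
  assumes base: "\<And>m. m < d \<Longrightarrow> m < 2 \<Longrightarrow> (2 * s - 1) * c m = 0"
    and c: "\<And>m. m < d \<Longrightarrow> m \<ge> 2 \<Longrightarrow>
      2 * of_nat (m div 2) * (2 * s + 2 * of_nat (m div 2) - 1) * c m = - (of_nat m * (of_nat m - 1) * c (m - 2))"
    and e: "\<And>m. m < d \<Longrightarrow> m \<ge> 2 \<Longrightarrow>
      2 * of_nat (m div 2) * (2 * s + 2 * of_nat (m div 2) - 1) * e m
        + (2 * (s + 2 * of_nat (m div 2)) - 1) * c m = - (of_nat m * (of_nat m - 1) * e (m - 2))"
  shows "chain_solution (\<lambda>y. s * (s - 1) / (of_real y)\<^sup>2) 0 (- 1) d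
     (\<lambda>m y. of_real y powr (s + 2 * of_nat (m div 2)) * (c m * of_real (ln y) + e m) / fact m)"
    (is "chain_solution _ _ _ _ ?u")
  unfolding chain_solution_def
proof (intro exI allI impI conjI)
  fix m y assume m: "m < d" and y: "(y :: real) > 0"
  define h where "h = (of_nat (m div 2) :: complex)"
  define a where "a = s + 2 * h"
  let ?l = "complex_of_real (ln y)"
  let ?u' = "\<lambda>m y. of_real y powr (s + 2 * of_nat (m div 2)) * ((s + 2 * of_nat (m div 2)) * c m * of_real (ln y)
     + ((s + 2 * of_nat (m div 2)) * e m + c m)) / of_real y / fact m"
  show "(?u m has_vector_derivative ?u' m y) (at y)"
    by (intro has_vector_derivative_divide power_log_has_vector_derivative y)
  have "(?u' m has_vector_derivative
     of_real y powr a * (a * (a - 1) * c m * ?l + (a * (a - 1) * e m + (2 * a - 1) * c m)) / (of_real y)\<^sup>2 / fact m) (at y)"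
    unfolding a_def h_def by (intro has_vector_derivative_divide power_log_has_second_vector_derivative y)
  moreover have "of_real y powr a * (a * (a - 1) * c m * ?l + (a * (a - 1) * e m + (2 * a - 1) * c m)) / (of_real y)\<^sup>2 / fact m
     = s * (s - 1) / (of_real y)\<^sup>2 * ?u m y
        + (if m \<ge> 1 then 0 * ?u (m - 1) y else 0) + (if m \<ge> 2 then - 1 * ?u (m - 2) y else 0)"
  proof (cases "m \<ge> 2")
    case False
    then have a: "a = s" by (simp add: a_def h_def)
    have "(2 * s - 1) * c m = 0" using base[OF m] False by simp
    then have "a * (a - 1) * c m * ?l + (a * (a - 1) * e m + (2 * a - 1) * c m) = s * (s - 1) * (c m * ?l + e m)"
      unfolding a by (simp only: distrib_left mult.assoc add_0_right)
    then show ?thesis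
      using False by (simp add: a_def[symmetric] h_def[symmetric] a)
  next
    case True
    then obtain n where n: "m = Suc (Suc n)" by (metis add_2_eq_Suc le_Suc_ex)
    have h: "of_nat (n div 2) = h - 1" by (simp add: h_def n)
    have aa: "a * (a - 1) = s * (s - 1) + 2 * h * (2 * s + 2 * h - 1)"
      by (simp add: a_def algebra_simps)
    have f: "fact m = of_nat m * (of_nat m - 1) * (fact n :: complex)"
      by (simp add: n algebra_simps)
    have nz: "of_nat m * (of_nat m - 1) \<noteq> (0 :: complex)"
      using of_nat_eq_0_iff[of "Suc n", where ?'a = complex] of_nat_eq_0_iff[of m, where ?'a = complex] n
      by simp
    have "a * (a - 1) * c m * ?l + (a * (a - 1) * e m + (2 * a - 1) * c m)
      = s * (s - 1) * (c m * ?l + e m) + (2 * h * (2 * s + 2 * h - 1) * c m) * ?l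
        + (2 * h * (2 * s + 2 * h - 1) * e m + (2 * a - 1) * c m)"
      unfolding aa by (simp add: algebra_simps)
    also have "\<dots> = s * (s - 1) * (c m * ?l + e m) - of_nat m * (of_nat m - 1) * (c n * ?l + e n)"
      unfolding a_def h_def c[OF m True] e[OF m True] by (simp add: n algebra_simps)
    finally have fin: "of_real y powr a * (a * (a - 1) * c m * ?l + (a * (a - 1) * e m + (2 * a - 1) * c m)) / (of_real y)\<^sup>2 / fact m
       = s * (s - 1) / (of_real y)\<^sup>2 * (of_real y powr a * (c m * ?l + e m) / fact m)
         - of_real y powr a / (of_real y)\<^sup>2 * (c n * ?l + e n) / fact n"
      unfolding f using nz by (simp add: divide_simps) (simp add: algebra_simps)
    have pw: "of_real y powr a / (of_real y)\<^sup>2 = complex_of_real y powr (s + 2 * of_nat (n div 2))"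
    proof -
      have "complex_of_real y powr (a - 2) = of_real y powr a / of_real y powr 2"
        by (rule powr_diff)
      moreover have "complex_of_real y powr 2 = (of_real y)\<^sup>2"
        using y powr_nat[of "complex_of_real y" 2] by simp
      moreover have "s + 2 * of_nat (n div 2) = a - 2" by (simp add: h a_def)
      ultimately show ?thesis by simp
    qed
    show ?thesis
      unfolding fin pw using True by (simp add: n a_def h_def)
  qed
  ultimately show "(?u' m has_vector_derivative s * (s - 1) / (of_real y)\<^sup>2 * ?u m y
        + (if m \<ge> 1 then 0 * ?u (m - 1) y else 0) + (if m \<ge> 2 then - 1 * ?u (m - 2) y else 0)) (at y)"
    by (simp only:)
qed

text \<open>Raising the index by 2 adds one factor to each product of the closed form. The
  hypothesis says that no denominator factor \<open>2 j + 2 s - 1\<close> vanishes up to level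
  \<open>m\<close>.\<close>

lemma pfun_rec:
  assumes "m \<ge> 2" "\<And>j. 1 \<le> j \<Longrightarrow> 2 * j \<le> m \<Longrightarrow> s \<noteq> 1 / 2 - of_nat j"
  shows "2 * of_nat (m div 2) * (2 * s + 2 * of_nat (m div 2) - 1) * pfun m s
    = - (of_nat m * (of_nat m - 1) * pfun (m - 2) s)"
proof -
  obtain n where n: "m = Suc (Suc n)" using assms(1) by (metis add_2_eq_Suc le_Suc_ex)
  define h where "h = n div 2"
  have h: "m div 2 = Suc h" by (simp add: n h_def)
  have nz: "2 * of_nat j + 2 * s - 1 \<noteq> 0" if "1 \<le> j" "j \<le> Suc h" for j
  proof
    assume "2 * of_nat j + 2 * s - 1 = 0"
    then have "s = 1 / 2 - of_nat j" by (simp add: field_simps)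
    moreover have "2 * j \<le> m" using that h by linarith
    ultimately show False using assms(2) that by blast
  qed
  have p: "pfun k s = (-1) ^ (k div 2) * fact k /
        (2 ^ (k div 2) * fact (k div 2) * (\<Prod>j = 1..k div 2. 2 * of_nat j + 2 * s - 1))" if "k \<le> m" for k
  proof -
    have "s \<notin> {1/2 - of_nat j | j. 1 \<le> j \<and> j \<le> k div 2}"
    proof
      assume "s \<in> {1/2 - of_nat j | j. 1 \<le> j \<and> j \<le> k div 2}"
      then obtain j where j: "s = 1/2 - of_nat j" "1 \<le> j" "j \<le> k div 2" by blast
      then have "2 * j \<le> m" using that by linarith
      with j assms(2) show False by blast
    qed
    then show ?thesis unfolding pfun_def by (simp only: if_False)
  qed
  define P where "P = (\<Prod>j = 1..h. 2 * of_nat j + 2 * s - 1)"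
  have P: "P \<noteq> 0" using nz unfolding P_def by (subst prod_zero_iff) auto
  define N where "N = 2 * of_nat (Suc h) + 2 * s - 1"
  define H where "H = (of_nat (Suc h) :: complex)"
  define M where "M = of_nat m * (of_nat m - 1 :: complex)"
  have nz': "N \<noteq> 0" "H \<noteq> 0" unfolding N_def H_def by (intro nz of_nat_neq_0; simp)+
  have fm: "fact m = M * (fact n :: complex)"
    by (simp add: n M_def algebra_simps)
  have p1: "pfun m s = - ((-1) ^ h) * (M * fact n) / (2 * 2 ^ h * (H * fact h) * (P * N))"
    unfolding p[OF order_refl] h fm by (simp add: P_def N_def H_def)
  have p2: "pfun (m - 2) s = (-1) ^ h * fact n / (2 ^ h * fact h * P)"
    using p[of n] by (simp add: n P_def h_def)
  have "2 * H * N * pfun m s = - (M * pfun (m - 2) s)"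
    unfolding p1 p2 using P nz' by (simp add: field_simps)
  moreover have "2 * s + 2 * of_nat (Suc h) - 1 = N" by (simp add: N_def)
  ultimately show ?thesis
    unfolding h M_def H_def by (simp only:)
qed

text \<open>The recursion for logarithmic coefficients, written with \<open>m = k + 2 j\<close>: for
  \<open>s = 1/2 - j\<close> the factor \<open>2 s + 2 (m div 2) - 1\<close> becomes
  \<open>2 (k div 2)\<close>, which is nonzero beyond the first two values of
  \<open>k\<close>.\<close>

lemma qfun_rec:
  assumes "k \<ge> 2" "s = 1 / 2 - of_nat j"
  shows "4 * of_nat (k div 2) * (of_nat j + of_nat (k div 2)) * qfun k s
    = - (of_nat (k + 2 * j) * (of_nat (k + 2 * j) - 1) * qfun (k - 2) s)"
proof -
  obtain n where n: "k = Suc (Suc n)" using assms(1) by (metis add_2_eq_Suc le_Suc_ex)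
  define h where "h = k div 2"
  have "h > 0" by (simp add: h_def n)
  then have h: "of_nat h \<noteq> (0 :: complex)" "of_nat j + of_nat h \<noteq> (0 :: complex)"
    by (simp_all flip: of_nat_add)
  have s: "1 - 2 * s + of_nat k = of_nat (k + 2 * j)" "- 2 * s + of_nat k = of_nat (k + 2 * j) - 1"
    "1 / 2 - s = of_nat j"
    by (simp_all add: assms(2) algebra_simps)
  have "qfun k s = - (1 / 4) * ((of_nat (k + 2 * j) * (of_nat (k + 2 * j) - 1))
      / (of_nat h * (of_nat j + of_nat h))) * qfun (k - 2) s"
    using qfun.simps(3)[of n s] unfolding n[symmetric] Let_def s h_def by (simp add: n)
  moreover define D where "D = of_nat h * (of_nat j + of_nat h :: complex)"
  moreover have "D \<noteq> 0" using h by (simp add: D_def)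
  ultimately have "4 * D * qfun k s = - (of_nat (k + 2 * j) * (of_nat (k + 2 * j) - 1) * qfun (k - 2) s)"
    by simp
  then show ?thesis
    unfolding h_def[symmetric] D_def by (simp only: mult.assoc)
qed

text \<open>For fixed parity this is an inhomogeneous first-order recursion in
  \<open>k div 2\<close> with a source proportional to \<open>q\<close>. The sum defining
  \<open>r\<close> is variation of constants: each summand carries the source of stage
  \<open>i\<close> to stage \<open>h\<close>.\<close>

lemma rfun_rec:
  assumes "k \<ge> 2" "s = 1 / 2 - of_nat j"
  shows "4 * of_nat (k div 2) * (of_nat j + of_nat (k div 2)) * rfun k s
      + (2 * of_nat j + 4 * of_nat (k div 2)) * qfun k s
    = - (of_nat (k + 2 * j) * (of_nat (k + 2 * j) - 1) * rfun (k - 2) s)"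
proof -
  define \<delta> where "\<delta> = k mod 2"
  define J where "J = (of_nat j :: complex)"
  \<comment> \<open>For \<open>i = h\<close> the products are empty and the sign is -1, so
    \<open>t h h\<close> is the isolated first summand of \<open>rfun\<close> and the sum may run up
    to \<open>h\<close>.\<close>
  define t where "t h i = (-1) ^ (h + i + 1)
           * ((J + 2 * of_nat i) / (2 * of_nat i * (J + of_nat i)))
           * (1 / 4 ^ (h - i))
           * ((\<Prod>l = 2 * i + 1 + \<delta>..2 * h + \<delta>. 2 * J + of_nat l)
              / (\<Prod>l = i + 1..h. of_nat l * (J + of_nat l)))
           * qfun (2 * i + \<delta>) s" for h i
  have r: "rfun (2 * h + \<delta>) s = (\<Sum>i = 1..h. t h i)" for h
  proof (cases h)
    case 0
    have "\<delta> < 2" by (simp add: \<delta>_def)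
    then show ?thesis using 0 by (simp add: rfun_def)
  next
    case (Suc h')
    have d2: "(2 * h + \<delta>) div 2 = h" "(if odd (2 * h + \<delta>) then 1 else 0) = \<delta>" "\<not> 2 * h + \<delta> < 2"
      using Suc by (auto simp: \<delta>_def mod_2_eq_odd)
    have s: "1 / 2 - s = J" "1 - 2 * s = 2 * J" by (simp_all add: J_def assms(2))
    have "rfun (2 * h + \<delta>) s = - ((J + 2 * of_nat h) / (2 * of_nat h * (J + of_nat h))) * qfun (2 * h + \<delta>) s
        + (\<Sum>i = 1..h - 1. t h i)"
      unfolding rfun_def[of "2 * h + \<delta>"] t_def Let_def d2 s using d2(3) by simp
    also have "- ((J + 2 * of_nat h) / (2 * of_nat h * (J + of_nat h))) * qfun (2 * h + \<delta>) s = t h h"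
      by (simp add: t_def del: minus_add_distrib)
    also have "t h h + (\<Sum>i = 1..h - 1. t h i) = (\<Sum>i = 1..h. t h i)"
      using Suc by simp
    finally show ?thesis .
  qed
  define h where "h = k div 2"
  have k: "k = 2 * h + \<delta>" by (simp add: h_def \<delta>_def)
  have hpos: "h \<ge> 1" using assms(1) by (simp add: h_def)
  then have k2: "k - 2 = 2 * (h - 1) + \<delta>" using k by simp
  have nzh: "of_nat h \<noteq> (0 :: complex)" "J + of_nat h \<noteq> 0"
    using hpos by (simp_all add: J_def flip: of_nat_add)
  define R where "R = of_nat (k + 2 * j) * (of_nat (k + 2 * j) - 1) / (4 * of_nat h * (J + of_nat h))"
  \<comment> \<open>Going from \<open>h - 1\<close> to \<open>h\<close> adds two factors to the
    numerator product, one to the denominator product, a factor 4 and a sign; together they are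
    \<open>- R\<close>, whatever \<open>i\<close> is.\<close>
  have step: "t h i = - R * t (h - 1) i" if "i \<in> {1..h - 1}" for i
  proof -
    define P where "P = (\<Prod>l = 2 * i + 1 + \<delta>..2 * (h - 1) + \<delta>. 2 * J + of_nat l)"
    define Q where "Q = (\<Prod>l = i + 1..h - 1. of_nat l * (J + of_nat l))"
    obtain g where g: "h = Suc g" using hpos by (cases h) auto
    have ig: "i \<le> g" using that g by simp
    have "(\<Prod>l = 2 * i + 1 + \<delta>..2 * h + \<delta>. 2 * J + of_nat l) = P * (of_nat (k + 2 * j) * (of_nat (k + 2 * j) - 1))"
    proof -
      have "2 * h + \<delta> = Suc (Suc (2 * g + \<delta>))" by (simp add: g)
      moreover have "(\<Prod>l = 2 * i + 1 + \<delta>..Suc (Suc (2 * g + \<delta>)). 2 * J + of_nat l) =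
         P * (2 * J + of_nat (Suc (2 * g + \<delta>))) * (2 * J + of_nat (Suc (Suc (2 * g + \<delta>))))"
        using ig by (simp add: P_def g)
      moreover have "2 * J + of_nat (Suc (2 * g + \<delta>)) = of_nat (k + 2 * j) - 1"
        "2 * J + of_nat (Suc (Suc (2 * g + \<delta>))) = of_nat (k + 2 * j)"
        by (simp_all add: k g J_def)
      ultimately show ?thesis by (simp add: mult_ac)
    qed
    moreover have "(\<Prod>l = i + 1..h. of_nat l * (J + of_nat l)) = Q * (of_nat h * (J + of_nat h))"
      unfolding Q_def g using ig by simp
    moreover have "4 ^ (h - i) = 4 * (4 :: complex) ^ (h - 1 - i)"
      using ig by (simp add: g Suc_diff_le)
    moreover have "(-1) ^ (h + i + 1) = - ((-1 :: complex) ^ (h - 1 + i + 1))"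
      by (simp add: g)
    ultimately have "t h i = - ((-1) ^ (h - 1 + i + 1))
           * ((J + 2 * of_nat i) / (2 * of_nat i * (J + of_nat i)))
           * (1 / (4 * 4 ^ (h - 1 - i)))
           * (P * (of_nat (k + 2 * j) * (of_nat (k + 2 * j) - 1))
              / (Q * (of_nat h * (J + of_nat h))))
           * qfun (2 * i + \<delta>) s"
      unfolding t_def by (simp only:)
    also have "\<dots> = - R * t (h - 1) i"
    proof -
      have "- S * A * (1 / (4 * F)) * (p * N / (q * (a * b))) * c = - (N / (4 * a * b)) * (S * A * (1 / F) * (p / q) * c)"
        for S A F p N q a b c :: complex
        by (simp add: mult_ac)
      then show ?thesis
        unfolding t_def P_def[symmetric] Q_def[symmetric] R_def .
    qed
    finally show ?thesis .
  qed
  have "rfun k s = t h h + (\<Sum>i = 1..h - 1. t h i)"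
    unfolding k r using hpos by (cases h) auto
  also have "(\<Sum>i = 1..h - 1. t h i) = - R * rfun (k - 2) s"
    unfolding k2 r sum_distrib_left by (intro sum.cong step refl)
  also have "t h h = - ((J + 2 * of_nat h) / (2 * of_nat h * (J + of_nat h))) * qfun k s"
    by (simp add: t_def k del: minus_add_distrib)
  finally have r_eq: "rfun k s = - ((J + 2 * of_nat h) / (2 * of_nat h * (J + of_nat h))) * qfun k s
      + - R * rfun (k - 2) s" .
  have gen: "4 * H * G * (- (A / (2 * H * G)) * q + - (N / (4 * H * G)) * r) + 2 * A * q = - (N * r)"
    if "H \<noteq> 0" "G \<noteq> 0" for H G A N q r :: complex
    using that by (simp add: field_simps)
  have "2 * J + 4 * of_nat h = 2 * (J + 2 * of_nat h)" by simp
  then show ?thesis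
    unfolding h_def[symmetric] J_def[symmetric] r_eq R_def using gen[OF nzh] by (simp only:)
qed

lemma pfun_chain_solution:
  assumes "\<And>j. 1 \<le> j \<Longrightarrow> j \<le> (d - 1) div 2 \<Longrightarrow> s \<noteq> 1 / 2 - of_nat j"
  shows "chain_solution (\<lambda>y. s * (s - 1) / (of_real y)\<^sup>2) 0 (- 1) d
     (\<lambda>m y. pfun m s * of_real y powr (s + 2 * of_nat (m div 2)) / fact m)"
proof -
  have "chain_solution (\<lambda>y. s * (s - 1) / (of_real y)\<^sup>2) 0 (- 1) d
     (\<lambda>m y. of_real y powr (s + 2 * of_nat (m div 2)) * (0 * of_real (ln y) + pfun m s) / fact m)"
  proof (rule power_log_chain_solution)
    fix m assume m: "m < d" "m \<ge> 2"
    have "2 * of_nat (m div 2) * (2 * s + 2 * of_nat (m div 2) - 1) * pfun m s = - (of_nat m * (of_nat m - 1) * pfun (m - 2) s)"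
      using m by (intro pfun_rec assms) auto
    then show "2 * of_nat (m div 2) * (2 * s + 2 * of_nat (m div 2) - 1) * pfun m s
       + (2 * (s + 2 * of_nat (m div 2)) - 1) * 0 = - (of_nat m * (of_nat m - 1) * pfun (m - 2) s)"
      by simp
  qed simp_all
  then show ?thesis by (simp add: mult.commute)
qed

text \<open>Resonance: at \<open>m = 2 j\<close> and \<open>m = 2 j + 1\<close> the factor
  \<open>2 s + 2 (m div 2) - 1\<close> vanishes. For \<open>j \<ge> 1\<close> the equation for
  \<open>e\<close> then no longer determines \<open>e m\<close> but prescribes the logarithmic
  coefficient \<open>c m\<close>, which is the origin of \<open>qfun 0 s\<close> and
  \<open>qfun 1 s\<close>; the free \<open>e m\<close> is set to 0. For \<open>j = 0\<close> the
  resonance sits at the two lowest levels, where \<open>c m\<close> is free and set to 1.\<close>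

lemma log_chain_solution:
  assumes s: "s = 1 / 2 - of_nat j"
  shows "chain_solution (\<lambda>y. s * (s - 1) / (of_real y)\<^sup>2) 0 (- 1) d
     (\<lambda>m y. (if 2 * j \<le> m then
          qfun (m - 2 * j) s * of_real y powr (s + 2 * of_nat (m div 2)) * of_real (ln y)
          + rfun (m - 2 * j) s * of_real y powr (s + 2 * of_nat (m div 2))
        else pfun m s * of_real y powr (s + 2 * of_nat (m div 2))) / fact m)"
proof -
  define c where "c m = (if 2 * j \<le> m then qfun (m - 2 * j) s else 0)" for m
  define e where "e m = (if 2 * j \<le> m then rfun (m - 2 * j) s else pfun m s)" for m
  have "chain_solution (\<lambda>y. s * (s - 1) / (of_real y)\<^sup>2) 0 (- 1) d
     (\<lambda>m y. of_real y powr (s + 2 * of_nat (m div 2)) * (c m * of_real (ln y) + e m) / fact m)"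
  proof (rule power_log_chain_solution)
    fix m :: nat assume "m < 2"
    then show "(2 * s - 1) * c m = 0"
      by (cases "j = 0") (auto simp: c_def s)
  next
    fix m :: nat assume m2: "m \<ge> 2"
    have p: "2 * of_nat (m div 2) * (2 * s + 2 * of_nat (m div 2) - 1) * pfun m s = - (of_nat m * (of_nat m - 1) * pfun (m - 2) s)"
      if "m < 2 * j"
      using that by (intro pfun_rec m2) (auto simp: s)
    have w: "2 * (s + 2 * of_nat j) - 1 = 2 * of_nat j" "2 * s + 2 * of_nat j - 1 = 0"
      by (simp_all add: s)
    \<comment> \<open>Below the resonance, at its two levels, and above it. For \<open>j = 0\<close>
      the resonant levels are 0 and 1 and are excluded by \<open>m \<ge> 2\<close>.\<close>
    consider "m < 2 * j" | "m = 2 * j" "j \<ge> 1" | "m = 2 * j + 1" "j \<ge> 1" | "m \<ge> 2 * j + 2"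
      using m2 by linarith
    then have "2 * of_nat (m div 2) * (2 * s + 2 * of_nat (m div 2) - 1) * c m = - (of_nat m * (of_nat m - 1) * c (m - 2)) \<and>
      2 * of_nat (m div 2) * (2 * s + 2 * of_nat (m div 2) - 1) * e m
        + (2 * (s + 2 * of_nat (m div 2)) - 1) * c m = - (of_nat m * (of_nat m - 1) * e (m - 2))"
    proof cases
      case 1
      then have "c m = 0" "c (m - 2) = 0" "e m = pfun m s" "e (m - 2) = pfun (m - 2) s"
        by (auto simp: c_def e_def)
      then show ?thesis using p[OF 1] by (simp only: mult_zero_right minus_zero add_0_right simp_thms)
    next
      case 2
      then obtain i where i: "j = Suc i" by (cases j) auto
      have "nat \<lfloor>- 2 * Re s - 1\<rfloor> = 2 * j - 2"
      proof -
        have "- 2 * Re s - 1 = of_int (2 * int i)" by (simp add: s i)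
        then show ?thesis by (simp only: floor_of_int) (simp add: i)
      qed
      moreover have "s \<noteq> 1 / 2" by (simp add: s i del: of_nat_Suc)
      ultimately have q: "qfun 0 s = 2 * s * pfun (2 * j - 2) s" by (simp only: qfun.simps if_False)
      have "c m = qfun 0 s" "e m = 0" "c (m - 2) = 0" "e (m - 2) = pfun (2 * j - 2) s" "m div 2 = j"
        using 2 by (auto simp: c_def e_def rfun_def)
      \<comment> \<open>The first factor \<open>2 j\<close> is the weight of \<open>c m\<close> in
        the equation for \<open>e\<close>, and \<open>2 s = 1 - m\<close> at this level.\<close>
      moreover have "2 * of_nat j * (2 * s * P) = - (of_nat m * (of_nat m - 1) * P)" for P
        by (simp add: 2 s algebra_simps)
      ultimately show ?thesis
        by (simp only: w q mult_zero_left mult_zero_right minus_zero add_0_left simp_thms)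
    next
      case 3
      then obtain i where i: "j = Suc i" by (cases j) auto
      have "nat \<lfloor>- 2 * Re s\<rfloor> = 2 * j - 1"
      proof -
        have "- 2 * Re s = of_int (2 * int i + 1)" by (simp add: s i)
        then show ?thesis by (simp only: floor_of_int) (simp add: i nat_add_distrib)
      qed
      moreover have "s \<noteq> 1 / 2" by (simp add: s i del: of_nat_Suc)
      ultimately have q: "qfun 1 s = (2 * s - 2) * pfun (2 * j - 1) s" by (simp only: qfun.simps if_False One_nat_def)
      have "c m = qfun 1 s" "e m = 0" "c (m - 2) = 0" "e (m - 2) = pfun (2 * j - 1) s" "m div 2 = j"
        using 3 by (auto simp: c_def e_def rfun_def)
      moreover have "2 * of_nat j * ((2 * s - 2) * P) = - (of_nat m * (of_nat m - 1) * P)" for P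
        by (simp add: 3 s algebra_simps)
      ultimately show ?thesis
        by (simp only: w q mult_zero_left mult_zero_right minus_zero add_0_left simp_thms)
    next
      case 4
      define k where "k = m - 2 * j"
      have k: "k \<ge> 2" "m = k + 2 * j" using 4 by (simp_all add: k_def)
      have eqs: "c m = qfun k s" "e m = rfun k s" "c (m - 2) = qfun (k - 2) s" "e (m - 2) = rfun (k - 2) s"
      proof -
        have "2 * j \<le> m" "2 * j \<le> m - 2" "m - 2 * j = k" "m - 2 - 2 * j = k - 2" using k by auto
        then show "c m = qfun k s" "e m = rfun k s" "c (m - 2) = qfun (k - 2) s" "e (m - 2) = rfun (k - 2) s"
          by (simp_all only: c_def e_def if_True)
      qed
      have h: "of_nat (m div 2) = of_nat (k div 2) + (of_nat j :: complex)" by (simp add: k)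
      have "2 * of_nat (m div 2) * (2 * s + 2 * of_nat (m div 2) - 1)
          = 4 * of_nat (k div 2) * (of_nat j + of_nat (k div 2))"
        unfolding h by (simp add: s algebra_simps)
      moreover have "2 * (s + 2 * of_nat (m div 2)) - 1 = 2 * of_nat j + 4 * of_nat (k div 2)"
        unfolding h by (simp add: s algebra_simps)
      ultimately show ?thesis
        unfolding eqs using qfun_rec[OF k(1) s] rfun_rec[OF k(1) s] by (simp only: k(2)[symmetric])
    qed
    then show "2 * of_nat (m div 2) * (2 * s + 2 * of_nat (m div 2) - 1) * c m = - (of_nat m * (of_nat m - 1) * c (m - 2))"
      "2 * of_nat (m div 2) * (2 * s + 2 * of_nat (m div 2) - 1) * e m
        + (2 * (s + 2 * of_nat (m div 2)) - 1) * c m = - (of_nat m * (of_nat m - 1) * e (m - 2))"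
      by blast+
  qed
  then show ?thesis
    by (rule chain_solution_cong) (auto simp: c_def e_def algebra_simps)
qed

section \<open>Resonant parameters and the base solutions at frequency zero\<close>

lemma exc_set_lower_iff:
  "s \<in> complex_of_real ` (exc_set d \<inter> {1/2 - real m / 2..1/2}) \<longleftrightarrow>
     (\<exists>j\<le>(d - 1) div 2. s = 1 / 2 - of_nat j \<and> 2 * j \<le> m)"
proof
  assume "s \<in> complex_of_real ` (exc_set d \<inter> {1/2 - real m / 2..1/2})"
  then obtain x where x: "s = of_real x" "x \<in> exc_set d" "1/2 - real m / 2 \<le> x" "x \<le> 1/2" by auto
  then obtain j where j: "j \<le> (d - 1) div 2" "x = 1/2 - real j"
    unfolding exc_set_def by fastforce
  with x have "2 * j \<le> m" by simp
  with j x show "\<exists>j\<le>(d - 1) div 2. s = 1 / 2 - of_nat j \<and> 2 * j \<le> m" by auto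
next
  assume "\<exists>j\<le>(d - 1) div 2. s = 1 / 2 - of_nat j \<and> 2 * j \<le> m"
  then obtain j where j: "j \<le> (d - 1) div 2" "s = 1 / 2 - of_nat j" "2 * j \<le> m" by blast
  have "1/2 - real j \<in> exc_set d \<inter> {1/2 - real m / 2..1/2}"
    using j unfolding exc_set_def by auto
  moreover have "s = of_real (1/2 - real j)" by (simp add: j)
  ultimately show "s \<in> complex_of_real ` (exc_set d \<inter> {1/2 - real m / 2..1/2})" by blast
qed

lemma exc_set_upper_iff:
  "s \<in> complex_of_real ` (exc_set d \<inter> {3/2..1/2 + real m / 2}) \<longleftrightarrow>
     (\<exists>j\<le>(d - 1) div 2. j \<ge> 1 \<and> 1 - s = 1 / 2 - of_nat j \<and> 2 * j \<le> m)"
proof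
  assume "s \<in> complex_of_real ` (exc_set d \<inter> {3/2..1/2 + real m / 2})"
  then obtain x where x: "s = of_real x" "x \<in> exc_set d" "3/2 \<le> x" "x \<le> 1/2 + real m / 2" by auto
  then obtain j where j: "j \<le> (d - 1) div 2" "x = 1/2 + real j"
    unfolding exc_set_def by fastforce
  with x have "2 * j \<le> m" "j \<ge> 1" by auto
  with j x show "\<exists>j\<le>(d - 1) div 2. j \<ge> 1 \<and> 1 - s = 1 / 2 - of_nat j \<and> 2 * j \<le> m" by auto
next
  assume "\<exists>j\<le>(d - 1) div 2. j \<ge> 1 \<and> 1 - s = 1 / 2 - of_nat j \<and> 2 * j \<le> m"
  then obtain j where j: "j \<le> (d - 1) div 2" "j \<ge> 1" "1 - s = 1 / 2 - of_nat j" "2 * j \<le> m" by blast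
  have "1/2 + real j \<in> exc_set d \<inter> {3/2..1/2 + real m / 2}"
    using j unfolding exc_set_def by auto
  moreover have "s = of_real (1/2 + real j)"
  proof -
    have "s = 1 - (1 - s)" by simp
    then show ?thesis unfolding j(3) by simp
  qed
  ultimately show "s \<in> complex_of_real ` (exc_set d \<inter> {3/2..1/2 + real m / 2})" by blast
qed

text \<open>For \<open>s = 1/2 - j\<close> the case distinction in \<open>bfI\<close> is precisely
  \<open>2 * j \<le> m\<close>. The bound \<open>j \<le> (d - 1) div 2\<close> selects the
  resonances that are met at some level \<open>m < d\<close>; for all other \<open>s\<close> pure
  powers suffice.\<close>

lemma bfI_zero_chain_solution:
  "chain_solution (\<lambda>y. s * (s - 1) / (of_real y)\<^sup>2) 0 (- 1) d (\<lambda>m y. bfI d \<omega> m 0 y s / fact m)"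
proof (cases "\<exists>j\<le>(d - 1) div 2. s = 1 / 2 - of_nat j")
  case True
  then obtain j where j: "j \<le> (d - 1) div 2" "s = 1 / 2 - of_nat j" by blast
  have iff: "s \<in> complex_of_real ` (exc_set d \<inter> {1/2 - real m / 2..1/2}) \<longleftrightarrow> 2 * j \<le> m" for m
    unfolding exc_set_lower_iff using j by auto
  have k: "nat \<lfloor>real m - 1 + 2 * Re s\<rfloor> = m - 2 * j" if "2 * j \<le> m" for m
  proof -
    have "real m - 1 + 2 * Re s = of_int (int m - 2 * int j)" by (simp add: j)
    then show ?thesis using that by (simp only: floor_of_int; auto)
  qed
  show ?thesis
  proof (rule chain_solution_cong[OF log_chain_solution[OF j(2)] _ refl])
    fix m and y :: real
    show "(if 2 * j \<le> m then
          qfun (m - 2 * j) s * of_real y powr (s + 2 * of_nat (m div 2)) * of_real (ln y)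
          + rfun (m - 2 * j) s * of_real y powr (s + 2 * of_nat (m div 2))
        else pfun m s * of_real y powr (s + 2 * of_nat (m div 2))) / fact m = bfI d \<omega> m 0 y s / fact m"
      unfolding bfI_def iff by (cases "2 * j \<le> m") (simp_all only: k Let_def simp_thms if_True if_False)
  qed
next
  case False
  then have "s \<notin> complex_of_real ` (exc_set d \<inter> {1/2 - real m / 2..1/2})" for m
    unfolding exc_set_lower_iff by blast
  then show ?thesis
    using False by (intro chain_solution_cong[OF pfun_chain_solution]) (auto simp: bfI_def)
qed

text \<open>The second solution arises from \<open>1 - s\<close> in place of \<open>s\<close>, which
  preserves \<open>s * (s - 1)\<close>. At \<open>s = 1/2\<close> it stays a pure power,
  complementing the logarithm in \<open>bfI\<close>; hence the condition
  \<open>j \<ge> 1\<close>.\<close>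

lemma bfK_zero_chain_solution:
  "chain_solution (\<lambda>y. s * (s - 1) / (of_real y)\<^sup>2) 0 (- 1) d (\<lambda>m y. bfK d \<omega> m 0 y s / fact m)"
proof (cases "\<exists>j\<le>(d - 1) div 2. j \<ge> 1 \<and> 1 - s = 1 / 2 - of_nat j")
  case True
  then obtain j where j: "j \<le> (d - 1) div 2" "j \<ge> 1" "1 - s = 1 / 2 - of_nat j" by blast
  have iff: "s \<in> complex_of_real ` (exc_set d \<inter> {3/2..1/2 + real m / 2}) \<longleftrightarrow> 2 * j \<le> m" for m
    unfolding exc_set_upper_iff using j by auto
  have s: "s = 1 / 2 + of_nat j"
  proof -
    have "s = 1 - (1 - s)" by simp
    then show ?thesis unfolding j(3) by simp
  qed
  have k: "nat \<lfloor>real m + 1 - 2 * Re s\<rfloor> = m - 2 * j" if "2 * j \<le> m" for m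
  proof -
    have "real m + 1 - 2 * Re s = of_int (int m - 2 * int j)" by (simp add: s)
    then show ?thesis using that by (simp only: floor_of_int; auto)
  qed
  show ?thesis
  proof (rule chain_solution_cong[OF log_chain_solution[OF j(3)]])
    fix m and y :: real
    show "(if 2 * j \<le> m then
          qfun (m - 2 * j) (1 - s) * of_real y powr (1 - s + 2 * of_nat (m div 2)) * of_real (ln y)
          + rfun (m - 2 * j) (1 - s) * of_real y powr (1 - s + 2 * of_nat (m div 2))
        else pfun m (1 - s) * of_real y powr (1 - s + 2 * of_nat (m div 2))) / fact m = bfK d \<omega> m 0 y s / fact m"
      unfolding bfK_def iff by (cases "2 * j \<le> m") (simp_all only: k Let_def simp_thms if_True if_False)
  qed (simp add: algebra_simps)
next
  case False
  then have "s \<notin> complex_of_real ` (exc_set d \<inter> {3/2..1/2 + real m / 2})" for m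
    unfolding exc_set_upper_iff by blast
  then show ?thesis
    using False by (intro chain_solution_cong[OF pfun_chain_solution[of d "1 - s"]]) (auto simp: bfK_def algebra_simps)
qed

text \<open>For \<open>m < 2\<close> the only possible resonance is \<open>j = 0\<close>. Levels 0
  and 1 share one base function; they are the lowest members of the two parity classes.\<close>

lemma bfI_zero_base:
  assumes "m < 2" "y > 0"
  shows "bfI d \<omega> m 0 y s / fact m
    = of_real y powr s * ((if s = 1/2 then 1 else 0) * of_real (ln y) + (if s = 1/2 then 0 else 1))"
proof -
  have m: "m = 0 \<or> m = Suc 0" using assms by auto
  have iff: "s \<in> complex_of_real ` (exc_set d \<inter> {1/2 - real m / 2..1/2}) \<longleftrightarrow> s = 1/2"
    unfolding exc_set_lower_iff
  proof
    assume "\<exists>j\<le>(d - 1) div 2. s = 1 / 2 - of_nat j \<and> 2 * j \<le> m"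
    then obtain j where "s = 1 / 2 - of_nat j" "2 * j \<le> m" by blast
    moreover from this have "j = 0" using assms(1) by linarith
    ultimately show "s = 1 / 2" by simp
  next
    assume "s = 1 / 2"
    then show "\<exists>j\<le>(d - 1) div 2. s = 1 / 2 - of_nat j \<and> 2 * j \<le> m"
      by (intro exI[of _ 0]) simp
  qed
  show ?thesis
  proof (cases "s = 1/2")
    case True
    have "real m - 1 + 2 * Re s = of_int (int m)" unfolding True by simp
    then have k: "nat \<lfloor>real m - 1 + 2 * Re s\<rfloor> = m" by (simp only: floor_of_int nat_int)
    have "qfun m s = 1" "rfun m s = 0" "m div 2 = 0" "fact m = (1 :: complex)"
      using m True by (auto simp: rfun_def)
    then show ?thesis
      unfolding bfI_def iff k Let_def by (simp add: True)
  next
    case False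
    have "pfun m s = 1" "m div 2 = 0" "fact m = (1 :: complex)"
      using m by (auto simp: pfun_def)
    then show ?thesis
      unfolding bfI_def iff using False by simp
  qed
qed

lemma bfK_zero_base:
  assumes "m < 2" "y > 0"
  shows "bfK d \<omega> m 0 y s / fact m = of_real y powr (1 - s) * (0 * of_real (ln y) + 1)"
proof -
  have m: "m = 0 \<or> m = Suc 0" using assms by auto
  have "\<not> s \<in> complex_of_real ` (exc_set d \<inter> {3/2..1/2 + real m / 2})"
    unfolding exc_set_upper_iff using assms(1) by auto
  then show ?thesis
    unfolding bfK_def using m by (auto simp: pfun_def)
qed

text \<open>Two distinct powers \<open>y^s\<close> and \<open>y^(1 - s)\<close> have Wronskian
  \<open>1 - 2 s\<close>; at \<open>s = 1/2\<close> the pair is \<open>y^(1/2) log y\<close> and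
  \<open>y^(1/2)\<close>, with Wronskian -1.\<close>

lemma zero_base_fundamental_system:
  "\<exists>p' q' W. scalar_solution (\<lambda>y. s * (s - 1) / (of_real y)\<^sup>2)
      (\<lambda>y. of_real y powr s * ((if s = 1/2 then 1 else 0) * of_real (ln y) + (if s = 1/2 then 0 else 1))) p' \<and>
    scalar_solution (\<lambda>y. s * (s - 1) / (of_real y)\<^sup>2)
      (\<lambda>y. of_real y powr (1 - s) * (0 * of_real (ln y) + 1)) q' \<and> W \<noteq> 0 \<and>
    (\<forall>y>0. of_real y powr s * ((if s = 1/2 then 1 else 0) * of_real (ln y) + (if s = 1/2 then 0 else 1)) * q' y
      - of_real y powr (1 - s) * (0 * of_real (ln y) + 1) * p' y = W)"
proof -
  let ?c = "(if s = 1/2 then 1 else 0 :: complex)" and ?e = "(if s = 1/2 then 0 else 1 :: complex)"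
  let ?p' = "\<lambda>y. of_real y powr s * (s * ?c * of_real (ln y) + (s * ?e + ?c)) / of_real y"
  let ?q' = "\<lambda>y. of_real y powr (1 - s) * ((1 - s) * 0 * of_real (ln y) + ((1 - s) * 1 + 0)) / of_real y"
  let ?W = "if s = 1/2 then -1 else 1 - 2 * s"
  have z: "(2 * s - 1) * ?c = 0"
  proof (cases "s = 1 / 2")
    case True
    show ?thesis unfolding True by simp
  qed simp
  have A: "scalar_solution (\<lambda>y. s * (s - 1) / (of_real y)\<^sup>2) (\<lambda>y. of_real y powr s * (?c * of_real (ln y) + ?e)) ?p'"
    by (rule power_log_scalar_solution[OF z])
  have "scalar_solution (\<lambda>y. (1 - s) * ((1 - s) - 1) / (of_real y)\<^sup>2) (\<lambda>y. of_real y powr (1 - s) * (0 * of_real (ln y) + 1)) ?q'"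
    by (rule power_log_scalar_solution) auto
  moreover have "(1 - s) * ((1 - s) - 1) = s * (s - 1)" by (simp add: algebra_simps)
  ultimately have B: "scalar_solution (\<lambda>y. s * (s - 1) / (of_real y)\<^sup>2) (\<lambda>y. of_real y powr (1 - s) * (0 * of_real (ln y) + 1)) ?q'"
    by (simp only:)
  have W: "?W \<noteq> 0"
  proof (cases "s = 1 / 2")
    case False
    have "s = (1 - (1 - 2 * s)) / 2" by simp
    with False have "1 - 2 * s \<noteq> 0" by (metis diff_zero)
    with False show ?thesis by simp
  next
    case True
    then show ?thesis by (simp only: if_True) simp
  qed
  have Q: "of_real y powr s * (?c * of_real (ln y) + ?e) * ?q' y - of_real y powr (1 - s) * (0 * of_real (ln y) + 1) * ?p' y = ?W"
    if y: "y > 0" for y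
  proof -
    have "complex_of_real y powr s * of_real y powr (1 - s) = of_real y"
      using y by (simp flip: powr_add)
    then have P: "X * (complex_of_real y powr s * of_real y powr (1 - s)) / of_real y = X" for X
      using y by simp
    have "of_real y powr s * (?c * of_real (ln y) + ?e) * ?q' y - of_real y powr (1 - s) * (0 * of_real (ln y) + 1) * ?p' y
      = ((?c * of_real (ln y) + ?e) * (1 - s) - (s * ?c * of_real (ln y) + (s * ?e + ?c)))
         * (complex_of_real y powr s * of_real y powr (1 - s)) / of_real y"
      using y by (simp add: field_simps)
    also have "\<dots> = (?c * of_real (ln y) + ?e) * (1 - s) - (s * ?c * of_real (ln y) + (s * ?e + ?c))"
      by (rule P)
    also have "\<dots> = ?W" by (auto simp: algebra_simps)
    finally show ?thesis .
  qed
  show ?thesis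
    by (intro exI[of _ ?p'] exI[of _ ?q'] exI[of _ ?W] conjI allI impI A B W Q)
qed

section \<open>Twisted periodic functions\<close>

text \<open>The components of \<open>exp (- x (a + U)) \<psi>\<close>, in generating-function form
  \<open>exp (- x (a + \<tau>))\<close> times the series of \<open>\<psi>\<close>. For twisted
  \<open>\<psi>\<close> and \<open>exp a = \<mu>\<close> the exponential undoes the twist and leaves
  a periodic function.\<close>

definition twist_sum :: "complex \<Rightarrow> (nat \<Rightarrow> real \<Rightarrow> complex) \<Rightarrow> nat \<Rightarrow> real \<Rightarrow> complex" where
  "twist_sum a \<psi> m x = exp (- a * of_real x) * (\<Sum>k\<le>m. (- of_real x) ^ k / fact k * \<psi> (m - k) x)"

definition twist_integral :: "complex \<Rightarrow> (nat \<Rightarrow> real \<Rightarrow> complex) \<Rightarrow> nat \<Rightarrow> complex" where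
  "twist_integral a \<psi> m = integral {0..1} (twist_sum a \<psi> m)"

definition twisted :: "complex \<Rightarrow> nat \<Rightarrow> (nat \<Rightarrow> real \<Rightarrow> complex) \<Rightarrow> bool" where
  "twisted \<mu> d \<psi> \<longleftrightarrow> (\<forall>m<d. \<forall>x. \<psi> m (x + 1) = \<mu> * (\<Sum>k\<le>m. \<psi> (m - k) x / fact k))"

lemma twist_sum_shift:
  "twist_sum (a + 2 * complex_of_real pi * \<i> * of_int n) \<psi> m x = twist_sum a \<psi> m x * fourier_char (- n) x"
  unfolding twist_sum_def fourier_char_def
  by (simp add: algebra_simps exp_add[symmetric] exp_diff exp_minus divide_inverse)

lemma twist_sum_linear:
  "twist_sum a (\<lambda>m x. c * \<psi> m x + e * \<phi> m x) m x = c * twist_sum a \<psi> m x + e * twist_sum a \<phi> m x"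
  by (simp add: twist_sum_def sum.distrib sum_distrib_left algebra_simps)

lemma continuous_on_twist_sum:
  assumes "\<And>k. k \<le> m \<Longrightarrow> continuous_on A (\<psi> k)"
  shows "continuous_on A (twist_sum a \<psi> m)"
  unfolding twist_sum_def by (intro continuous_intros assms) auto

context
  includes fps_syntax
begin

lemma twist_sum_conv_fps:
  "twist_sum a \<psi> m x = exp (- a * of_real x) * (fps_exp (- of_real x) * Abs_fps (\<lambda>k. \<psi> k x)) $ m"
  by (simp add: twist_sum_def fps_mult_nth atLeast0AtMost)

text \<open>The step from \<open>x\<close> to \<open>x + 1\<close> contributes
  \<open>\<mu> exp \<tau>\<close> from the twist and \<open>exp (- a - \<tau>)\<close> from the
  prefactor, and these cancel.\<close>

lemma twist_sum_periodic:
  assumes tw: "twisted \<mu> d \<psi>" and "m < d" "exp a = \<mu>"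
  shows "twist_sum a \<psi> m (x + 1) = twist_sum a \<psi> m x"
proof -
  let ?\<Psi> = "Abs_fps (\<lambda>k. \<psi> k x)"
  have "(fps_exp (- of_real (x + 1)) * Abs_fps (\<lambda>k. \<psi> k (x + 1))) $ m
      = (\<Sum>k\<le>m. fps_exp (- of_real (x + 1)) $ k * (\<mu> * (fps_exp 1 * ?\<Psi>) $ (m - k)))"
    unfolding fps_mult_nth atLeast0AtMost
    using tw assms(2) by (intro sum.cong refl) (simp add: twisted_def)
  also have "\<dots> = \<mu> * (fps_exp (- of_real (x + 1)) * (fps_exp 1 * ?\<Psi>)) $ m"
    unfolding fps_mult_nth[of "fps_exp (- of_real (x + 1))" _ m] atLeast0AtMost sum_distrib_left
    by (intro sum.cong refl mult.left_commute)
  also have "fps_exp (- of_real (x + 1)) * (fps_exp 1 * ?\<Psi>) = fps_exp (- of_real x) * ?\<Psi>"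
    by (simp add: fps_exp_add_mult[symmetric] mult.assoc[symmetric])
  finally show ?thesis
    unfolding twist_sum_conv_fps assms(3)[symmetric]
    by (simp add: exp_add[symmetric] algebra_simps)
qed

lemma twist_sum_inverse:
  "(\<Sum>k\<le>m. of_real x ^ k / fact k * twist_sum a \<psi> (m - k) x) = exp (- a * of_real x) * \<psi> m x"
proof -
  let ?\<Psi> = "Abs_fps (\<lambda>k. \<psi> k x)"
  have "(\<Sum>k\<le>m. of_real x ^ k / fact k * twist_sum a \<psi> (m - k) x)
      = exp (- a * of_real x) * (fps_exp (of_real x) * (fps_exp (- of_real x) * ?\<Psi>)) $ m"
    by (simp add: twist_sum_conv_fps fps_mult_nth[of "fps_exp (of_real x)"] atLeast0AtMost sum_distrib_left mult_ac)
  also have "fps_exp (of_real x) * (fps_exp (- of_real x) * ?\<Psi>) = ?\<Psi>"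
    by (simp add: fps_exp_add_mult[symmetric] mult.assoc[symmetric])
  finally show ?thesis by simp
qed

end

text \<open>Differentiating \<open>exp (- x (a + U))\<close> gives \<open>- (a + U)\<close>, and
  \<open>U\<close> lowers the component by one.\<close>

lemma twist_sum_has_vector_derivative:
  assumes "\<And>k. k \<le> m \<Longrightarrow> (\<psi> k has_vector_derivative \<psi>' k x) (at x)"
  shows "(twist_sum a \<psi> m has_vector_derivative
     twist_sum a \<psi>' m x - (if m \<ge> 1 then twist_sum a \<psi> (m - 1) x else 0) - a * twist_sum a \<psi> m x) (at x)"
proof -
  define e where "e x = exp (- a * complex_of_real x)" for x
  have e: "(e has_vector_derivative - a * e x) (at x)"
    unfolding e_def by (rule has_vector_derivative_real_field) (auto intro!: derivative_eq_intros)
  have p: "((\<lambda>x. (- complex_of_real x) ^ k / fact k) has_vector_derivative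
      - (if k \<ge> 1 then (- complex_of_real x) ^ (k - 1) / fact (k - 1) else 0)) (at x)" for k
  proof (rule has_vector_derivative_real_field)
    show "((\<lambda>x. (- x) ^ k / fact k) has_field_derivative
      - (if k \<ge> 1 then (- complex_of_real x) ^ (k - 1) / fact (k - 1) else 0)) (at (of_real x))"
    proof (cases k)
      case (Suc n)
      have "fact k = of_nat k * (fact n :: complex)" "(of_nat k :: complex) \<noteq> 0"
        by (simp_all add: Suc del: of_nat_Suc)
      moreover have "((\<lambda>x. (- x) ^ k / fact k) has_field_derivative
          of_nat k * (- 1 * (- complex_of_real x) ^ (k - Suc 0)) / fact k) (at (of_real x))"
        by (intro DERIV_cdivide DERIV_power) (auto intro!: derivative_eq_intros)
      ultimately show ?thesis
        by (auto simp: Suc simp del: of_nat_Suc elim!: DERIV_cong)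
    qed (auto intro!: derivative_eq_intros)
  qed
  let ?S = "\<lambda>\<psi> m x. \<Sum>k\<le>m. (- complex_of_real x) ^ k / fact k * \<psi> (m - k) x"
  have "((\<lambda>x. e x * ?S \<psi> m x) has_vector_derivative
      e x * (\<Sum>k\<le>m. (- complex_of_real x) ^ k / fact k * \<psi>' (m - k) x
         + (- (if k \<ge> 1 then (- complex_of_real x) ^ (k - 1) / fact (k - 1) else 0)) * \<psi> (m - k) x)
      + (- a * e x) * ?S \<psi> m x) (at x)"
    by (intro has_vector_derivative_mult has_vector_derivative_sum e p assms) auto
  moreover have eq: "(\<Sum>k\<le>m. (if k \<ge> 1 then (- complex_of_real x) ^ (k - 1) / fact (k - 1) else 0) * \<psi> (m - k) x)
      = (if m \<ge> 1 then ?S \<psi> (m - 1) x else 0)"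
  proof (cases m)
    case (Suc n)
    show ?thesis unfolding Suc by (subst sum.atMost_Suc_shift) simp
  qed simp
  moreover have "e x * (X - (if m \<ge> 1 then Y else 0)) + (- a * e x) * Z
      = e x * X - (if m \<ge> 1 then e x * Y else 0) - a * (e x * Z)" for X Y Z
    by (cases "m \<ge> 1") (simp_all add: algebra_simps)
  ultimately show ?thesis
    unfolding twist_sum_def e_def[symmetric]
    by (simp only: sum.distrib mult_minus_left sum_negf add_uminus_conv_diff sum_subtractf)
qed

text \<open>Integration by parts: the boundary terms cancel because the twisted sum is periodic.\<close>

lemma twist_integral_deriv:
  assumes d: "m < d"
    and D: "\<And>k x. k < d \<Longrightarrow> (\<psi> k has_vector_derivative \<psi>' k x) (at x)"
    and cont: "\<And>k. k < d \<Longrightarrow> continuous_on UNIV (\<psi>' k)"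
    and tw: "twisted \<mu> d \<psi>" "exp a = \<mu>"
  shows "twist_integral a \<psi>' m = (if m \<ge> 1 then twist_integral a \<psi> (m - 1) else 0) + a * twist_integral a \<psi> m"
proof -
  have cont\<psi>: "continuous_on A (\<psi> k)" if "k < d" for k A
    by (intro continuous_at_imp_continuous_on ballI has_vector_derivative_continuous[OF D[OF that]])
  have cont\<psi>': "continuous_on A (\<psi>' k)" if "k < d" for k A
    by (rule continuous_on_subset[OF cont[OF that]]) simp
  have int: "(twist_sum a \<phi> k has_integral twist_integral a \<phi> k) {0..1}"
    if "\<And>j A. j < d \<Longrightarrow> continuous_on A (\<phi> j)" "k < d" for k \<phi>
    unfolding twist_integral_def
    by (intro integrable_integral integrable_continuous_interval continuous_on_twist_sum that(1))
       (use that(2) in simp)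
  have 1: "((\<lambda>x. twist_sum a \<psi>' m x - (if m \<ge> 1 then twist_sum a \<psi> (m - 1) x else 0) - a * twist_sum a \<psi> m x)
      has_integral twist_sum a \<psi> m 1 - twist_sum a \<psi> m 0) {0..1}"
    by (rule fundamental_theorem_of_calculus[OF _ has_vector_derivative_at_within[OF twist_sum_has_vector_derivative]])
       (use d in \<open>simp_all add: D\<close>)
  have 2: "twist_sum a \<psi> m 1 = twist_sum a \<psi> m 0"
    using twist_sum_periodic[OF tw(1) d tw(2), of 0] by simp
  have 3: "((\<lambda>x. twist_sum a \<psi>' m x - (if m \<ge> 1 then twist_sum a \<psi> (m - 1) x else 0) - a * twist_sum a \<psi> m x)
      has_integral twist_integral a \<psi>' m - (if m \<ge> 1 then twist_integral a \<psi> (m - 1) else 0) - a * twist_integral a \<psi> m) {0..1}"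
  proof -
    have "((\<lambda>x. if m \<ge> 1 then twist_sum a \<psi> (m - 1) x else 0) has_integral
        (if m \<ge> 1 then twist_integral a \<psi> (m - 1) else 0)) {0..1}"
    proof (cases "m \<ge> 1")
      case True
      have "m - 1 < d" using d by simp
      from int[OF cont\<psi> this] show ?thesis using True by simp
    qed simp
    then show ?thesis
      by (intro has_integral_diff has_integral_mult_right int cont\<psi> cont\<psi>' d)
  qed
  have "twist_integral a \<psi>' m - (if m \<ge> 1 then twist_integral a \<psi> (m - 1) else 0) - a * twist_integral a \<psi> m = 0"
    using has_integral_unique[OF 3 1] 2 by simp
  then show ?thesis by (simp add: algebra_simps)
qed

lemma twist_integral_eq_fourier_coeff:
  "twist_integral (a + 2 * complex_of_real pi * \<i> * of_int n) \<psi> m = fourier_coeff (twist_sum a \<psi> m) n"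
  by (simp add: twist_integral_def fourier_coeff_def twist_sum_shift[abs_def])

lemma twist_sum_fourier_series:
  assumes d: "m < d"
    and D: "\<And>k x. k < d \<Longrightarrow> (\<psi> k has_vector_derivative \<psi>' k x) (at x)"
    and cont: "\<And>k. k < d \<Longrightarrow> continuous_on UNIV (\<psi>' k)"
    and tw: "twisted \<mu> d \<psi>" "exp a = \<mu>"
  shows "((\<lambda>n. twist_integral (a + 2 * complex_of_real pi * \<i> * of_int n) \<psi> m * fourier_char n x)
     has_sum twist_sum a \<psi> m x) UNIV"
  unfolding twist_integral_eq_fourier_coeff
proof (rule fourier_series_has_sum)
  have cont\<psi>: "continuous_on A (\<psi> k)" if "k < d" for k A
    by (intro continuous_at_imp_continuous_on ballI has_vector_derivative_continuous[OF D[OF that]])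
  show "(twist_sum a \<psi> m has_vector_derivative
     twist_sum a \<psi>' m x - (if m \<ge> 1 then twist_sum a \<psi> (m - 1) x else 0) - a * twist_sum a \<psi> m x) (at x)" for x
    using D d by (intro twist_sum_has_vector_derivative) auto
  have "continuous_on UNIV (\<lambda>x. if m \<ge> 1 then twist_sum a \<psi> (m - 1) x else 0)"
    using d by (cases "m \<ge> 1") (auto intro!: continuous_on_twist_sum cont\<psi>)
  then show "continuous_on UNIV (\<lambda>x. twist_sum a \<psi>' m x - (if m \<ge> 1 then twist_sum a \<psi> (m - 1) x else 0) - a * twist_sum a \<psi> m x)"
    using d by (intro continuous_on_diff continuous_on_mult continuous_on_const continuous_on_twist_sum cont\<psi> cont) auto
  show "twist_sum a \<psi> m (x + 1) = twist_sum a \<psi> m x" for x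
    by (rule twist_sum_periodic[OF tw(1) d tw(2)])
qed

section \<open>Eigenfunctions of the Laplacian\<close>

lemma has_sum_finite_sum:
  fixes F :: "'a \<Rightarrow> 'b \<Rightarrow> complex"
  assumes "finite A" "\<And>k. k \<in> A \<Longrightarrow> (F k has_sum S k) B"
  shows "((\<lambda>n. \<Sum>k\<in>A. F k n) has_sum (\<Sum>k\<in>A. S k)) B"
  using assms by (induction A rule: finite_induct) (auto intro!: has_sum_add)

lemma smooth_on_dx:
  assumes "smooth_on S F"
  shows "smooth_on S (dx F)"
  unfolding smooth_on_def
proof
  fix k
  have "Ck_on (Suc k) S F" using assms unfolding smooth_on_def ..
  then show "Ck_on k S (dx F)" unfolding Ck_on.simps dx_def[abs_def] by (elim conjE allE)
qed

lemma smooth_on_dy: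
  assumes "smooth_on S F"
  shows "smooth_on S (dy F)"
  unfolding smooth_on_def
proof
  fix k
  have "Ck_on (Suc k) S F" using assms unfolding smooth_on_def ..
  then show "Ck_on k S (dy F)" unfolding Ck_on.simps dy_def[abs_def] by (elim conjE allE)
qed

lemma smooth_on_imp_continuous_on: "smooth_on S F \<Longrightarrow> continuous_on S F"
  unfolding smooth_on_def by (drule spec[of _ 0]) simp

lemma smooth_on_has_derivative:
  assumes "smooth_on S F" "z \<in> S"
  shows "(F has_derivative frechet_derivative F (at z)) (at z)"
proof -
  have "Ck_on (Suc 0) S F" using assms(1) unfolding smooth_on_def by blast
  then have "F differentiable (at z)" using assms(2) by simp
  then show ?thesis by (simp add: frechet_derivative_works)
qed

lemma smooth_on_dx_has_vector_derivative:
  assumes "smooth_on S F" "Complex x y \<in> S"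
  shows "((\<lambda>t. F (Complex t y)) has_vector_derivative dx F (Complex x y)) (at x)"
proof -
  have "((\<lambda>t. Complex t y) has_vector_derivative 1) (at x)"
  proof -
    have "((\<lambda>t. of_real t + \<i> * complex_of_real y) has_vector_derivative 1 + 0) (at x)"
      by (intro has_vector_derivative_add has_vector_derivative_const)
         (auto intro!: has_vector_derivative_real_field derivative_eq_intros)
    then show ?thesis unfolding Complex_eq by simp
  qed
  from vector_derivative_diff_chain_within[OF this has_derivative_at_withinI[OF smooth_on_has_derivative[OF assms]]]
  show ?thesis by (simp add: dx_def o_def)
qed

lemma smooth_on_dy_has_vector_derivative:
  assumes "smooth_on S F" "Complex x y \<in> S"
  shows "((\<lambda>t. F (Complex x t)) has_vector_derivative dy F (Complex x y)) (at y)"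
proof -
  have "((\<lambda>t. Complex x t) has_vector_derivative \<i>) (at y)"
  proof -
    have "((\<lambda>t. of_real x + \<i> * complex_of_real t) has_vector_derivative 0 + \<i> * 1) (at y)"
      by (intro has_vector_derivative_add has_vector_derivative_const has_vector_derivative_mult_right)
         (auto intro!: has_vector_derivative_real_field derivative_eq_intros)
    then show ?thesis unfolding Complex_eq by simp
  qed
  from vector_derivative_diff_chain_within[OF this has_derivative_at_withinI[OF smooth_on_has_derivative[OF assms]]]
  show ?thesis by (simp add: dy_def o_def)
qed

lemma Complex_in_upper_half_plane [simp]: "Complex x y \<in> upper_half_plane \<longleftrightarrow> y > 0"
  by (simp add: upper_half_plane_def)

lemma continuous_on_horizontal:
  assumes "continuous_on upper_half_plane g" "y > 0"
  shows "continuous_on A (\<lambda>x. g (Complex x y))"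
proof (rule continuous_on_compose2[OF assms(1)])
  show "continuous_on A (\<lambda>x. Complex x y)"
    unfolding Complex_eq by (intro continuous_intros)
qed (use assms(2) in auto)

text \<open>Differentiation under the integral over a compact interval; joint continuity in both
  variables comes from continuity of \<open>g'\<close> on the half-plane.\<close>

lemma twist_integral_has_vector_derivative:
  assumes D: "\<And>k x y. k \<le> m \<Longrightarrow> y > 0 \<Longrightarrow> ((\<lambda>t. g k (Complex x t)) has_vector_derivative g' k (Complex x y)) (at y)"
    and cont: "\<And>k. k \<le> m \<Longrightarrow> continuous_on upper_half_plane (g k)"
      "\<And>k. k \<le> m \<Longrightarrow> continuous_on upper_half_plane (g' k)"
    and y: "y > 0"
  shows "((\<lambda>y. twist_integral a (\<lambda>k x. g k (Complex x y)) m) has_vector_derivative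
      twist_integral a (\<lambda>k x. g' k (Complex x y)) m) (at y)"
proof -
  let ?F = "\<lambda>g y x. twist_sum a (\<lambda>k x. g k (Complex x y)) m x"
  have "((\<lambda>y. integral (cbox 0 1) (?F g y)) has_vector_derivative integral (cbox 0 1) (?F g' y)) (at y within {0<..})"
  proof (rule leibniz_rule_vector_derivative)
    fix t x :: real assume "t \<in> {0<..}"
    then show "((\<lambda>y. ?F g y x) has_vector_derivative ?F g' t x) (at t within {0<..})"
      unfolding twist_sum_def
      by (intro has_vector_derivative_mult_right has_vector_derivative_sum has_vector_derivative_at_within[OF D]) auto
  next
    fix t :: real assume "t \<in> {0<..}"
    then show "?F g t integrable_on cbox 0 1"
      unfolding cbox_interval
      by (intro integrable_continuous_interval continuous_on_twist_sum continuous_on_horizontal cont) auto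
  next
    have "continuous_on ({0<..} \<times> cbox 0 1) (\<lambda>(t, x). g' k (Complex x t))" if "k \<le> m" for k
      unfolding case_prod_unfold
    proof (rule continuous_on_compose2[OF cont(2)[OF that]])
      show "continuous_on ({0<..} \<times> cbox 0 1) (\<lambda>p. Complex (snd p) (fst p))"
        unfolding Complex_eq by (intro continuous_intros)
    qed auto
    then show "continuous_on ({0<..} \<times> cbox 0 1) (\<lambda>(t, x). ?F g' t x)"
      unfolding twist_sum_def case_prod_unfold by (intro continuous_intros) auto
  qed (use y in auto)
  then show ?thesis
    using y unfolding twist_integral_def cbox_interval
    by (simp add: at_within_open[of y "{0<..}"])
qed

section \<open>The basis in which the Jordan block acts as an exponential\<close>

definition exp_comb :: "(nat \<Rightarrow> complex \<Rightarrow> complex) \<Rightarrow> nat \<Rightarrow> complex \<Rightarrow> complex" where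
  "exp_comb g m z = (\<Sum>k\<le>m. exp_coeff m k * g k z)"

lemma exp_comb_inverse: "(\<Sum>j\<le>m. log_coeff m j * exp_comb g j z) = g m z"
proof -
  have "(\<Sum>j\<le>m. log_coeff m j * exp_comb g j z) = (\<Sum>j\<le>m. \<Sum>k\<le>m. log_coeff m j * exp_coeff j k * g k z)"
    unfolding exp_comb_def sum_distrib_left
    by (intro sum.cong sum.mono_neutral_cong_left) (auto simp: exp_coeff_eq_0)
  also have "\<dots> = (\<Sum>k\<le>m. (\<Sum>j\<le>m. log_coeff m j * exp_coeff j k) * g k z)"
    by (subst sum.swap) (simp add: sum_distrib_right)
  also have "\<dots> = (\<Sum>k\<le>m. if m = k then g k z else 0)"
    by (intro sum.cong) (auto simp: log_exp_coeff_inverse)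
  finally show ?thesis by simp
qed

text \<open>The hypothesis is one action of the block, multiplication by
  \<open>\<mu> (1 + t)\<close>; in the new basis \<open>exp_coeff_Suc\<close> turns it into
  \<open>\<mu> exp \<tau>\<close>. The index shift is free since
  \<open>exp_coeff m (Suc m) = 0\<close>.\<close>

lemma exp_comb_twisted:
  assumes "\<And>k x. k < d \<Longrightarrow> g k (Complex (x + 1) y) =
     \<mu> * (g k (Complex x y) + (if k \<ge> 1 then g (k - 1) (Complex x y) else 0))"
  shows "twisted \<mu> d (\<lambda>m x. exp_comb g m (Complex x y))"
  unfolding twisted_def
proof (intro allI impI)
  fix m x assume m: "m < d"
  let ?g = "\<lambda>k. g k (Complex x y)"
  have "exp_comb g m (Complex (x + 1) y) = \<mu> * (\<Sum>k\<le>m. exp_coeff m k * ?g k + exp_coeff m k * (if k \<ge> 1 then ?g (k - 1) else 0))"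
    unfolding exp_comb_def sum_distrib_left
    by (intro sum.cong refl) (use m in \<open>simp add: assms distrib_left mult_ac\<close>)
  also have "(\<Sum>k\<le>m. exp_coeff m k * ?g k + exp_coeff m k * (if k \<ge> 1 then ?g (k - 1) else 0))
      = (\<Sum>k\<le>m. exp_coeff m k * ?g k) + (\<Sum>k\<le>Suc m. exp_coeff m k * (if k \<ge> 1 then ?g (k - 1) else 0))"
    by (simp add: sum.distrib exp_coeff_eq_0)
  also have "(\<Sum>k\<le>Suc m. exp_coeff m k * (if k \<ge> 1 then ?g (k - 1) else 0)) = (\<Sum>k\<le>m. exp_coeff m (Suc k) * ?g k)"
    by (subst sum.atMost_Suc_shift) simp
  also have "(\<Sum>k\<le>m. exp_coeff m k * ?g k) + (\<Sum>k\<le>m. exp_coeff m (Suc k) * ?g k)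
      = (\<Sum>k\<le>m. (\<Sum>j\<le>m. exp_coeff (m - j) k / fact j) * ?g k)"
    by (simp add: exp_coeff_Suc[symmetric] sum.distrib distrib_right)
  also have "\<dots> = (\<Sum>j\<le>m. \<Sum>k\<le>m. exp_coeff (m - j) k / fact j * ?g k)"
    unfolding sum_distrib_right by (rule sum.swap)
  also have "\<dots> = (\<Sum>j\<le>m. exp_comb g (m - j) (Complex x y) / fact j)"
  proof (intro sum.cong refl)
    fix j
    have "(\<Sum>k\<le>m. exp_coeff (m - j) k / fact j * ?g k) = (\<Sum>k\<le>m - j. exp_coeff (m - j) k / fact j * ?g k)"
      by (rule sum.mono_neutral_right) (auto simp: exp_coeff_eq_0)
    then show "(\<Sum>k\<le>m. exp_coeff (m - j) k / fact j * ?g k) = exp_comb g (m - j) (Complex x y) / fact j"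
      by (simp add: exp_comb_def sum_divide_distrib)
  qed
  finally show "exp_comb g m (Complex (x + 1) y) = \<mu> * (\<Sum>k\<le>m. exp_comb g (m - k) (Complex x y) / fact k)" .
qed

lemma exp_comb_continuous_on:
  assumes "\<And>k. k \<le> m \<Longrightarrow> continuous_on A (g k)"
  shows "continuous_on A (exp_comb g m)"
  unfolding exp_comb_def by (intro continuous_intros assms) auto

lemma exp_comb_has_vector_derivative:
  assumes "\<And>k. k \<le> m \<Longrightarrow> ((\<lambda>t. g k (c t)) has_vector_derivative g' k z) (at x)"
  shows "((\<lambda>t. exp_comb g m (c t)) has_vector_derivative exp_comb g' m z) (at x)"
  unfolding exp_comb_def by (intro has_vector_derivative_sum has_vector_derivative_mult_right assms) auto

context
  fixes d :: nat and f :: "nat \<Rightarrow> complex \<Rightarrow> complex" and \<mu> s \<kappa> :: complex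
  assumes smooth: "\<And>k. k < d \<Longrightarrow> smooth_on upper_half_plane (f k)"
    and eigen: "\<And>k z. k < d \<Longrightarrow> z \<in> upper_half_plane \<Longrightarrow> hyp_laplacian (f k) z = s * (1 - s) * f k z"
    and twist: "\<And>k z. k < d \<Longrightarrow> z \<in> upper_half_plane \<Longrightarrow>
      f k (z + 1) = \<mu> * (f k z + (if k \<ge> 1 then f (k - 1) z else 0))"
    and exp_l: "exp \<kappa> = \<mu>"
begin

lemma twist_Complex:
  assumes "k < d" "y > 0"
  shows "f k (Complex (x + 1) y) = \<mu> * (f k (Complex x y) + (if k \<ge> 1 then f (k - 1) (Complex x y) else 0))"
  using twist[OF assms(1), of "Complex x y"] assms(2) by (simp add: plus_complex.code one_complex.code)

text \<open>The second integration by parts acts on \<open>dx f\<close>, whose boundary terms cancel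
  only if it is twisted in the same way.\<close>

lemma twist_dx:
  assumes "k < d" "y > 0"
  shows "dx (f k) (Complex (x + 1) y)
    = \<mu> * (dx (f k) (Complex x y) + (if k \<ge> 1 then dx (f (k - 1)) (Complex x y) else 0))"
proof -
  have D: "((\<lambda>t. f j (Complex t y)) has_vector_derivative dx (f j) (Complex t y)) (at t)" if "j < d" for j t
    using that assms(2) by (intro smooth_on_dx_has_vector_derivative[OF smooth]) auto
  have "((\<lambda>t. t + 1) has_vector_derivative 1) (at x)"
    by (auto intro!: derivative_eq_intros simp flip: has_real_derivative_iff_has_vector_derivative)
  then have "((\<lambda>t. f k (Complex (t + 1) y)) has_vector_derivative 1 *\<^sub>R dx (f k) (Complex (x + 1) y)) (at x)"
    using vector_diff_chain_at[of "\<lambda>t. t + 1" 1 x "\<lambda>t. f k (Complex t y)"] D[OF assms(1), of "x + 1"]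
    by (simp add: o_def)
  then have "((\<lambda>t. \<mu> * (f k (Complex t y) + (if k \<ge> 1 then f (k - 1) (Complex t y) else 0)))
      has_vector_derivative dx (f k) (Complex (x + 1) y)) (at x)"
    using twist_Complex[OF assms] by simp
  moreover have "((\<lambda>t. if k \<ge> 1 then f (k - 1) (Complex t y) else 0) has_vector_derivative
      (if k \<ge> 1 then dx (f (k - 1)) (Complex x y) else 0)) (at x)"
    using D[of "k - 1" x] assms(1) by (cases "k \<ge> 1") auto
  then have "((\<lambda>t. \<mu> * (f k (Complex t y) + (if k \<ge> 1 then f (k - 1) (Complex t y) else 0)))
      has_vector_derivative \<mu> * (dx (f k) (Complex x y) + (if k \<ge> 1 then dx (f (k - 1)) (Complex x y) else 0))) (at x)"
    by (intro has_vector_derivative_mult_right has_vector_derivative_add D assms(1))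
  ultimately show ?thesis by (rule vector_derivative_unique_at)
qed

text \<open>A Fourier coefficient of the untwisted function. The frequency \<open>n\<close> is
  absorbed into the exponent, so that one formula for integration by parts serves all
  \<open>n\<close>.\<close>

definition mode :: "int \<Rightarrow> nat \<Rightarrow> real \<Rightarrow> complex" where
  "mode n m y = twist_integral (\<kappa> + 2 * complex_of_real pi * \<i> * of_int n) (\<lambda>k x. exp_comb f k (Complex x y)) m"

text \<open>Each horizontal derivative acts on a mode as \<open>a n + U\<close>, two of them as
  \<open>(a n)^2 + 2 (a n) U + U^2\<close>. The eigenvalue equation replaces the second vertical
  derivative by minus this plus \<open>s (s - 1) / y^2\<close>.\<close>

lemma mode_chain_solution:
  defines "a \<equiv> \<lambda>n. \<kappa> + 2 * complex_of_real pi * \<i> * of_int n"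
  shows "chain_solution (\<lambda>y. - (a n)\<^sup>2 + s * (s - 1) / (of_real y)\<^sup>2) (- 2 * a n) (- 1) d (mode n)"
  unfolding chain_solution_def
proof (intro exI[of _ "\<lambda>m y. twist_integral (a n) (\<lambda>k x. exp_comb (\<lambda>k. dy (f k)) k (Complex x y)) m"] allI impI conjI)
  fix m y assume m: "m < d" and y: "y > (0::real)"
  have an: "\<kappa> + 2 * complex_of_real pi * \<i> * of_int n = a n"
    by (simp add: a_def)
  have exp_a: "exp (a n) = \<mu>"
  proof -
    have "2 * complex_of_real pi * \<i> * of_int n = \<i> * (of_int n * (of_real pi * 2))" by simp
    then show ?thesis using exp_integer_2pi[of "of_int n"] by (simp add: a_def exp_add exp_l mult_ac)
  qed
  have sm: "smooth_on upper_half_plane (f k)" "smooth_on upper_half_plane (dx (f k))" "smooth_on upper_half_plane (dy (f k))"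
    "smooth_on upper_half_plane (dx (dx (f k)))" "smooth_on upper_half_plane (dy (dy (f k)))" if "k < d" for k
    using smooth[OF that] by (auto intro: smooth_on_dx smooth_on_dy)
  note cont = sm[THEN smooth_on_imp_continuous_on]
  show "(mode n m has_vector_derivative
      twist_integral (a n) (\<lambda>k x. exp_comb (\<lambda>k. dy (f k)) k (Complex x y)) m) (at y)"
    unfolding mode_def an
    by (intro twist_integral_has_vector_derivative exp_comb_has_vector_derivative exp_comb_continuous_on
        smooth_on_dy_has_vector_derivative[OF sm(1)] cont(1,3) y) (use m in auto)
  have D2: "((\<lambda>y. twist_integral (a n) (\<lambda>k x. exp_comb (\<lambda>k. dy (f k)) k (Complex x y)) m) has_vector_derivative
      twist_integral (a n) (\<lambda>k x. exp_comb (\<lambda>k. dy (dy (f k))) k (Complex x y)) m) (at y)"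
    by (intro twist_integral_has_vector_derivative exp_comb_has_vector_derivative exp_comb_continuous_on
        smooth_on_dy_has_vector_derivative[OF sm(3)] cont(3,5) y) (use m in auto)
  define I where "I g m = twist_integral (a n) (\<lambda>k x. exp_comb g k (Complex x y)) m" for g m
  define c where "c = s * (s - 1) / (complex_of_real y)\<^sup>2"
  have dyy: "dy (dy (f k)) (Complex x y) = c * f k (Complex x y) + (- 1) * dx (dx (f k)) (Complex x y)" if "k < d" for k x
  proof -
    have "- (complex_of_real y)\<^sup>2 * (dx (dx (f k)) (Complex x y) + dy (dy (f k)) (Complex x y)) = s * (1 - s) * f k (Complex x y)"
      using eigen[OF that, of "Complex x y"] y by (simp add: hyp_laplacian_def)
    then show ?thesis using y unfolding c_def by (simp add: field_simps)
  qed
  have I_dyy: "I (\<lambda>k. dy (dy (f k))) m = c * I f m + (- 1) * I (\<lambda>k. dx (dx (f k))) m"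
  proof -
    have "exp_comb (\<lambda>k. dy (dy (f k))) k (Complex x y) = c * exp_comb f k (Complex x y)
        + (- 1) * exp_comb (\<lambda>k. dx (dx (f k))) k (Complex x y)" if "k \<le> m" for k x
      unfolding exp_comb_def sum_distrib_left sum.distrib[symmetric]
      using that m by (intro sum.cong refl) (simp add: dyy algebra_simps)
    then have eq: "twist_sum (a n) (\<lambda>k x. exp_comb (\<lambda>k. dy (dy (f k))) k (Complex x y)) m x =
      c * twist_sum (a n) (\<lambda>k x. exp_comb f k (Complex x y)) m x
      + (- 1) * twist_sum (a n) (\<lambda>k x. exp_comb (\<lambda>k. dx (dx (f k))) k (Complex x y)) m x" for x
      unfolding twist_sum_linear[symmetric] by (simp add: twist_sum_def)
    have int: "twist_sum (a n) (\<lambda>k x. exp_comb g k (Complex x y)) m integrable_on {0..1}"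
      if "\<And>k. k < d \<Longrightarrow> continuous_on upper_half_plane (g k)" for g
      using m y by (intro integrable_continuous_interval continuous_on_twist_sum
          continuous_on_horizontal exp_comb_continuous_on that) auto
    show ?thesis
      unfolding I_def twist_integral_def eq[abs_def]
      by (intro integral_unique has_integral_add has_integral_mult_right integrable_integral int cont)
  qed
  have I_dx: "I (\<lambda>k. dx (f k)) j = (if j \<ge> 1 then I f (j - 1) else 0) + a n * I f j" if "j < d" for j
    unfolding I_def
    by (rule twist_integral_deriv[OF that _ _ exp_comb_twisted[OF twist_Complex[OF _ y]] exp_a])
       (use y in \<open>auto intro!: exp_comb_has_vector_derivative smooth_on_dx_has_vector_derivative[OF sm(1)]
          continuous_on_horizontal exp_comb_continuous_on cont(2)\<close>)
  have I_dxx: "I (\<lambda>k. dx (dx (f k))) m = (if m \<ge> 1 then I (\<lambda>k. dx (f k)) (m - 1) else 0) + a n * I (\<lambda>k. dx (f k)) m"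
    unfolding I_def
    by (rule twist_integral_deriv[OF m _ _ exp_comb_twisted[OF twist_dx[OF _ y]] exp_a])
       (use y in \<open>auto intro!: exp_comb_has_vector_derivative smooth_on_dx_has_vector_derivative[OF sm(2)]
          continuous_on_horizontal exp_comb_continuous_on cont(4)\<close>)
  have md: "m - 1 < d" using m by simp
  have EI: "I (\<lambda>k. dy (dy (f k))) m = (- (a n)\<^sup>2 + c) * I f m
        + (if m \<ge> 1 then - 2 * a n * I f (m - 1) else 0) + (if m \<ge> 2 then - 1 * I f (m - 2) else 0)"
  proof -
    consider "m = 0" | "m = 1" | k where "m = Suc (Suc k)" by (metis One_nat_def not0_implies_Suc)
    then show ?thesis
      unfolding I_dyy I_dxx I_dx[OF m] I_dx[OF md]
      by cases (auto simp: algebra_simps power2_eq_square)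
  qed
  have If: "I f j = mode n j y" for j
    by (simp add: I_def mode_def a_def)
  show "((\<lambda>y. twist_integral (a n) (\<lambda>k x. exp_comb (\<lambda>k. dy (f k)) k (Complex x y)) m) has_vector_derivative
      (- (a n)\<^sup>2 + s * (s - 1) / (of_real y)\<^sup>2) * mode n m y
        + (if m \<ge> 1 then - 2 * a n * mode n (m - 1) y else 0) + (if m \<ge> 2 then - 1 * mode n (m - 2) y else 0)) (at y)"
    by (rule has_vector_derivative_eq_rhs[OF D2]) (rule EI[unfolded If c_def, unfolded I_def])
qed

text \<open>By \<open>gbinomial_log_coeff\<close> the binomial action of \<open>J^x\<close> is
  \<open>exp (x U)\<close> in the logarithmic basis; it cancels the exponential inside
  \<open>twist_sum\<close>, and \<open>exp_comb_inverse\<close> leads back to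
  \<open>f\<close>.\<close>

lemma mode_expansion:
  assumes m: "m < d" and y: "y > 0"
  shows "((\<lambda>n. fourier_char n x * (exp (of_real x * \<kappa>) * (\<Sum>k\<le>m. (complex_of_real x gchoose k) *
     (\<Sum>j\<le>m - k. log_coeff (m - k) j * mode n j y)))) has_sum f m (Complex x y)) UNIV"
proof -
  let ?\<psi> = "\<lambda>k x. exp_comb f k (Complex x y)"
  define \<gamma> where "\<gamma> j = twist_sum \<kappa> ?\<psi> j x" for j
  have four: "((\<lambda>n. mode n j y * fourier_char n x) has_sum \<gamma> j) UNIV" if "j < d" for j
    unfolding mode_def \<gamma>_def
  proof (rule twist_sum_fourier_series[OF that _ _ _ exp_l])
    show "twisted \<mu> d ?\<psi>"
      by (intro exp_comb_twisted twist_Complex y)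
    show "(?\<psi> k has_vector_derivative exp_comb (\<lambda>k. dx (f k)) k (Complex x y)) (at x)" if "k < d" for k x
      using that y by (intro exp_comb_has_vector_derivative smooth_on_dx_has_vector_derivative[OF smooth]) auto
    show "continuous_on UNIV (\<lambda>x. exp_comb (\<lambda>k. dx (f k)) k (Complex x y))" if "k < d" for k
      using that y by (intro continuous_on_horizontal exp_comb_continuous_on smooth_on_imp_continuous_on smooth_on_dx smooth) auto
  qed
  have ext: "(\<Sum>j\<le>m - k. log_coeff (m - k) j * h j) = (\<Sum>j\<le>m. log_coeff (m - k) j * h j)" for k h
    by (rule sum.mono_neutral_left) (auto simp: log_coeff_eq_0)
  have "((\<lambda>n. \<Sum>k\<le>m. \<Sum>j\<le>m. exp (of_real x * \<kappa>) * (complex_of_real x gchoose k) * log_coeff (m - k) j * (mode n j y * fourier_char n x))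
      has_sum (\<Sum>k\<le>m. \<Sum>j\<le>m. exp (of_real x * \<kappa>) * (complex_of_real x gchoose k) * log_coeff (m - k) j * \<gamma> j)) UNIV"
    using m by (intro has_sum_finite_sum has_sum_cmult_right four) auto
  moreover have "(\<Sum>k\<le>m. \<Sum>j\<le>m. exp (of_real x * \<kappa>) * (complex_of_real x gchoose k) * log_coeff (m - k) j * (mode n j y * fourier_char n x))
      = fourier_char n x * (exp (of_real x * \<kappa>) * (\<Sum>k\<le>m. (complex_of_real x gchoose k) *
     (\<Sum>j\<le>m - k. log_coeff (m - k) j * mode n j y)))" for n
    unfolding ext by (simp add: sum_distrib_left mult_ac)
  moreover have "(\<Sum>k\<le>m. \<Sum>j\<le>m. exp (of_real x * \<kappa>) * (complex_of_real x gchoose k) * log_coeff (m - k) j * \<gamma> j)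
      = f m (Complex x y)"
  proof -
    have "(\<Sum>k\<le>m. \<Sum>j\<le>m. (complex_of_real x gchoose k) * log_coeff (m - k) j * \<gamma> j)
        = (\<Sum>j\<le>m. (\<Sum>k\<le>m. (complex_of_real x gchoose k) * log_coeff (m - k) j) * \<gamma> j)"
      unfolding sum_distrib_right by (rule sum.swap)
    also have "\<dots> = (\<Sum>j\<le>m. \<Sum>k\<le>m. of_real x ^ k / fact k * log_coeff m (j + k) * \<gamma> j)"
      unfolding gbinomial_log_coeff sum_distrib_right ..
    also have "\<dots> = (\<Sum>j\<le>m. \<Sum>k\<le>m - j. of_real x ^ k / fact k * log_coeff m (j + k) * \<gamma> j)"
    proof (intro sum.cong[OF refl] sum.mono_neutral_right ballI)
      fix j k assume "k \<in> {..m} - {..m - j}"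
      then have "log_coeff m (j + k) = 0" by (intro log_coeff_eq_0) auto
      then show "complex_of_real x ^ k / fact k * log_coeff m (j + k) * \<gamma> j = 0" by simp
    qed auto
    also have "\<dots> = (\<Sum>i\<le>m. \<Sum>k\<le>i. of_real x ^ k / fact k * log_coeff m i * \<gamma> (i - k))"
    proof -
      have "(\<Sum>j\<le>m. \<Sum>k\<le>m - j. of_real x ^ k / fact k * log_coeff m (j + k) * \<gamma> j)
        = (\<Sum>(j, k)\<in>(SIGMA j:{..m}. {..m - j}). of_real x ^ k / fact k * log_coeff m (j + k) * \<gamma> j)"
        by (rule sum.Sigma) auto
      \<comment> \<open>Collecting the terms with \<open>j + k = i\<close> exhibits, for each
        \<open>log_coeff m i\<close>, the sum that inverts the twist.\<close>
      also have "\<dots> = (\<Sum>(i, k)\<in>(SIGMA i:{..m}. {..i}). of_real x ^ k / fact k * log_coeff m i * \<gamma> (i - k))"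
        by (rule sum.reindex_bij_witness[where i = "\<lambda>(i, k). (i - k, k)" and j = "\<lambda>(j, k). (j + k, k)"]) auto
      also have "\<dots> = (\<Sum>i\<le>m. \<Sum>k\<le>i. of_real x ^ k / fact k * log_coeff m i * \<gamma> (i - k))"
        by (rule sum.Sigma[symmetric]) auto
      finally show ?thesis .
    qed
    also have "\<dots> = (\<Sum>i\<le>m. log_coeff m i * (\<Sum>k\<le>i. of_real x ^ k / fact k * \<gamma> (i - k)))"
      by (simp add: sum_distrib_left mult_ac)
    also have "\<dots> = (\<Sum>i\<le>m. log_coeff m i * (exp (- \<kappa> * of_real x) * ?\<psi> i x))"
      unfolding \<gamma>_def twist_sum_inverse ..
    also have "\<dots> = exp (- \<kappa> * of_real x) * (\<Sum>i\<le>m. log_coeff m i * ?\<psi> i x)"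
      unfolding sum_distrib_left by (intro sum.cong refl mult.left_commute)
    also have "\<dots> = exp (- \<kappa> * of_real x) * f m (Complex x y)"
      unfolding exp_comb_inverse ..
    finally have "exp (of_real x * \<kappa>) * (\<Sum>k\<le>m. \<Sum>j\<le>m. (complex_of_real x gchoose k) * log_coeff (m - k) j * \<gamma> j)
        = (exp (of_real x * \<kappa>) * exp (- \<kappa> * of_real x)) * f m (Complex x y)" by simp
    also have "exp (of_real x * \<kappa>) * exp (- \<kappa> * of_real x) = 1"
      by (simp add: exp_add[symmetric] mult.commute)
    finally show ?thesis by (simp add: sum_distrib_left mult.assoc)
  qed
  ultimately show ?thesis by (simp only:)
qed

end

section \<open>Coefficient matrices\<close>

text \<open>Rows and columns of all matrices are counted from the bottom right corner: the index \<open>m\<close>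
  corresponds to row \<open>d - 1 - m\<close>.\<close>

definition flipped_mat :: "nat \<Rightarrow> (nat \<Rightarrow> nat \<Rightarrow> complex) \<Rightarrow> complex mat" where
  "flipped_mat d g = Matrix.mat d d (\<lambda>(i, j). if i \<le> j then g (d - 1 - i) (d - 1 - j) else 0)"

lemma flipped_mat_carrier [simp]: "flipped_mat d g \<in> carrier_mat d d"
  by (simp add: flipped_mat_def)

lemma flipped_mat_mult_vec:
  assumes "v \<in> carrier_vec d" "m < d"
  shows "(flipped_mat d g *\<^sub>v v) $ (d - 1 - m) = (\<Sum>k\<le>m. g m k * v $ (d - 1 - k))"
proof -
  have i: "d - 1 - m < d" "d - Suc (d - 1 - m) = m" using assms(2) by auto
  have "(flipped_mat d g *\<^sub>v v) $ (d - 1 - m) =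
      (\<Sum>j<d. (if d - 1 - m \<le> j then g m (d - 1 - j) else 0) * v $ j)"
    using assms i by (auto simp: flipped_mat_def scalar_prod_def atLeast0LessThan intro!: sum.cong)
  also have "\<dots> = (\<Sum>k<d. (if d - 1 - m \<le> d - 1 - k then g m k else 0) * v $ (d - 1 - k))"
    by (subst sum.nat_diff_reindex[symmetric]) (auto intro!: sum.cong)
  also have "\<dots> = (\<Sum>k\<le>m. g m k * v $ (d - 1 - k))"
    using assms(2) by (intro sum.mono_neutral_cong_right) auto
  finally show ?thesis .
qed

lemma T_mat_eq: "T_mat d = flipped_mat d (\<lambda>m k. log_coeff m k / fact k)"
proof (rule eq_matI)
  fix i j assume "i < dim_row (flipped_mat d (\<lambda>m k. log_coeff m k / fact k))"
    "j < dim_col (flipped_mat d (\<lambda>m k. log_coeff m k / fact k))"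
  then have ij: "i < d" "j < d" by (simp_all add: flipped_mat_def)
  have "of_int (sstirling m k) / fact m = log_coeff m k / (fact k :: complex)" for m k
    by (simp add: log_coeff_conv_sstirling)
  then show "T_mat d $$ (i, j) = flipped_mat d (\<lambda>m k. log_coeff m k / fact k) $$ (i, j)"
    using ij by (simp add: T_mat_def flipped_mat_def log_coeff_eq_0)
qed (simp_all add: T_mat_def flipped_mat_def)

lemma S_mat_power_eq:
  assumes "e \<in> {0, 1}"
  shows "S_mat d ^\<^sub>m e = flipped_mat d (\<lambda>m k. if k = m then (-1) ^ (e * m) else 0)"
proof (rule eq_matI)
  fix i j assume "i < dim_row (flipped_mat d (\<lambda>m k. if k = m then (-1) ^ (e * m) else 0))"
    "j < dim_col (flipped_mat d (\<lambda>m k. if k = m then (-1) ^ (e * m) else 0))"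
  then have ij: "i < d" "j < d" by (simp_all add: flipped_mat_def)
  then have "d - Suc j = d - Suc i \<longleftrightarrow> i = j" by auto
  then show "(S_mat d ^\<^sub>m e) $$ (i, j) = flipped_mat d (\<lambda>m k. if k = m then (-1) ^ (e * m) else 0) $$ (i, j)"
    using ij assms by (auto simp: S_mat_def flipped_mat_def)
qed (use assms in \<open>auto simp: S_mat_def flipped_mat_def\<close>)

lemma jordan_ilk_eq:
  "jordan_ilk d \<mu> = flipped_mat d (\<lambda>m k. if k = m \<or> m = Suc k then \<mu> else 0)"
  by (rule eq_matI) (auto simp: jordan_ilk_def flipped_mat_def)

lemma jordan_ilk_power_eq:
  "jordan_ilk_power d \<omega> \<mu> x =
     flipped_mat d (\<lambda>m k. exp (complex_of_real x * log_cut \<omega> \<mu>) * (complex_of_real x gchoose (m - k)))"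
  by (rule eq_matI) (auto simp: jordan_ilk_power_def flipped_mat_def)

text \<open>\<open>A m k\<close> is the coefficient, in component \<open>m\<close>, of the solution
  shifted by \<open>k\<close>. The ratio of factorials is conjugation by a diagonal matrix: the
  vectors in the theorem, unlike the chain solutions, are not divided by factorials.\<close>

definition coeff_mat :: "nat \<Rightarrow> (nat \<Rightarrow> nat \<Rightarrow> complex) \<Rightarrow> complex mat" where
  "coeff_mat d A = flipped_mat d (\<lambda>m k. A m (m - k) * fact m / fact k)"

lemma coeff_mat_carrier [simp]: "coeff_mat d A \<in> carrier_mat d d"
  by (simp add: coeff_mat_def)

lemma entry_coeff_mat:
  assumes "1 \<le> i" "i \<le> d" "1 \<le> j" "j \<le> d"
  shows "entry (coeff_mat d A) i j = (if i \<le> j then A (d - i) (j - i) * fact (d - i) / fact (d - j) else 0)"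
  using assms by (auto simp: entry_def coeff_mat_def flipped_mat_def)

lemma fact_falling:
  "n \<le> N \<Longrightarrow> (fact N :: complex) = fact (N - n) * (\<Prod>p<n. of_nat N - of_nat p)"
proof (induction n)
  case (Suc n)
  then have "fact (N - n) = (of_nat N - of_nat n) * (fact (N - Suc n) :: complex)"
    using fact_Suc[of "N - Suc n", where ?'a = complex] by (simp add: Suc_diff_Suc of_nat_diff)
  with Suc show ?case by (simp add: mult_ac)
qed simp

text \<open>The entry in row \<open>i\<close> and column \<open>i + p\<close> is
  \<open>a p (d - i)! / (d - i - p)!\<close>, and its ratio to the entry in row 1 is the quotient of
  the two falling products.\<close>

lemma coeff_mat_in_Coeff1: "coeff_mat d (\<lambda>m k. a k) \<in> Coeff1 d"
proof -
  have "entry (coeff_mat d (\<lambda>m k. a k)) i (i + p) =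
          entry (coeff_mat d (\<lambda>m k. a k)) 1 (1 + p) * (\<Prod>k = 1..i - 1. of_nat d - of_nat p - of_nat k)
            / (\<Prod>k = 1..i - 1. of_nat d - of_nat k)" if i: "i \<in> {1..d}" and p: "p \<in> {0..d - i}" for i p
  proof -
    have fall: "(fact (N - 1) :: complex) = fact (N - i) * (\<Prod>k = 1..i - 1. of_nat N - of_nat k)" if "i \<le> N" for N
    proof -
      have "(\<Prod>k = 1..i - 1. of_nat N - of_nat k :: complex) = (\<Prod>p<i - 1. of_nat (N - 1) - of_nat p)"
        by (rule prod.reindex_bij_witness[where i = Suc and j = "\<lambda>k. k - 1"])
           (use that i in \<open>auto simp: of_nat_diff\<close>)
      moreover have "N - 1 - (i - 1) = N - i" using i that by auto
      ultimately show ?thesis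
        using fact_falling[of "i - 1" "N - 1"] that by simp
    qed
    define P where "P = (\<Prod>k = 1..i - 1. of_nat d - of_nat k :: complex)"
    define Q where "Q = (\<Prod>k = 1..i - 1. of_nat d - of_nat p - of_nat k :: complex)"
    have P: "fact (d - 1) = fact (d - i) * P" unfolding P_def by (rule fall) (use i in simp)
    have "(fact (d - p - 1) :: complex) = fact (d - p - i) * (\<Prod>k = 1..i - 1. of_nat (d - p) - of_nat k)"
      by (rule fall) (use i p in auto)
    then have Q: "fact (d - (1 + p)) = fact (d - (i + p)) * Q"
      unfolding Q_def using i p by (simp add: of_nat_diff add.commute)
    have nz: "P \<noteq> 0" "Q \<noteq> 0"
      using P Q by (metis fact_nonzero mult_zero_right)+
    have "entry (coeff_mat d (\<lambda>m k. a k)) i (i + p) = a p * fact (d - i) / fact (d - (i + p))"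
      using i p by (subst entry_coeff_mat) auto
    moreover have "entry (coeff_mat d (\<lambda>m k. a k)) 1 (1 + p) = a p * fact (d - 1) / fact (d - (1 + p))"
      using i p by (subst entry_coeff_mat) auto
    ultimately show ?thesis
      unfolding P Q P_def[symmetric] Q_def[symmetric] using nz by simp
  qed
  moreover have "\<forall>i\<in>{1..d}. \<forall>j\<in>{1..d}. i > j \<longrightarrow> entry (coeff_mat d (\<lambda>m k. a k)) i j = 0"
    by (auto simp: entry_coeff_mat)
  ultimately show ?thesis
    unfolding Coeff1_def by simp
qed

text \<open>A diagonal step by \<open>2 k\<close> keeps the parity of the row and hence the
  coefficient, while the factorials contribute the two falling products. The entries in the second
  condition lie below the diagonal.\<close>

lemma coeff_mat_in_Coeff0:
  assumes A_odd: "\<And>m k. odd k \<Longrightarrow> A m k = 0" and A_parity: "\<And>m k. A (m + 2) k = A m k"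
  shows "coeff_mat d A \<in> Coeff0 d"
proof -
  have A_add: "A (m + 2 * k) l = A m l" for m k l
    by (induction k) (use A_parity[of "m + 2 * _" l] in \<open>auto simp: add_ac\<close>)
  have "entry (coeff_mat d A) (i + 2 * k) (j + 2 * k) =
          entry (coeff_mat d A) i j * (\<Prod>p<2 * k. of_nat d - of_nat (j + p))
            / (\<Prod>p<2 * k. of_nat d - of_nat (i + p))"
    if ij: "1 \<le> i" "1 \<le> j" "i + 2 * k \<le> d" "j + 2 * k \<le> d" for i j k
  proof (cases "i \<le> j")
    case True
    have fall: "(fact (d - l) :: complex) = fact (d - (l + 2 * k)) * (\<Prod>p<2 * k. of_nat d - of_nat (l + p))"
      if "l + 2 * k \<le> d" for l
      using fact_falling[of "2 * k" "d - l"] that by (simp add: of_nat_diff diff_diff_add)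
    define P where "P l = (\<Prod>p<2 * k. of_nat d - of_nat (l + p) :: complex)" for l
    have P: "fact (d - l) = fact (d - (l + 2 * k)) * P l" if "l + 2 * k \<le> d" for l
      unfolding P_def by (rule fall[OF that])
    have nz: "P l \<noteq> 0" if "l + 2 * k \<le> d" for l
      using P[OF that] by (metis fact_nonzero mult_zero_right)
    have "A (d - (i + 2 * k)) (j - i) = A (d - i) (j - i)"
      using A_add[of "d - (i + 2 * k)" k "j - i"] ij by simp
    then have "entry (coeff_mat d A) (i + 2 * k) (j + 2 * k) =
        A (d - i) (j - i) * fact (d - (i + 2 * k)) / fact (d - (j + 2 * k))"
      using ij True by (subst entry_coeff_mat) auto
    moreover have "entry (coeff_mat d A) i j = A (d - i) (j - i) * fact (d - i) / fact (d - j)"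
      using ij True by (subst entry_coeff_mat) auto
    ultimately show ?thesis
      unfolding P_def[symmetric] P[OF ij(3)] P[OF ij(4)] using nz[OF ij(3)] nz[OF ij(4)] by simp
  next
    case False
    then show ?thesis using ij by (simp add: entry_coeff_mat)
  qed
  moreover have "entry (coeff_mat d A) i j = 0" if "i \<in> {3..d}" "j \<in> {1..2 * ((i - 1) div 2)}" for i j
  proof -
    have "j < i" using that by auto
    then show ?thesis using that by (simp add: entry_coeff_mat)
  qed
  ultimately show ?thesis
    unfolding Coeff0_def by simp
qed

text \<open>The factorial of the row of \<open>coeff_mat\<close> cancels against the one in
  \<open>T\<close>; that of the column normalises the components of \<open>v\<close> to those of a
  chain solution.\<close>

lemma coeff_mat_apply:
  assumes e: "e \<in> {0, 1}" and v: "v \<in> carrier_vec d" and m: "m < d"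
  shows "(T_mat d * coeff_mat d A * (S_mat d ^\<^sub>m e) *\<^sub>v v) $ (d - 1 - m) =
    (\<Sum>j\<le>m. log_coeff m j * (\<Sum>k\<le>j. A j k * ((-1) ^ (e * (j - k)) * v $ (d - 1 - (j - k)) / fact (j - k))))"
proof -
  have carr: "T_mat d \<in> carrier_mat d d" "S_mat d ^\<^sub>m e \<in> carrier_mat d d"
    unfolding T_mat_eq S_mat_power_eq[OF e] by simp_all
  let ?w = "S_mat d ^\<^sub>m e *\<^sub>v v"
  have w: "?w \<in> carrier_vec d" using carr v by simp
  have wm: "?w $ (d - 1 - k) = (-1) ^ (e * k) * v $ (d - 1 - k)" if "k < d" for k
  proof -
    have "?w $ (d - 1 - k) = (\<Sum>l\<le>k. (if l = k then (-1) ^ (e * k) else 0) * v $ (d - 1 - l))"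
      unfolding S_mat_power_eq[OF e] by (rule flipped_mat_mult_vec[OF v that])
    also have "\<dots> = (\<Sum>l\<le>k. if l = k then (-1) ^ (e * k) * v $ (d - 1 - k) else 0)"
      by (intro sum.cong) auto
    finally show ?thesis by simp
  qed
  let ?z = "coeff_mat d A *\<^sub>v ?w"
  have z: "?z \<in> carrier_vec d" by (rule mult_mat_vec_carrier[OF coeff_mat_carrier w])
  have zm: "?z $ (d - 1 - j) = fact j * (\<Sum>k\<le>j. A j k * ((-1) ^ (e * (j - k)) * v $ (d - 1 - (j - k)) / fact (j - k)))"
    if "j < d" for j
  proof -
    have "?z $ (d - 1 - j) = (\<Sum>k\<le>j. A j (j - k) * fact j / fact k * ?w $ (d - 1 - k))"
      unfolding coeff_mat_def by (rule flipped_mat_mult_vec[OF w that])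
    also have "\<dots> = (\<Sum>k\<le>j. fact j * (A j (j - k) * ((-1) ^ (e * k) * v $ (d - 1 - k) / fact k)))"
      using that by (intro sum.cong refl) (subst wm, auto)
    also have "\<dots> = (\<Sum>k\<le>j. fact j * (A j k * ((-1) ^ (e * (j - k)) * v $ (d - 1 - (j - k)) / fact (j - k))))"
      by (rule sum.reindex_bij_witness[where i = "\<lambda>k. j - k" and j = "\<lambda>k. j - k"]) auto
    finally show ?thesis by (simp add: sum_distrib_left)
  qed
  have "T_mat d * coeff_mat d A * (S_mat d ^\<^sub>m e) *\<^sub>v v = T_mat d *\<^sub>v ?z"
    using carr v w by (simp add: assoc_mult_mat_vec[of _ d d _ d])
  also have "\<dots> $ (d - 1 - m) = (\<Sum>j\<le>m. log_coeff m j / fact j * ?z $ (d - 1 - j))"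
    unfolding T_mat_eq by (rule flipped_mat_mult_vec[OF z m])
  also have "\<dots> = (\<Sum>j\<le>m. log_coeff m j * (\<Sum>k\<le>j. A j k * ((-1) ^ (e * (j - k)) * v $ (d - 1 - (j - k)) / fact (j - k))))"
    using m by (intro sum.cong refl) (subst zm, auto)
  finally show ?thesis .
qed

section \<open>Fundamental systems for nonzero and zero frequency\<close>

lemma scalar_solution_cong:
  assumes "scalar_solution q v v'" "\<And>y. y > 0 \<Longrightarrow> v y = w y"
  shows "scalar_solution q w v'"
  unfolding scalar_solution_def
proof (intro allI impI conjI)
  fix y :: real assume y: "y > 0"
  show "(w has_vector_derivative v' y) (at y)"
    by (rule has_vector_derivative_transform_within_open[where S = "{0<..}" and f = v])
       (use assms y in \<open>auto simp: scalar_solution_def\<close>)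
  show "(v' has_vector_derivative q y * w y) (at y)"
    using assms y by (simp add: scalar_solution_def)
qed

lemma scalar_solution_scale:
  assumes "scalar_solution q v v'"
  shows "scalar_solution q (\<lambda>y. c * v y) (\<lambda>y. c * v' y)"
  unfolding scalar_solution_def
proof (intro allI impI conjI)
  fix y :: real assume y: "y > 0"
  show "((\<lambda>y. c * v y) has_vector_derivative c * v' y) (at y)"
    using assms y by (intro has_vector_derivative_mult_right) (simp add: scalar_solution_def)
  have "((\<lambda>y. c * v' y) has_vector_derivative c * (q y * v y)) (at y)"
    using assms y by (intro has_vector_derivative_mult_right) (simp add: scalar_solution_def)
  then show "((\<lambda>y. c * v' y) has_vector_derivative q y * (c * v y)) (at y)"
    by (simp add: mult.left_commute)
qed

lemma chain_solution_sign_power: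
  assumes "chain_solution q \<beta> \<gamma> d u" "e \<in> {0, 1 :: nat}"
  shows "chain_solution q ((-1) ^ e * \<beta>) \<gamma> d (\<lambda>m y. (-1) ^ (e * m) * u m y)"
  using assms(2) chain_solution_sign[OF assms(1)] assms(1) by auto

abbreviation signed_I :: "nat \<Rightarrow> complex \<Rightarrow> nat \<Rightarrow> complex \<Rightarrow> complex \<Rightarrow> nat \<Rightarrow> real \<Rightarrow> complex" where
  "signed_I d \<omega> e \<alpha> s m y \<equiv> (-1) ^ (e * m) * bfI d \<omega> m \<alpha> y s / fact m"

abbreviation signed_K :: "nat \<Rightarrow> complex \<Rightarrow> nat \<Rightarrow> complex \<Rightarrow> complex \<Rightarrow> nat \<Rightarrow> real \<Rightarrow> complex" where
  "signed_K d \<omega> e \<alpha> s m y \<equiv> (-1) ^ (e * m) * bfK d \<omega> m \<alpha> y s / fact m"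

text \<open>The Bessel functions are evaluated at \<open>\<beta> = (-1)^e \<alpha>\<close>, which
  lies in the slit plane. Their system has \<open>\<beta>\<close> in the first coupling; the signs
  \<open>(-1)^(e m)\<close> convert it into the system for \<open>\<alpha>\<close>, while
  \<open>\<beta>^2 = \<alpha>^2\<close> needs no change.\<close>

lemma nonzero_frequency_span:
  assumes omega: "\<omega> \<notin> complex_of_real ` {0..}" and e: "e \<in> {0, 1 :: nat}"
    and ray: "(-1) ^ e * \<alpha> \<notin> open_ray \<omega>" and \<alpha>: "\<alpha> \<noteq> 0"
    and u: "chain_solution (\<lambda>y. \<alpha>\<^sup>2 + s * (s - 1) / (of_real y)\<^sup>2) (- 2 * \<i> * \<alpha>) (- 1) d u"
  shows "\<exists>a b. \<forall>m<d. \<forall>y>0. u m y =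
    (\<Sum>k\<le>m. a k * signed_I d \<omega> e ((-1) ^ e * \<alpha>) s (m - k) y
       + b k * signed_K d \<omega> e ((-1) ^ e * \<alpha>) s (m - k) y)"
proof -
  define \<beta> where "\<beta> = (-1) ^ e * \<alpha>"
  have \<beta>: "\<beta> \<in> slit_plane \<omega>" "\<beta> \<noteq> 0" using ray \<alpha> by (simp_all add: slit_plane_def \<beta>_def)
  have \<beta>2: "\<beta>\<^sup>2 = \<alpha>\<^sup>2" "(-1) ^ e * (- 2 * \<i> * \<beta>) = - 2 * \<i> * \<alpha>" using e by (auto simp: \<beta>_def)
  have \<eta>: "(s - 1 / 2)\<^sup>2 - 1 / 4 = s * (s - 1)" by (simp add: power2_eq_square algebra_simps)
  obtain I1 K1 where
    I: "bessel_solution \<omega> (s - 1/2) (bessel_I \<omega> (s - 1/2)) I1" and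
    K: "bessel_solution \<omega> (s - 1/2) (bessel_K \<omega> (s - 1/2)) K1" and
    W: "\<And>z. z \<in> slit_plane \<omega> \<Longrightarrow> bessel_I \<omega> (s - 1/2) z * K1 z - bessel_K \<omega> (s - 1/2) z * I1 z = -1"
    using bessel_fundamental_system[OF omega, of "s - 1/2"] by blast
  let ?q = "\<lambda>y. \<alpha>\<^sup>2 + s * (s - 1) / (complex_of_real y)\<^sup>2"
  let ?P = "\<lambda>m y. (-1) ^ (e * m) * (bfI d \<omega> m \<beta> y s / fact m)"
  let ?Q = "\<lambda>m y. (-1) ^ (e * m) * (bfK d \<omega> m \<beta> y s / fact m)"
  have P: "chain_solution ?q (- 2 * \<i> * \<alpha>) (- 1) d ?P"
    using chain_solution_sign_power[OF bessel_chain_solution[OF omega I \<beta>(1), of d] e]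
    unfolding \<beta>2 \<eta> using \<beta>(2) by (simp add: bfI_def)
  have Q: "chain_solution ?q (- 2 * \<i> * \<alpha>) (- 1) d ?Q"
    using chain_solution_sign_power[OF bessel_chain_solution[OF omega K \<beta>(1), of d] e]
    unfolding \<beta>2 \<eta> using \<beta>(2) by (simp add: bfK_def)
  let ?d = "\<lambda>B B1 y. of_real (sqrt y) * ((1 / 2 * B (\<beta> * of_real y) + B1 (\<beta> * of_real y)) / of_real y)"
  have p: "scalar_solution ?q (?P 0) (?d (bessel_I \<omega> (s - 1/2)) I1)"
    using bessel_scalar_solution[OF omega I \<beta>(1)] unfolding \<beta>2 \<eta> using \<beta>(2) by (simp add: bfI_def)
  have q: "scalar_solution ?q (?Q 0) (?d (bessel_K \<omega> (s - 1/2)) K1)"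
    using bessel_scalar_solution[OF omega K \<beta>(1)] unfolding \<beta>2 \<eta> using \<beta>(2) by (simp add: bfK_def)
  have "?P 0 y * ?d (bessel_K \<omega> (s - 1/2)) K1 y - ?Q 0 y * ?d (bessel_I \<omega> (s - 1/2)) I1 y = -1"
    if y: "y > 0" for y
  proof -
    define r where "r = complex_of_real (sqrt y)"
    have r: "r * r = of_real y" "complex_of_real y \<noteq> 0"
      using y by (simp_all add: r_def flip: of_real_mult)
    have z: "\<beta> * of_real y \<in> slit_plane \<omega>" by (rule slit_plane_scale[OF omega \<beta>(1) y])
    \<comment> \<open>The halves come from differentiating \<open>sqrt y\<close> and cancel;
      \<open>r * r / y = 1\<close> then leaves the Wronskian of \<open>I\<close> and
      \<open>K\<close>.\<close>
    have gen: "r * B * (r * ((1 / 2 * C + C1) / of_real y)) - r * C * (r * ((1 / 2 * B + B1) / of_real y))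
        = (r * r) / of_real y * (B * C1 - C * B1)" for B B1 C C1
      by (simp add: diff_divide_distrib add_divide_distrib algebra_simps)
    have "?P 0 y = r * bessel_I \<omega> (s - 1/2) (\<beta> * of_real y)" "?Q 0 y = r * bessel_K \<omega> (s - 1/2) (\<beta> * of_real y)"
      using \<beta>(2) by (simp_all add: bfI_def bfK_def r_def)
    then show ?thesis
      unfolding r_def[symmetric] by (simp only: gen W[OF z]) (use r in simp)
  qed
  from chain_solution_span[OF u P Q p q this] show ?thesis
    unfolding \<beta>_def[symmetric] by (simp only: times_divide_eq_right) simp
qed

text \<open>The parity classes are solved independently with the same base pair, giving one
  coefficient sequence for each class \<open>r\<close>. In \<open>A m k\<close> the class is
  \<open>m mod 2\<close>, and odd shifts, which would mix the classes, get coefficient 0.\<close>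

lemma zero_frequency_span:
  assumes e: "e \<in> {0, 1 :: nat}"
    and u: "chain_solution (\<lambda>y. s * (s - 1) / (of_real y)\<^sup>2) 0 (- 1) d u"
  shows "\<exists>A B. (\<forall>m k. odd k \<longrightarrow> A m k = 0 \<and> B m k = 0) \<and> (\<forall>m k. A (m + 2) k = A m k \<and> B (m + 2) k = B m k) \<and>
    (\<forall>m<d. \<forall>y>0. u m y =
    (\<Sum>k\<le>m. A m k * signed_I d \<omega> e 0 s (m - k) y
       + B m k * signed_K d \<omega> e 0 s (m - k) y))"
proof -
  let ?q = "\<lambda>y. s * (s - 1) / (complex_of_real y)\<^sup>2"
  define P where "P = (\<lambda>m y. (-1) ^ (e * m) * (bfI d \<omega> m 0 y s / fact m))"
  define Q where "Q = (\<lambda>m y. (-1) ^ (e * m) * (bfK d \<omega> m 0 y s / fact m))"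
  have P: "chain_solution ?q 0 (- 1) d P" and Q: "chain_solution ?q 0 (- 1) d Q"
    using chain_solution_sign_power[OF bfI_zero_chain_solution e, of s d \<omega>]
      chain_solution_sign_power[OF bfK_zero_chain_solution e, of s d \<omega>]
    by (simp_all add: P_def Q_def)
  let ?p = "\<lambda>y. of_real y powr s * ((if s = 1/2 then 1 else 0) * of_real (ln y) + (if s = 1/2 then 0 else 1))"
  let ?r = "\<lambda>y. of_real y powr (1 - s) * (0 * of_real (ln y) + 1)"
  obtain p' q' W where pq: "scalar_solution ?q ?p p'" "scalar_solution ?q ?r q'" "W \<noteq> 0"
    "\<And>y. y > 0 \<Longrightarrow> ?p y * q' y - ?r y * p' y = W"
    using zero_base_fundamental_system[of s] by blast
  have "\<exists>a b. \<forall>m<(d + 1 - r) div 2. \<forall>y>0. u (2 * m + r) y = (\<Sum>k\<le>m. a k * P (2 * (m - k) + r) y + b k * Q (2 * (m - k) + r) y)"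
    if r: "r < 2" for r
  proof (rule chain_solution_span)
    show "chain_solution ?q (- 1) 0 ((d + 1 - r) div 2) (\<lambda>m. u (2 * m + r))"
      "chain_solution ?q (- 1) 0 ((d + 1 - r) div 2) (\<lambda>m. P (2 * m + r))"
      "chain_solution ?q (- 1) 0 ((d + 1 - r) div 2) (\<lambda>m. Q (2 * m + r))"
      by (intro chain_solution_parity u P Q r)+
    \<comment> \<open>The constant value of the sign on the parity class; its square is 1, so the
      Wronskian is unaffected.\<close>
    let ?s = "(-1) ^ (e * r) :: complex"
    have base: "P (2 * 0 + r) y = ?s * ?p y" "Q (2 * 0 + r) y = ?s * ?r y" if "y > 0" for y
      by (simp_all only: P_def Q_def mult_0_right add_0 bfI_zero_base[OF r that] bfK_zero_base[OF r that])
    show "scalar_solution ?q (P (2 * 0 + r)) (\<lambda>y. ?s * p' y)"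
      by (rule scalar_solution_cong[OF scalar_solution_scale[OF pq(1)]]) (simp only: base)
    show "scalar_solution ?q (Q (2 * 0 + r)) (\<lambda>y. ?s * q' y)"
      by (rule scalar_solution_cong[OF scalar_solution_scale[OF pq(2)]]) (simp only: base)
    show "P (2 * 0 + r) y * (?s * q' y) - Q (2 * 0 + r) y * (?s * p' y) = W" if "y > 0" for y
    proof -
      have "?s * ?s = 1" by (simp flip: power_add)
      moreover have "?s * X * (?s * Y) - ?s * Z * (?s * V) = (?s * ?s) * (X * Y - Z * V)" for X Y Z V
        by (simp add: algebra_simps)
      ultimately show ?thesis unfolding base[OF that] pq(4)[OF that, symmetric] by (simp only: mult_1_left)
    qed
  qed (rule pq(3))
  then have "\<forall>r\<in>{..<2}. \<exists>a b. \<forall>m<(d + 1 - r) div 2. \<forall>y>0. u (2 * m + r) y = (\<Sum>k\<le>m. a k * P (2 * (m - k) + r) y + b k * Q (2 * (m - k) + r) y)"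
    by blast
  then obtain a b where ab: "\<And>r m y. r < 2 \<Longrightarrow> m < (d + 1 - r) div 2 \<Longrightarrow> y > 0 \<Longrightarrow>
      u (2 * m + r) y = (\<Sum>k\<le>m. a r k * P (2 * (m - k) + r) y + b r k * Q (2 * (m - k) + r) y)"
    unfolding bchoice_iff by auto
  define A where "A m k = (if even k then a (m mod 2) (k div 2) else 0)" for m k :: nat
  define B where "B m k = (if even k then b (m mod 2) (k div 2) else 0)" for m k :: nat
  have "u m y = (\<Sum>k\<le>m. A m k * P (m - k) y + B m k * Q (m - k) y)" if m: "m < d" and y: "y > 0" for m y
  proof -
    define r h where "r = m mod 2" and "h = m div 2"
    have mh: "m = 2 * h + r" "r < 2" by (simp_all add: r_def h_def)
    then have hd: "h < (d + 1 - r) div 2" using m by linarith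
    have "(\<Sum>k\<le>m. A m k * P (m - k) y + B m k * Q (m - k) y)
        = (\<Sum>k\<in>(\<lambda>k. 2 * k) ` {..h}. A m k * P (m - k) y + B m k * Q (m - k) y)"
    proof (rule sum.mono_neutral_right)
      show "\<forall>k\<in>{..m} - (\<lambda>k. 2 * k) ` {..h}. A m k * P (m - k) y + B m k * Q (m - k) y = 0"
      proof
        fix k assume k: "k \<in> {..m} - (\<lambda>k. 2 * k) ` {..h}"
        have "odd k"
        proof
          assume "even k"
          then obtain l where "k = 2 * l" by blast
          moreover from this have "l \<le> h" using k mh by simp
          ultimately show False using k by auto
        qed
        then show "A m k * P (m - k) y + B m k * Q (m - k) y = 0" by (simp add: A_def B_def)
      qed
    qed (use mh in auto)
    also have "\<dots> = (\<Sum>k\<le>h. A m (2 * k) * P (m - 2 * k) y + B m (2 * k) * Q (m - 2 * k) y)"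
      by (subst sum.reindex) (auto simp: inj_on_def)
    also have "\<dots> = (\<Sum>k\<le>h. a r k * P (2 * (h - k) + r) y + b r k * Q (2 * (h - k) + r) y)"
    proof (intro sum.cong refl)
      fix k assume "k \<in> {..h}"
      then have "m - 2 * k = 2 * (h - k) + r" using mh by simp
      then show "A m (2 * k) * P (m - 2 * k) y + B m (2 * k) * Q (m - 2 * k) y =
          a r k * P (2 * (h - k) + r) y + b r k * Q (2 * (h - k) + r) y"
        by (simp add: A_def B_def r_def)
    qed
    also have "\<dots> = u m y" unfolding mh(1) by (rule ab[OF mh(2) hd y, symmetric])
    finally show ?thesis ..
  qed
  then show ?thesis
    by (intro exI[of _ A] exI[of _ B]) (simp add: A_def B_def P_def Q_def)
qed

section \<open>The expansion\<close>

theorem theorem2p4: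
  fixes d :: nat and lam \<omega> s :: complex and eps :: "int \<Rightarrow> nat"
    and f :: "complex \<Rightarrow> complex vec"
  assumes d: "d \<ge> 1"
    and lam: "lam \<noteq> 0"
    and omega_not_nonneg: "\<omega> \<notin> complex_of_real ` {0..}"
    and omega_choice: "\<And>n::int.
          - \<i> * Ln lam + 2 * complex_of_real pi * of_int n \<notin> open_ray \<omega> \<or>
          \<i> * Ln lam - 2 * complex_of_real pi * of_int n \<notin> open_ray \<omega>"
    and eps01: "\<And>n. eps n \<in> {0, 1}"
    and eps_choice: "\<And>n. (-1) ^ eps n * freq \<omega> lam n \<notin> open_ray \<omega>"
    and f_dim: "\<And>z. z \<in> upper_half_plane \<Longrightarrow> f z \<in> carrier_vec d"
    and f_smooth: "\<And>i. i < d \<Longrightarrow> smooth_on upper_half_plane (\<lambda>z. f z $ i)"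
    and f_eigen: "\<And>z i. z \<in> upper_half_plane \<Longrightarrow> i < d \<Longrightarrow>
          hyp_laplacian (\<lambda>w. f w $ i) z = s * (1 - s) * (f z $ i)"
    and f_twist: "\<And>z. z \<in> upper_half_plane \<Longrightarrow> f (z + 1) = jordan_ilk d lam *\<^sub>v f z"
  shows "\<exists>fhat :: int \<Rightarrow> real \<Rightarrow> complex vec.
    (\<forall>z\<in>upper_half_plane. \<forall>i<d.
       ((\<lambda>n. (exp (2 * complex_of_real pi * \<i> * of_int n * complex_of_real (Re z))
                \<cdot>\<^sub>v (jordan_ilk_power d \<omega> lam (Re z) *\<^sub>v fhat n (Im z))) $ i)
          has_sum (f z $ i)) UNIV) \<and>
    (\<forall>n. \<exists>C D.
       (if (-1) ^ eps n * freq \<omega> lam n = 0 \<and> freq \<omega> lam n = 0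
        then C \<in> Coeff0 d \<and> D \<in> Coeff0 d
        else C \<in> Coeff1 d \<and> D \<in> Coeff1 d) \<and>
       (\<forall>y>0. fhat n y =
          T_mat d * C * (S_mat d ^\<^sub>m eps n) *\<^sub>v I_vec d \<omega> ((-1) ^ eps n * freq \<omega> lam n) y s +
          T_mat d * D * (S_mat d ^\<^sub>m eps n) *\<^sub>v K_vec d \<omega> ((-1) ^ eps n * freq \<omega> lam n) y s))"
proof -
  define \<kappa> where "\<kappa> = log_cut \<omega> lam"
  have exp_\<kappa>: "exp \<kappa> = lam"
    unfolding \<kappa>_def by (rule exp_log_cut[OF omega_not_nonneg lam])
  \<comment> \<open>Numbering from the bottom turns the superdiagonal of \<open>J\<close> into a
    coupling of \<open>k\<close> to \<open>k - 1\<close>.\<close>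
  define F where "F k z = f z $ (d - 1 - k)" for k z
  have smooth: "smooth_on upper_half_plane (F k)" if "k < d" for k
    using f_smooth[of "d - 1 - k"] that by (simp add: F_def[abs_def])
  have eigen: "hyp_laplacian (F k) z = s * (1 - s) * F k z" if "k < d" "z \<in> upper_half_plane" for k z
    using f_eigen[OF that(2), of "d - 1 - k"] that(1) by (simp add: F_def[abs_def])
  have twist: "F k (z + 1) = lam * (F k z + (if k \<ge> 1 then F (k - 1) z else 0))"
    if k: "k < d" and z: "z \<in> upper_half_plane" for k z
  proof -
    have "F k (z + 1) = (\<Sum>j\<le>k. (if j = k \<or> k = Suc j then lam else 0) * F j z)"
      unfolding F_def f_twist[OF z] jordan_ilk_eq by (rule flipped_mat_mult_vec[OF f_dim[OF z] k])
    also have "\<dots> = lam * (F k z + (if k \<ge> 1 then F (k - 1) z else 0))"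
    proof (cases k)
      case (Suc l)
      have "(\<Sum>j<l. (if j = Suc l \<or> Suc l = Suc j then lam else 0) * F j z) = 0"
        by (intro sum.neutral) auto
      then show ?thesis
        by (simp add: Suc algebra_simps flip: lessThan_Suc_atMost)
    qed simp
    finally show ?thesis .
  qed
  define u where "u = mode F \<kappa>"
  \<comment> \<open>This is \<open>T\<close> applied to the column of the
    \<open>fact j * u n j\<close>, and it is the inner sum of the mode expansion.\<close>
  define fhat where "fhat n y = Matrix.vec d (\<lambda>i. \<Sum>j\<le>d - 1 - i. log_coeff (d - 1 - i) j * u n j y)" for n y
  have "((\<lambda>n. (exp (2 * complex_of_real pi * \<i> * of_int n * complex_of_real (Re z))
                \<cdot>\<^sub>v (jordan_ilk_power d \<omega> lam (Re z) *\<^sub>v fhat n (Im z))) $ i)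
          has_sum (f z $ i)) UNIV" if z: "z \<in> upper_half_plane" and i: "i < d" for z i
  proof -
    define m where "m = d - 1 - i"
    have m: "m < d" "d - 1 - m = i" using i by (auto simp: m_def)
    have y: "Im z > 0" using z by (simp add: upper_half_plane_def)
    have "(exp (2 * complex_of_real pi * \<i> * of_int n * complex_of_real (Re z))
          \<cdot>\<^sub>v (jordan_ilk_power d \<omega> lam (Re z) *\<^sub>v fhat n (Im z))) $ i
        = fourier_char n (Re z) * (exp (of_real (Re z) * \<kappa>) * (\<Sum>k\<le>m. (complex_of_real (Re z) gchoose k) *
           (\<Sum>j\<le>m - k. log_coeff (m - k) j * u n j (Im z))))" for n
    proof -
      have fh: "fhat n (Im z) \<in> carrier_vec d" by (simp add: fhat_def)
      have "(jordan_ilk_power d \<omega> lam (Re z) *\<^sub>v fhat n (Im z)) $ i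
          = (\<Sum>k\<le>m. exp (of_real (Re z) * \<kappa>) * (complex_of_real (Re z) gchoose (m - k)) * fhat n (Im z) $ (d - 1 - k))"
        unfolding jordan_ilk_power_eq \<kappa>_def m(2)[symmetric] by (rule flipped_mat_mult_vec[OF fh m(1)])
      also have "\<dots> = (\<Sum>k\<le>m. exp (of_real (Re z) * \<kappa>) * (complex_of_real (Re z) gchoose k) * fhat n (Im z) $ (d - 1 - (m - k)))"
        by (rule sum.reindex_bij_witness[where i = "\<lambda>k. m - k" and j = "\<lambda>k. m - k"]) auto
      also have "\<dots> = exp (of_real (Re z) * \<kappa>) * (\<Sum>k\<le>m. (complex_of_real (Re z) gchoose k) *
           (\<Sum>j\<le>m - k. log_coeff (m - k) j * u n j (Im z)))"
      proof (subst sum_distrib_left, intro sum.cong refl)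
        fix k
        have "d - 1 - (m - k) < d" "d - 1 - (d - 1 - (m - k)) = m - k" using m(1) by auto
        then have "fhat n (Im z) $ (d - 1 - (m - k)) = (\<Sum>j\<le>m - k. log_coeff (m - k) j * u n j (Im z))"
          by (simp add: fhat_def)
        then show "exp (of_real (Re z) * \<kappa>) * (complex_of_real (Re z) gchoose k) * fhat n (Im z) $ (d - 1 - (m - k))
          = exp (of_real (Re z) * \<kappa>) * ((complex_of_real (Re z) gchoose k) * (\<Sum>j\<le>m - k. log_coeff (m - k) j * u n j (Im z)))"
          by (simp only: mult.assoc)
      qed
      finally have J: "(jordan_ilk_power d \<omega> lam (Re z) *\<^sub>v fhat n (Im z)) $ i = \<dots>" .
      have "dim_vec (jordan_ilk_power d \<omega> lam (Re z) *\<^sub>v fhat n (Im z)) = d"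
        by (simp add: jordan_ilk_power_def)
      then show ?thesis
        using i by (simp only: index_smult_vec J fourier_char_def)
    qed
    moreover have "f z $ i = F m (Complex (Re z) (Im z))"
      unfolding F_def m(2) by simp
    ultimately show ?thesis
      unfolding u_def using mode_expansion[OF smooth eigen twist exp_\<kappa> m(1) y, of "Re z"] by (simp only:)
  qed
  moreover have "\<exists>C D.
       (if (-1) ^ eps n * freq \<omega> lam n = 0 \<and> freq \<omega> lam n = 0
        then C \<in> Coeff0 d \<and> D \<in> Coeff0 d
        else C \<in> Coeff1 d \<and> D \<in> Coeff1 d) \<and>
       (\<forall>y>0. fhat n y =
          T_mat d * C * (S_mat d ^\<^sub>m eps n) *\<^sub>v I_vec d \<omega> ((-1) ^ eps n * freq \<omega> lam n) y s +
          T_mat d * D * (S_mat d ^\<^sub>m eps n) *\<^sub>v K_vec d \<omega> ((-1) ^ eps n * freq \<omega> lam n) y s)" for n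
  proof -
    define \<alpha> where "\<alpha> = freq \<omega> lam n"
    define \<beta> where "\<beta> = (-1) ^ eps n * \<alpha>"
    \<comment> \<open>The exponent of the mode is \<open>\<i>\<close> times the frequency, which
      turns minus its square into \<open>\<alpha>^2\<close>.\<close>
    have a: "\<kappa> + 2 * complex_of_real pi * \<i> * of_int n = \<i> * \<alpha>"
      by (simp add: \<alpha>_def freq_def \<kappa>_def algebra_simps)
    have a2: "- (\<i> * \<alpha>)\<^sup>2 = \<alpha>\<^sup>2" "- 2 * (\<i> * \<alpha>) = - 2 * \<i> * \<alpha>" by (simp_all add: power_mult_distrib)
    have u: "chain_solution (\<lambda>y. \<alpha>\<^sup>2 + s * (s - 1) / (of_real y)\<^sup>2) (- 2 * \<i> * \<alpha>) (- 1) d (u n)"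
      using mode_chain_solution[OF smooth eigen twist exp_\<kappa>, where n = n] unfolding a a2 u_def .
    \<comment> \<open>Common to both cases, which differ only in how the coefficients may depend on
      the row \<open>m\<close>.\<close>
    have final: "fhat n y = T_mat d * coeff_mat d A * (S_mat d ^\<^sub>m eps n) *\<^sub>v I_vec d \<omega> \<beta> y s +
          T_mat d * coeff_mat d B * (S_mat d ^\<^sub>m eps n) *\<^sub>v K_vec d \<omega> \<beta> y s"
      if AB: "\<And>m. m < d \<Longrightarrow> u n m y = (\<Sum>k\<le>m. A m k * signed_I d \<omega> (eps n) \<beta> s (m - k) y
         + B m k * signed_K d \<omega> (eps n) \<beta> s (m - k) y)" for A B y
    proof (rule eq_vecI)
      let ?X = "\<lambda>A v. T_mat d * coeff_mat d A * (S_mat d ^\<^sub>m eps n) *\<^sub>v v"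
      show "dim_vec (fhat n y) = dim_vec (?X A (I_vec d \<omega> \<beta> y s) + ?X B (K_vec d \<omega> \<beta> y s))"
        by (simp add: fhat_def T_mat_def)
      fix i assume "i < dim_vec (?X A (I_vec d \<omega> \<beta> y s) + ?X B (K_vec d \<omega> \<beta> y s))"
      then have i: "i < d" by (simp add: T_mat_def)
      define m where "m = d - 1 - i"
      have m: "m < d" "i = d - 1 - m" using i by (auto simp: m_def)
      have idx: "I_vec d \<omega> \<beta> y s $ (d - 1 - k) = bfI d \<omega> k \<beta> y s" "K_vec d \<omega> \<beta> y s $ (d - 1 - k) = bfK d \<omega> k \<beta> y s"
        if "k < d" for k
      proof -
        have "d - 1 - k < d" "d - 1 - (d - 1 - k) = k" using that by auto
        then show "I_vec d \<omega> \<beta> y s $ (d - 1 - k) = bfI d \<omega> k \<beta> y s" "K_vec d \<omega> \<beta> y s $ (d - 1 - k) = bfK d \<omega> k \<beta> y s"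
          by (simp_all add: I_vec_def K_vec_def)
      qed
      have "(?X A (I_vec d \<omega> \<beta> y s) + ?X B (K_vec d \<omega> \<beta> y s)) $ i
          = ?X A (I_vec d \<omega> \<beta> y s) $ i + ?X B (K_vec d \<omega> \<beta> y s) $ i"
        by (rule index_add_vec(1)) (simp add: T_mat_def i)
      also have "\<dots> = (\<Sum>j\<le>m. log_coeff m j * (\<Sum>k\<le>j. A j k * signed_I d \<omega> (eps n) \<beta> s (j - k) y))
          + (\<Sum>j\<le>m. log_coeff m j * (\<Sum>k\<le>j. B j k * signed_K d \<omega> (eps n) \<beta> s (j - k) y))"
      proof -
        have X: "?X A (I_vec d \<omega> \<beta> y s) $ i = (\<Sum>j\<le>m. log_coeff m j * (\<Sum>k\<le>j. A j k * ((-1) ^ (eps n * (j - k)) * I_vec d \<omega> \<beta> y s $ (d - 1 - (j - k)) / fact (j - k))))"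
          "?X B (K_vec d \<omega> \<beta> y s) $ i = (\<Sum>j\<le>m. log_coeff m j * (\<Sum>k\<le>j. B j k * ((-1) ^ (eps n * (j - k)) * K_vec d \<omega> \<beta> y s $ (d - 1 - (j - k)) / fact (j - k))))"
          unfolding m(2) by (rule coeff_mat_apply[OF eps01 _ m(1)]; simp add: I_vec_def K_vec_def)+
        have "(\<Sum>j\<le>m. log_coeff m j * (\<Sum>k\<le>j. G j k * (e (j - k) * v (j - k) / fact (j - k))))
            = (\<Sum>j\<le>m. log_coeff m j * (\<Sum>k\<le>j. G j k * (e (j - k) * w (j - k) / fact (j - k))))"
          if "\<And>k. k < d \<Longrightarrow> v k = w k" for G v w and e :: "nat \<Rightarrow> complex"
          by (intro sum.cong refl arg_cong2[where f = "(*)"]) (use m(1) that in simp)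
        from this[of "\<lambda>k. I_vec d \<omega> \<beta> y s $ (d - 1 - k)" "\<lambda>k. bfI d \<omega> k \<beta> y s" A "\<lambda>k. (-1) ^ (eps n * k)", OF idx(1)]
          this[of "\<lambda>k. K_vec d \<omega> \<beta> y s $ (d - 1 - k)" "\<lambda>k. bfK d \<omega> k \<beta> y s" B "\<lambda>k. (-1) ^ (eps n * k)", OF idx(2)]
        show ?thesis unfolding X by (simp only:)
      qed
      also have "\<dots> = (\<Sum>j\<le>m. log_coeff m j * u n j y)"
        unfolding sum.distrib[symmetric] distrib_left[symmetric]
        by (intro sum.cong refl) (use m(1) AB in simp)
      also have "\<dots> = fhat n y $ i" using i by (simp add: fhat_def m_def)
      finally show "fhat n y $ i = (?X A (I_vec d \<omega> \<beta> y s) + ?X B (K_vec d \<omega> \<beta> y s)) $ i" ..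
    qed
    show ?thesis
    proof (cases "\<alpha> = 0")
      case True
      \<comment> \<open>The sign does not affect vanishing, so the two conditions that select
        \<open>Coeff0\<close> hold together.\<close>
      then have \<beta>0: "\<beta> = 0" by (simp add: \<beta>_def)
      have "chain_solution (\<lambda>y. s * (s - 1) / (of_real y)\<^sup>2) 0 (- 1) d (u n)"
        using u True by simp
      from zero_frequency_span[OF eps01[of n] this, where \<omega> = \<omega>] obtain A B where
        AB: "\<forall>m k. odd k \<longrightarrow> A m k = 0 \<and> B m k = 0"
          "\<forall>m k. A (m + 2) k = A m k \<and> B (m + 2) k = B m k"
        and span: "\<forall>m<d. \<forall>y>0. u n m y =
          (\<Sum>k\<le>m. A m k * signed_I d \<omega> (eps n) 0 s (m - k) y
             + B m k * signed_K d \<omega> (eps n) 0 s (m - k) y)"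
        by (elim exE conjE) (rule that)
      have "coeff_mat d A \<in> Coeff0 d"
        by (rule coeff_mat_in_Coeff0) (use AB in blast)+
      moreover have "coeff_mat d B \<in> Coeff0 d"
        by (rule coeff_mat_in_Coeff0) (use AB in blast)+
      moreover have "\<forall>y>0. fhat n y = T_mat d * coeff_mat d A * (S_mat d ^\<^sub>m eps n) *\<^sub>v I_vec d \<omega> \<beta> y s +
          T_mat d * coeff_mat d B * (S_mat d ^\<^sub>m eps n) *\<^sub>v K_vec d \<omega> \<beta> y s"
        by (intro allI impI final) (use span \<beta>0 in simp)
      ultimately show ?thesis
        unfolding \<alpha>_def[symmetric] \<beta>_def[symmetric] using True \<beta>0
        by (intro exI[of _ "coeff_mat d A"] exI[of _ "coeff_mat d B"]) simp
    next
      case False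
      from nonzero_frequency_span[OF omega_not_nonneg eps01[of n] eps_choice[of n, folded \<alpha>_def] False u, folded \<beta>_def] obtain a b where
        span: "\<forall>m<d. \<forall>y>0. u n m y =
          (\<Sum>k\<le>m. a k * signed_I d \<omega> (eps n) \<beta> s (m - k) y
             + b k * signed_K d \<omega> (eps n) \<beta> s (m - k) y)"
        by (elim exE) (rule that)
      \<comment> \<open>Coefficients independent of the row are what \<open>Coeff1\<close>
        encodes.\<close>
      let ?C = "\<lambda>a. coeff_mat d (\<lambda>m k. a k)"
      have "\<forall>y>0. fhat n y = T_mat d * ?C a * (S_mat d ^\<^sub>m eps n) *\<^sub>v I_vec d \<omega> \<beta> y s +
          T_mat d * ?C b * (S_mat d ^\<^sub>m eps n) *\<^sub>v K_vec d \<omega> \<beta> y s"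
        by (intro allI impI final span[rule_format])
      then show ?thesis
        unfolding \<alpha>_def[symmetric] \<beta>_def[symmetric] using False
        by (intro exI[of _ "?C a"] exI[of _ "?C b"]) (simp add: coeff_mat_in_Coeff1)
    qed
  qed
  ultimately show ?thesis by blast
qed

end
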